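(* Let $\lambda\vdash n$, let $i$ be a part of $\lambda$, and let $r\ge 1$. For $\pi\in\mathcal{C}_{\lambda,i}$, the number of sequences $(\tau_1,\dots,\tau_r)$ of star transpositions with $\tau_1\tau_2\cdots\tau_r=\pi$ is \[ [K_{\lambda,i}]J_n^r = \sum_{\substack{\mu\vdash n\\ j\in\mu}}\frac{d_\mu}{n!}\,\gamma^{\mu,j}_{\lambda,i}\,c_{\mu,j}^{\,r}, \] where the sum is over all $\mu\vdash n$ and distinct parts $j$ of $\mu$.
   Context: $\mathfrak{S}_n$ is the symmetric group on $\{1,\dots,n\}$ (products read right to left), $\mathbb{C}[\mathfrak{S}_n]$ its group algebra, and $Z_1(n)$ the set of elements commuting with every element of the subgroup $\mathfrak{S}_{n-1}$ fixing $n$. A star transposition is a transposition $(j,n)$ with $1\le j\le n-1$; $J_n=\sum_{1\le j<n}(j,n)$. For a part $i$ of $\lambda\vdash n$, $\mathcal{C}_{\lambda,i}$ is the set of permutations of cycle type $\lambda$ in which $n$ lies on a cycle of length $i$, and $K_{\lambda,i}$ is the sum of its elements; these form a basis of $Z_1(n)$ and $[K_{\lambda,i}]g$ denotes the coefficient. $d_\mu$ is the number of standard Young tableaux of shape $\mu$. $c_{\mu,j}:=j-\sum_{k\ge j}m_k(\mu)$, where $m_k(\mu)$ is the multiplicity of $k$ as a part of $\mu$ (the content, column minus row, of the cell containing $n$ when $n$ sits at the end of a row of length $j$). $e_T$ is Young's seminormal unit of a standard Young tableau $T$; $\mathrm{SYT}_{\mu,j}$ is the set of standard Young tableaux of shape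 $\mu$ with $n$ at the end of a row of length $j$; $\Gamma^{\mu,j}=\sum_{T\in\mathrm{SYT}_{\mu,j}}e_T\in Z_1(n)$. Generalized characters: $\gamma^{\mu,j}_{\lambda,i}:=\frac{n!}{d_\mu}[K_{\lambda,i}]\Gamma^{\mu,j}$. *)

theory Defs
  imports Complex_Main
    "HOL-Library.Multiset"
    "HOL-Combinatorics.Orbits"
    "HOL-Algebra.Sym_Groups"
    "HOL-Algebra.Module"
begin

section \<open>The group algebra of the symmetric group\<close>

text \<open>Elements of \<open>\<complex>[S\<^sub>n]\<close> are coefficient functions vanishing off \<open>S\<^sub>n\<close>.  As permutations in
  \<open>S\<^sub>n\<^sub>-\<^sub>1\<close> are maps on all of \<^typ>\<open>nat\<close> fixing \<open>n\<close>, the inclusion of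
  \<open>\<complex>[S\<^sub>n\<^sub>-\<^sub>1]\<close> into \<open>\<complex>[S\<^sub>n]\<close> is the identity on functions.\<close>

type_synonym alg_elt = "(nat \<Rightarrow> nat) \<Rightarrow> complex"

definition of_perm :: "(nat \<Rightarrow> nat) \<Rightarrow> alg_elt" where
  "of_perm \<pi> = (\<lambda>\<sigma>. if \<sigma> = \<pi> then 1 else 0)"

definition sym_alg :: "nat \<Rightarrow> (complex, alg_elt) module" where
  "sym_alg n =
     \<lparr> carrier = {a. \<forall>\<sigma>. \<sigma> \<notin> carrier (sym_group n) \<longrightarrow> a \<sigma> = 0},
       mult = (\<lambda>a b \<sigma>. \<Sum>\<rho>\<in>carrier (sym_group n). a \<rho> * b (Hilbert_Choice.inv \<rho> \<circ> \<sigma>)),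
       one = of_perm id,
       zero = (\<lambda>\<sigma>. 0),
       add = (\<lambda>a b \<sigma>. a \<sigma> + b \<sigma>),
       smult = (\<lambda>c a \<sigma>. c * a \<sigma>) \<rparr>"

definition star_transpositions :: "nat \<Rightarrow> (nat \<Rightarrow> nat) set" where
  "star_transpositions n = {Transposition.transpose j n | j. 1 \<le> j \<and> j < n}"

definition jucys_murphy :: "nat \<Rightarrow> alg_elt" where
  "jucys_murphy n = (\<Oplus>\<^bsub>sym_alg n\<^esub>j\<in>{1..<n}. of_perm (Transposition.transpose j n))"


section \<open>Partitions and near-central classes\<close>

definition partition_of :: "nat multiset \<Rightarrow> nat \<Rightarrow> bool" (infix \<open>\<turnstile>\<close> 50) where
  "\<mu> \<turnstile> n \<longleftrightarrow> 0 \<notin># \<mu> \<and> \<Sum>\<^sub># \<mu> = n"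

definition marked_partitions :: "nat \<Rightarrow> (nat multiset \<times> nat) set" where
  "marked_partitions n = {(\<mu>, j). \<mu> \<turnstile> n \<and> j \<in># \<mu>}"

definition cycle_type :: "nat \<Rightarrow> (nat \<Rightarrow> nat) \<Rightarrow> nat multiset" where
  "cycle_type n \<sigma> = image_mset card (mset_set (Orbits.orbit \<sigma> ` {1..n}))"

definition marked_class :: "nat \<Rightarrow> nat multiset \<Rightarrow> nat \<Rightarrow> (nat \<Rightarrow> nat) set" where
  "marked_class n \<mu> j =
     {\<sigma> \<in> carrier (sym_group n). cycle_type n \<sigma> = \<mu> \<and> card (Orbits.orbit \<sigma> n) = j}"

definition class_sum :: "nat \<Rightarrow> nat multiset \<Rightarrow> nat \<Rightarrow> alg_elt" where
  "class_sum n \<mu> j = (\<Oplus>\<^bsub>sym_alg n\<^esub>\<sigma>\<in>marked_class n \<mu> j. of_perm \<sigma>)"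

text \<open>\<open>[K\<^sub>\<mu>\<^sub>,\<^sub>j] g\<close>: the coefficient of \<^term>\<open>class_sum n \<mu> j\<close> in the expansion of \<open>g\<close> in the basis of all the
  \<^const>\<open>class_sum\<close>; it is meaningful only for \<open>g\<close> in their span, the centralizer \<open>Z\<^sub>1(n)\<close> of
  \<open>S\<^sub>n\<^sub>-\<^sub>1\<close>.\<close>

definition K_coeff :: "nat \<Rightarrow> nat multiset \<Rightarrow> nat \<Rightarrow> alg_elt \<Rightarrow> complex" where
  "K_coeff n \<mu> j g =
     (THE c. \<exists>a. c = a (\<mu>, j) \<and>
        g = (\<Oplus>\<^bsub>sym_alg n\<^esub>p\<in>marked_partitions n. a p \<odot>\<^bsub>sym_alg n\<^esub> class_sum n (fst p) (snd p)))"

definition end_content :: "nat multiset \<Rightarrow> nat \<Rightarrow> int" where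
  "end_content \<mu> j = int j - int (\<Sum>k | k \<in># \<mu> \<and> j \<le> k. count \<mu> k)"


section \<open>Standard Young tableaux and Young's seminormal units\<close>

text \<open>A tableau is the list of its rows, longest row first (English notation).\<close>

type_synonym tableau = "nat list list"

definition standard_tableau :: "nat \<Rightarrow> tableau \<Rightarrow> bool" where
  "standard_tableau n T \<longleftrightarrow>
     [] \<notin> set T \<and> sorted_wrt (\<ge>) (map length T) \<and>
     distinct (concat T) \<and> set (concat T) = {1..n} \<and>
     (\<forall>row\<in>set T. sorted_wrt (<) row) \<and>
     (\<forall>r c. Suc r < length T \<longrightarrow> c < length (T ! Suc r) \<longrightarrow> T ! r ! c < T ! Suc r ! c)"

definition tableau_shape :: "tableau \<Rightarrow> nat multiset" where
  "tableau_shape T = mset (map length T)"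

definition SYT :: "nat multiset \<Rightarrow> tableau set" where
  "SYT \<mu> = {T. standard_tableau (\<Sum>\<^sub># \<mu>) T \<and> tableau_shape T = \<mu>}"

definition num_SYT :: "nat multiset \<Rightarrow> nat" where
  "num_SYT \<mu> = card (SYT \<mu>)"

definition SYT_marked :: "nat \<Rightarrow> nat multiset \<Rightarrow> nat \<Rightarrow> tableau set" where
  "SYT_marked n \<mu> j =
     {T. standard_tableau n T \<and> tableau_shape T = \<mu> \<and> (\<exists>row\<in>set T. length row = j \<and> last row = n)}"

definition tableau_column :: "tableau \<Rightarrow> nat \<Rightarrow> nat set" where
  "tableau_column T c = {T ! r ! c | r. r < length T \<and> c < length (T ! r)}"

definition row_stabilizer :: "nat \<Rightarrow> tableau \<Rightarrow> (nat \<Rightarrow> nat) set" where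
  "row_stabilizer n T = {\<sigma> \<in> carrier (sym_group n). \<forall>row\<in>set T. \<sigma> ` set row = set row}"

definition column_stabilizer :: "nat \<Rightarrow> tableau \<Rightarrow> (nat \<Rightarrow> nat) set" where
  "column_stabilizer n T = {\<sigma> \<in> carrier (sym_group n). \<forall>c. \<sigma> ` tableau_column T c = tableau_column T c}"

definition row_symmetrizer :: "nat \<Rightarrow> tableau \<Rightarrow> alg_elt" where
  "row_symmetrizer n T = (\<Oplus>\<^bsub>sym_alg n\<^esub>\<sigma>\<in>row_stabilizer n T. of_perm \<sigma>)"

definition column_antisymmetrizer :: "nat \<Rightarrow> tableau \<Rightarrow> alg_elt" where
  "column_antisymmetrizer n T =
     (\<Oplus>\<^bsub>sym_alg n\<^esub>\<sigma>\<in>column_stabilizer n T. of_int (sign \<sigma>) \<odot>\<^bsub>sym_alg n\<^esub> of_perm \<sigma>)"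

definition young_symmetrizer :: "nat \<Rightarrow> tableau \<Rightarrow> alg_elt" where
  "young_symmetrizer n T =
     (of_nat (num_SYT (tableau_shape T)) / fact n) \<odot>\<^bsub>sym_alg n\<^esub>
       (row_symmetrizer n T \<otimes>\<^bsub>sym_alg n\<^esub> column_antisymmetrizer n T)"

definition remove_entry :: "nat \<Rightarrow> tableau \<Rightarrow> tableau" where
  "remove_entry m T = filter (\<lambda>row. row \<noteq> []) (map (removeAll m) T)"

text \<open>Young's recursion: if \<open>T'\<close> is \<open>T\<close> without its largest entry, then
  \<open>e\<^sub>T = e\<^sub>T\<^sub>' (d\<^sub>\<mu> / n!) P\<^sub>T N\<^sub>T e\<^sub>T\<^sub>'\<close>, starting from \<open>e\<^sub>T = 1\<close>.  The first argument is
  the size of the tableau.\<close>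

primrec seminormal_unit :: "nat \<Rightarrow> tableau \<Rightarrow> alg_elt" where
  "seminormal_unit 0 T = \<one>\<^bsub>sym_alg 0\<^esub>"
| "seminormal_unit (Suc n) T =
     seminormal_unit n (remove_entry (Suc n) T) \<otimes>\<^bsub>sym_alg (Suc n)\<^esub>
     young_symmetrizer (Suc n) T \<otimes>\<^bsub>sym_alg (Suc n)\<^esub>
     seminormal_unit n (remove_entry (Suc n) T)"

definition Gamma_elt :: "nat \<Rightarrow> nat multiset \<Rightarrow> nat \<Rightarrow> alg_elt" where
  "Gamma_elt n \<mu> j = (\<Oplus>\<^bsub>sym_alg n\<^esub>T\<in>SYT_marked n \<mu> j. seminormal_unit n T)"

definition gen_char :: "nat \<Rightarrow> nat multiset \<Rightarrow> nat \<Rightarrow> nat multiset \<Rightarrow> nat \<Rightarrow> complex" where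
  "gen_char n \<mu> j lam i = fact n / of_nat (num_SYT \<mu>) * K_coeff n lam i (Gamma_elt n \<mu> j)"

end

theory Submission
  imports Defs "HOL-Library.Poly_Mapping"
begin

text \<open>Young's seminormal units \<open>e\<^sub>T\<close>, with \<open>T\<close> ranging over the standard tableaux of size \<open>n\<close>, form a
  complete system of orthogonal idempotents of \<open>\<complex>[S\<^sub>n]\<close>, and \<open>J\<^sub>n e\<^sub>T = c e\<^sub>T\<close>, where \<open>c\<close> is the content of
  the cell of \<open>n\<close> in \<open>T\<close>. Hence \<open>J\<^sub>n\<^sup>r = \<Sum>\<^sub>T c\<^sup>r e\<^sub>T\<close>, and grouping the tableaux by shape and by the row of
  \<open>n\<close> gives the formula.

  Let \<open>P N\<close> be the product of the row symmetrizer and the column antisymmetrizer of \<open>T\<close>. By von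
  Neumann's lemma \<open>P x N\<close> is a multiple of \<open>P N\<close> for every \<open>x\<close>, so \<open>(P N)\<^sup>2 = \<theta> P N\<close> for a scalar \<open>\<theta>\<close>, and
  \<open>\<theta> \<noteq> 0\<close> because \<open>P N P\<close> is self-adjoint. The units are first built with the factor \<open>1 / \<theta>\<close>; reading off
  the coefficient of the identity shows that they are orthogonal idempotents. Completeness is a
  dimension count: the corner \<open>e\<^sub>T \<complex>[S\<^sub>n\<^sub>+\<^sub>1] e\<^sub>T\<close> has dimension at most one plus the number of removable cells
  of \<open>T\<close>, which is the number of addable cells and hence of units refining \<open>e\<^sub>T\<close>. Only then is \<open>\<theta>\<close>
  identified with \<open>n! / d\<^sub>\<mu>\<close>, by averaging \<open>e\<^sub>T\<close> over conjugation. The eigenvalues come from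
  \<open>J\<^sub>n = z\<^sub>n - z\<^sub>n\<^sub>-\<^sub>1\<close>, where the sum \<open>z\<^sub>n\<close> of all transpositions of \<open>S\<^sub>n\<close> is central and acts on \<open>P N\<close> by
  the sum of the contents.\<close>

section \<open>Group algebras\<close>

text \<open>Groups are written additively, without being commutative, so that \<^typ>\<open>'a \<Rightarrow>\<^sub>0 'b\<close> with its convolution
  product is the group algebra.\<close>

abbreviation coef :: "('a \<Rightarrow>\<^sub>0 'b::zero) \<Rightarrow> 'a \<Rightarrow> 'b" where
  "coef \<equiv> Poly_Mapping.lookup"

abbreviation delta :: "'a \<Rightarrow> ('a \<Rightarrow>\<^sub>0 'b::zero_neq_one)" where
  "delta a \<equiv> Poly_Mapping.single a 1"

abbreviation trace :: "('a::zero \<Rightarrow>\<^sub>0 'b::zero) \<Rightarrow> 'b" where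
  "trace x \<equiv> coef x 0"

definition scale :: "'b \<Rightarrow> ('a \<Rightarrow>\<^sub>0 'b) \<Rightarrow> ('a::group_add \<Rightarrow>\<^sub>0 'b::comm_ring_1)"  (infixr \<open>\<star>\<close> 75) where
  "c \<star> x = Poly_Mapping.single 0 c * x"

lemma delta_plus: "delta (a + b) = (delta a * delta b :: 'a::group_add \<Rightarrow>\<^sub>0 'b::comm_ring_1)"
  by (simp add: mult_single)

lemma delta_cancel [simp]:
  fixes a :: "'a::group_add"
  shows "delta a * delta (- a) = (1 :: 'a \<Rightarrow>\<^sub>0 'b::comm_ring_1)"
    and "delta (- a) * delta a = (1 :: 'a \<Rightarrow>\<^sub>0 'b)"
  by (simp_all flip: delta_plus)

lemma delta_cancel_left [simp]:
  fixes x :: "'a::group_add \<Rightarrow>\<^sub>0 'b::comm_ring_1"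
  shows "delta a * (delta (- a) * x) = x" "delta (- a) * (delta a * x) = x"
  by (simp_all flip: mult.assoc)

lemma scale_delta: "c \<star> delta a = Poly_Mapping.single a c"
  by (simp add: scale_def mult_single)

lemma coef_mult:
  fixes x y :: "'a::group_add \<Rightarrow>\<^sub>0 'b::comm_ring_1"
  assumes "finite S" "Poly_Mapping.keys x \<subseteq> S"
  shows "coef (x * y) a = (\<Sum>b\<in>S. coef x b * coef y (- b + a))"
proof -
  have solve: "a = b + q \<longleftrightarrow> q = - b + a" for b q
    by (metis add.assoc add.left_neutral left_minus right_minus)
  have "coef (x * y) a = (\<Sum>b. coef x b * coef y (- b + a))"
    unfolding lookup_mult solve by simp
  also have "\<dots> = (\<Sum>b\<in>S. coef x b * coef y (- b + a))"
    using assms by (intro Sum_any.expand_superset)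
      (auto simp: in_keys_iff subset_iff, metis mult_zero_left)
  finally show ?thesis .
qed

lemma coef_delta_mult: "coef (delta b * x) a = coef x (- b + a)"
  for x :: "'a::group_add \<Rightarrow>\<^sub>0 'b::comm_ring_1"
  by (subst coef_mult[of "{b}"]) auto

lemma coef_scale [simp]: "coef (c \<star> x) a = c * coef x a"
  unfolding scale_def by (subst coef_mult[of "{0}"]) auto

lemma scale_zero [simp]: "0 \<star> x = 0" "c \<star> 0 = 0"
  by (simp_all add: scale_def)

lemma one_scale [simp]: "1 \<star> x = x"
  by (simp add: scale_def)

lemma scale_distrib:
  "c \<star> (x + y) = c \<star> x + c \<star> y" "(c + d) \<star> x = c \<star> x + d \<star> x"
  "c \<star> (x - y) = c \<star> x - c \<star> y" "(c - d) \<star> x = c \<star> x - d \<star> x"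
  by (simp_all add: scale_def algebra_simps single_add single_diff)

lemma scale_sum: "c \<star> sum f I = (\<Sum>i\<in>I. c \<star> f i)"
  by (simp add: scale_def sum_distrib_left)

lemma sum_scale: "sum f I \<star> x = (\<Sum>i\<in>I. f i \<star> x)"
  by (induction I rule: infinite_finite_induct) (auto simp: scale_distrib)

lemma group_algebra_expand:
  fixes x :: "'a::group_add \<Rightarrow>\<^sub>0 'b::comm_ring_1"
  assumes "finite S" "Poly_Mapping.keys x \<subseteq> S"
  shows "x = (\<Sum>a\<in>S. coef x a \<star> delta a)"
proof (rule poly_mapping_eqI)
  fix b
  have "coef (\<Sum>a\<in>S. coef x a \<star> delta a) b = (\<Sum>a\<in>S. if b = a then coef x a else 0)"
    by (auto simp: lookup_sum scale_delta lookup_single when_def intro!: sum.cong)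
  also have "\<dots> = coef x b"
    using assms by (auto simp: in_keys_iff)
  finally show "coef x b = coef (\<Sum>a\<in>S. coef x a \<star> delta a) b" by simp
qed

lemma group_algebra_induct [consumes 1, case_names zero delta add]:
  fixes x :: "'a::group_add \<Rightarrow>\<^sub>0 'b::comm_ring_1"
  assumes keys: "Poly_Mapping.keys x \<subseteq> S" and zero: "Q 0"
    and delta: "\<And>a c. a \<in> S \<Longrightarrow> Q (c \<star> delta a)"
    and add: "\<And>x y. Q x \<Longrightarrow> Q y \<Longrightarrow> Q (x + y)"
  shows "Q x"
proof -
  have "Q (\<Sum>a\<in>A. coef x a \<star> delta a)" if "finite A" "A \<subseteq> S" for A
    using that by (induction A rule: finite_induct) (auto intro: assms)
  then have "Q (\<Sum>a\<in>Poly_Mapping.keys x. coef x a \<star> delta a)" using keys by simp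
  then show ?thesis by (simp flip: group_algebra_expand)
qed

lemma scalar_commute: "x * Poly_Mapping.single 0 c = c \<star> x"
  for x :: "'a::group_add \<Rightarrow>\<^sub>0 'b::comm_ring_1"
  by (induction x rule: group_algebra_induct[OF subset_UNIV])
    (simp_all add: scale_def mult_single mult.commute distrib_left distrib_right)

lemma scale_simps:
  "c \<star> (d \<star> x) = (c * d) \<star> x" "x * (c \<star> y) = c \<star> (x * y)" "(c \<star> x) * y = c \<star> (x * y)"
proof -
  show assoc: "(c \<star> x) * y = c \<star> (x * y)" for x y by (simp add: scale_def mult.assoc)
  have "(c * d) \<star> x = (c \<star> Poly_Mapping.single 0 d) * x" by (simp add: scale_def mult_single)
  then show "c \<star> (d \<star> x) = (c * d) \<star> x" unfolding assoc by (simp only: scale_def)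
  have "x * (c \<star> y) = (x * Poly_Mapping.single 0 c) * y" by (simp add: scale_def mult.assoc)
  then show "x * (c \<star> y) = c \<star> (x * y)" unfolding scalar_commute assoc .
qed

lemma scale_eq_zero_iff [simp]: "c \<star> x = 0 \<longleftrightarrow> c = 0 \<or> x = 0"
  for c :: "'b::field" and x :: "'a::group_add \<Rightarrow>\<^sub>0 'b"
proof
  assume zero: "c \<star> x = 0"
  show "c = 0 \<or> x = 0"
  proof (rule disjCI)
    assume "x \<noteq> 0"
    then obtain a where "coef x a \<noteq> 0"
      by (metis lookup_zero poly_mapping_eqI)
    then show "c = 0"
      using arg_cong[OF zero, of "\<lambda>y. coef y a"] by simp
  qed
qed auto

lemma scale_left_cancel: "c \<noteq> 0 \<Longrightarrow> c \<star> x = c \<star> y \<Longrightarrow> x = y"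
  for c :: "'b::field" and x y :: "'a::group_add \<Rightarrow>\<^sub>0 'b"
  using scale_eq_zero_iff[of c "x - y"] by (simp add: scale_distrib)

interpretation group_algebra: vector_space "scale :: 'b::field \<Rightarrow> ('a::group_add \<Rightarrow>\<^sub>0 'b) \<Rightarrow> _"
  by unfold_locales (simp_all add: scale_distrib scale_simps)

lemma trace_commute: "trace (x * y) = trace (y * x)"
  for x y :: "'a::group_add \<Rightarrow>\<^sub>0 'b::comm_ring_1"
proof -
  define S where "S = Poly_Mapping.keys x \<union> uminus ` Poly_Mapping.keys y"
  have "trace (x * y) = (\<Sum>b\<in>S. coef x b * coef y (- b))"
    by (subst coef_mult[of S]) (auto simp: S_def)
  also have "\<dots> = (\<Sum>b\<in>uminus ` S. coef y b * coef x (- b))"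
    by (subst sum.reindex) (auto simp: inj_on_def mult.commute)
  also have "\<dots> = trace (y * x)"
    by (subst coef_mult[of "uminus ` S"]) (auto simp: S_def image_Un image_image)
  finally show ?thesis .
qed

lemma trace_mult_delta: "trace (x * delta a) = coef x (- a)"
  for x :: "'a::group_add \<Rightarrow>\<^sub>0 'b::comm_ring_1"
  by (subst trace_commute) (simp add: coef_delta_mult)

lemma coef_mult_delta: "coef (x * delta b) a = coef x (a - b)"
  for x :: "'a::group_add \<Rightarrow>\<^sub>0 'b::comm_ring_1"
proof -
  have "coef (x * delta b) a = trace (x * delta b * delta (- a))" by (simp add: trace_mult_delta)
  also have "\<dots> = trace (x * delta (b + - a))" by (simp only: delta_plus mult.assoc)
  also have "\<dots> = coef x (- (b + - a))" by (rule trace_mult_delta)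
  also have "- (b + - a) = a - b" by simp
  finally show ?thesis .
qed

lemma coef_power_sum_delta:
  fixes T :: "'a::group_add set"
  assumes "finite T"
  shows "coef ((\<Sum>t\<in>T. delta t :: 'a \<Rightarrow>\<^sub>0 'b::comm_ring_1) ^ r) a =
    of_nat (card {ts. length ts = r \<and> set ts \<subseteq> T \<and> sum_list ts = a})"
proof (induction r arbitrary: a)
  case 0
  have "{ts. length ts = 0 \<and> set ts \<subseteq> T \<and> sum_list ts = a} = (if a = 0 then {[]} else {})"
    by auto
  then show ?case unfolding power_0 by (simp only:) (simp add: lookup_one when_def)
next
  case (Suc r)
  let ?L = "\<lambda>r a. {ts. length ts = r \<and> set ts \<subseteq> T \<and> sum_list ts = a}"
  have fin: "finite (?L r b)" for b
    by (rule finite_subset[OF _ finite_lists_length_eq[OF assms, of r]]) auto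
  have solve: "t + b = a \<longleftrightarrow> b = - t + a" for t b :: 'a
    by (metis add.assoc add_0 left_minus right_minus)
  have "?L (Suc r) a = (\<lambda>(t, ts). t # ts) ` (SIGMA t:T. ?L r (- t + a))"
  proof (rule Set.set_eqI)
    show "us \<in> ?L (Suc r) a \<longleftrightarrow> us \<in> (\<lambda>(t, ts). t # ts) ` (SIGMA t:T. ?L r (- t + a))" for us
      by (cases us) (auto simp: solve image_iff)
  qed
  moreover have "inj_on (\<lambda>(t, ts). t # ts) (SIGMA t:T. ?L r (- t + a))" by (auto simp: inj_on_def)
  ultimately have "card (?L (Suc r) a) = (\<Sum>t\<in>T. card (?L r (- t + a)))"
    using assms fin by (simp add: card_image card_SigmaI)
  then show ?case
    by (simp add: sum_distrib_right lookup_sum coef_delta_mult Suc.IH)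
qed

definition adjoint :: "('a::group_add \<Rightarrow>\<^sub>0 complex) \<Rightarrow> ('a \<Rightarrow>\<^sub>0 complex)" where
  "adjoint x = Poly_Mapping.map_key uminus (Poly_Mapping.map cnj x)"

lemma coef_adjoint [simp]: "coef (adjoint x) a = cnj (coef x (- a))"
  unfolding adjoint_def by (simp add: map_key.rep_eq map.rep_eq when_def)

lemma adjoint_zero [simp]: "adjoint 0 = 0"
  by (rule poly_mapping_eqI) simp

lemma adjoint_add: "adjoint (x + y) = adjoint x + adjoint y"
  by (rule poly_mapping_eqI) (simp add: lookup_add)

lemma adjoint_scale: "adjoint (c \<star> x) = cnj c \<star> adjoint x"
  by (rule poly_mapping_eqI) simp

lemma adjoint_sum: "adjoint (sum f I) = (\<Sum>i\<in>I. adjoint (f i))"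
  by (rule poly_mapping_eqI) (simp add: lookup_sum)

lemma adjoint_delta [simp]: "adjoint (delta a) = delta (- a)"
  by (rule poly_mapping_eqI) (auto simp: lookup_single when_def)

lemma adjoint_delta_mult: "adjoint (delta a * y) = adjoint y * delta (- a)"
  by (rule poly_mapping_eqI) (simp add: coef_delta_mult coef_mult_delta minus_add)

lemma adjoint_mult: "adjoint (x * y) = adjoint y * adjoint x"
  by (induction x rule: group_algebra_induct[OF subset_UNIV])
    (simp_all add: distrib_left distrib_right adjoint_add adjoint_scale adjoint_delta_mult scale_simps)

lemma trace_mult_adjoint_eq_zero_iff: "trace (x * adjoint x) = 0 \<longleftrightarrow> x = 0"
proof
  assume "trace (x * adjoint x) = 0"
  then have "(\<Sum>a\<in>Poly_Mapping.keys x. coef x a * cnj (coef x a)) = 0"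
    by (subst (asm) coef_mult[of "Poly_Mapping.keys x"]) simp_all
  then have "of_real (\<Sum>a\<in>Poly_Mapping.keys x. (cmod (coef x a))\<^sup>2) = (0 :: complex)"
    by (simp add: complex_norm_square del: of_real_power)
  then have "(\<Sum>a\<in>Poly_Mapping.keys x. (cmod (coef x a))\<^sup>2) = 0" by (simp only: of_real_eq_0_iff)
  then show "x = 0"
    by (subst (asm) sum_nonneg_eq_0_iff) (auto simp: in_keys_iff intro: poly_mapping_eqI)
qed simp

section \<open>Sums over subgroups weighted by a character\<close>

definition add_subgroup :: "'a::group_add set \<Rightarrow> bool" where
  "add_subgroup H \<longleftrightarrow> 0 \<in> H \<and> (\<forall>a\<in>H. \<forall>b\<in>H. a + b \<in> H) \<and> (\<forall>a\<in>H. - a \<in> H)"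

definition linear_character :: "('a::group_add \<Rightarrow> 'b::comm_ring_1) \<Rightarrow> bool" where
  "linear_character \<chi> \<longleftrightarrow> \<chi> 0 = 1 \<and> (\<forall>a b. \<chi> (a + b) = \<chi> a * \<chi> b)"

definition char_sum :: "('a::group_add \<Rightarrow> 'b::comm_ring_1) \<Rightarrow> 'a set \<Rightarrow> ('a \<Rightarrow>\<^sub>0 'b)" where
  "char_sum \<chi> H = (\<Sum>a\<in>H. \<chi> a \<star> delta a)"

lemma add_subgroupD:
  assumes "add_subgroup H"
  shows "0 \<in> H" "a \<in> H \<Longrightarrow> b \<in> H \<Longrightarrow> a + b \<in> H" "- a \<in> H \<longleftrightarrow> a \<in> H"
proof -
  show "0 \<in> H" "a \<in> H \<Longrightarrow> b \<in> H \<Longrightarrow> a + b \<in> H"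
    using assms by (auto simp: add_subgroup_def)
  show "- a \<in> H \<longleftrightarrow> a \<in> H"
    using assms unfolding add_subgroup_def by (metis minus_minus)
qed

lemma linear_characterD:
  assumes "linear_character \<chi>"
  shows "\<chi> 0 = 1" "\<chi> (a + b) = \<chi> a * \<chi> b" "\<chi> (- a) * \<chi> a = 1"
  using assms unfolding linear_character_def by (blast, blast, metis left_minus)

lemma bij_betw_plus_subgroup:
  assumes "add_subgroup H" "a \<in> H"
  shows "bij_betw ((+) a) H H" "bij_betw (\<lambda>b. b + a) H H"
proof -
  show "bij_betw ((+) a) H H"
    by (rule bij_betw_byWitness[where f' = "(+) (- a)"])
      (use assms in \<open>auto simp: add_subgroupD simp flip: add.assoc\<close>)
  show "bij_betw (\<lambda>b. b + a) H H"
    by (rule bij_betw_byWitness[where f' = "\<lambda>b. b + - a"])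
      (use assms in \<open>auto simp: add_subgroupD add.assoc simp del: add_uminus_conv_diff\<close>)
qed

lemma char_sum_absorbs:
  assumes H: "add_subgroup H" "a \<in> H" and \<chi>: "linear_character \<chi>"
  shows "delta a * char_sum \<chi> H = \<chi> (- a) \<star> char_sum \<chi> H"
    and "char_sum \<chi> H * delta a = \<chi> (- a) \<star> char_sum \<chi> H"
proof -
  have weight: "\<chi> (- a) * (\<chi> a * \<chi> b) = \<chi> b" for b
    using linear_characterD(3)[OF \<chi>] by (simp flip: mult.assoc)
  have "delta a * char_sum \<chi> H = (\<Sum>b\<in>H. \<chi> (- a) \<star> (\<chi> (a + b) \<star> delta (a + b)))"
    by (simp add: char_sum_def sum_distrib_left scale_simps delta_plus linear_characterD(2)[OF \<chi>] weight)
  also have "\<dots> = \<chi> (- a) \<star> char_sum \<chi> H"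
    unfolding char_sum_def scale_sum by (rule sum.reindex_bij_betw[OF bij_betw_plus_subgroup(1)[OF H]])
  finally show "delta a * char_sum \<chi> H = \<chi> (- a) \<star> char_sum \<chi> H" .
  have "char_sum \<chi> H * delta a = (\<Sum>b\<in>H. \<chi> (- a) \<star> (\<chi> (b + a) \<star> delta (b + a)))"
    by (simp add: char_sum_def sum_distrib_right scale_simps delta_plus linear_characterD(2)[OF \<chi>]
        mult.commute[of "\<chi> _" "\<chi> a"] weight)
  also have "\<dots> = \<chi> (- a) \<star> char_sum \<chi> H"
    unfolding char_sum_def scale_sum by (rule sum.reindex_bij_betw[OF bij_betw_plus_subgroup(2)[OF H]])
  finally show "char_sum \<chi> H * delta a = \<chi> (- a) \<star> char_sum \<chi> H" .
qed

lemma char_sum_square: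
  assumes "add_subgroup H" "linear_character \<chi>"
  shows "char_sum \<chi> H * char_sum \<chi> H = of_nat (card H) \<star> char_sum \<chi> H"
proof -
  have "char_sum \<chi> H * char_sum \<chi> H = (\<Sum>a\<in>H. (\<chi> a * \<chi> (- a)) \<star> char_sum \<chi> H)"
    by (subst (1) char_sum_def)
      (simp add: sum_distrib_right scale_simps char_sum_absorbs[OF assms(1) _ assms(2)])
  also have "\<dots> = (\<Sum>a\<in>H. 1) \<star> char_sum \<chi> H"
    unfolding sum_scale by (intro sum.cong refl) (metis linear_characterD(3)[OF assms(2)] mult.commute)
  finally show ?thesis by simp
qed

lemma delta_conj_char_sum:
  assumes "linear_character \<chi>" "bij_betw (\<lambda>b. a + b + - a) H H'"
  shows "delta a * char_sum \<chi> H = char_sum \<chi> H' * delta a"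
proof -
  have conj: "\<chi> (a + b + - a) = \<chi> b" for b
    using linear_characterD(3)[OF assms(1), of a]
    by (simp only: linear_characterD(2)[OF assms(1)]) (metis mult.assoc mult.commute mult_1)
  have "char_sum \<chi> H' = (\<Sum>b\<in>H. \<chi> b \<star> delta (a + b + - a))"
    unfolding char_sum_def sum.reindex_bij_betw[OF assms(2), symmetric] conj ..
  then show ?thesis
    by (simp add: char_sum_def sum_distrib_left sum_distrib_right scale_simps mult_single add.assoc
        del: add_uminus_conv_diff)
qed

lemma adjoint_char_sum:
  assumes "add_subgroup H" "\<And>a. cnj (\<chi> a) = \<chi> (- a)"
  shows "adjoint (char_sum \<chi> H) = char_sum \<chi> H"
  unfolding char_sum_def adjoint_sum adjoint_scale adjoint_delta assms(2)
  by (rule sum.reindex_bij_witness[of _ uminus uminus]) (auto simp: add_subgroupD[OF assms(1)])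

section \<open>The group algebra of the finitary symmetric group\<close>

typedef fperm = "{f :: nat \<Rightarrow> nat. \<exists>n. f permutes {1..n}}"
  morphisms app Fperm
  using permutes_id by blast

setup_lifting type_definition_fperm

lemma finitary_perm_comp:
  assumes "\<exists>n. f permutes {1..n::nat}" "\<exists>n. g permutes {1..n}"
  shows "\<exists>n. f \<circ> g permutes {1..n}"
proof -
  obtain n m where "f permutes {1..n}" "g permutes {1..m}" using assms by blast
  then have "f permutes {1..max n m}" "g permutes {1..max n m}"
    by (auto elim!: permutes_subset)
  then show ?thesis using permutes_compose by blast
qed

instantiation fperm :: group_add
begin

lift_definition zero_fperm :: fperm is id using permutes_id by blast

lift_definition plus_fperm :: "fperm \<Rightarrow> fperm \<Rightarrow> fperm" is "(\<circ>)"
  by (rule finitary_perm_comp)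

lift_definition uminus_fperm :: "fperm \<Rightarrow> fperm" is "Hilbert_Choice.inv"
  using permutes_inv by blast

definition minus_fperm :: "fperm \<Rightarrow> fperm \<Rightarrow> fperm" where
  "minus_fperm a b = a + - b"

instance
proof
  show "a + b + c = a + (b + c)" for a b c :: fperm by transfer (rule comp_assoc)
  show "0 + a = a" for a :: fperm by transfer simp
  show "a + 0 = a" for a :: fperm by transfer simp
  show "- a + a = 0" for a :: fperm by transfer (auto simp: permutes_inv_o)
  show "a + - b = a - b" for a b :: fperm by (simp add: minus_fperm_def)
qed

end

lemma app_plus [simp]: "app (a + b) x = app a (app b x)"
  by transfer simp

lemma app_zero [simp]: "app 0 x = x"
  by transfer simp

lemma app_uminus_app [simp]: "app (- a) (app a x) = x" "app a (app (- a) x) = x"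
  by (metis app_plus app_zero left_minus) (metis app_plus app_zero right_minus)

lemma fperm_eqI: "(\<And>x. app a x = app b x) \<Longrightarrow> a = b"
  by (metis app_inject ext)

lemma app_eq_iff [simp]: "app a x = app a y \<longleftrightarrow> x = y"
  by (metis app_uminus_app(1))

lemma permutation_app: "permutation (app a)"
  using app[of a] permutation_permutes by blast

lemma app_Fperm: "f permutes {1..n} \<Longrightarrow> app (Fperm f) = f"
  by (auto intro!: Fperm_inverse)

definition fsign :: "fperm \<Rightarrow> complex" where
  "fsign a = of_int (sign (app a))"

lemma linear_character_fsign: "linear_character fsign"
  by (simp add: linear_character_def fsign_def plus_fperm.rep_eq zero_fperm.rep_eq sign_compose permutation_app)

lemma linear_character_one: "linear_character (\<lambda>a. 1)"
  by (simp add: linear_character_def)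

lemma fsign_uminus [simp]: "fsign (- a) = fsign a"
  by (simp add: fsign_def uminus_fperm.rep_eq sign_inverse permutation_app)

lemma cnj_fsign [simp]: "cnj (fsign a) = fsign a"
  by (simp add: fsign_def)

lift_definition fswap :: "nat \<Rightarrow> nat \<Rightarrow> fperm" is
  "\<lambda>a b. if 1 \<le> a \<and> 1 \<le> b then Transposition.transpose a b else id"
proof -
  fix a b :: nat
  show "\<exists>n. (if 1 \<le> a \<and> 1 \<le> b then Transposition.transpose a b else id) permutes {1..n}"
    by (rule exI[of _ "max a b"]) (auto intro: permutes_swap_id permutes_id)
qed

lemma app_fswap: "1 \<le> a \<Longrightarrow> 1 \<le> b \<Longrightarrow> app (fswap a b) = Transposition.transpose a b"
  by transfer simp

lemma fswap_commute: "fswap a b = fswap b a"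
  by (rule fperm_eqI) (simp add: fswap.rep_eq transpose_commute)

lemma fswap_twice [simp]: "fswap a b + fswap a b = 0"
  by (rule fperm_eqI) (simp add: fswap.rep_eq)

lemma fsign_fswap: "1 \<le> a \<Longrightarrow> 1 \<le> b \<Longrightarrow> a \<noteq> b \<Longrightarrow> fsign (fswap a b) = - 1"
  by (simp add: fsign_def app_fswap sign_swap_id)

definition Sym :: "nat \<Rightarrow> fperm set" where
  "Sym n = {a. app a permutes {1..n}}"

lemma Fperm_in_Sym: "f permutes {1..n} \<Longrightarrow> Fperm f \<in> Sym n"
  by (simp add: Sym_def app_Fperm)

lemma bij_betw_app_Sym: "bij_betw app (Sym n) {f. f permutes {1..n}}"
  unfolding bij_betw_def inj_on_def
  by (auto simp: app_inject Sym_def image_iff) (metis One_nat_def app_Fperm)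

lemma finite_Sym [simp]: "finite (Sym n)"
  using bij_betw_finite[OF bij_betw_app_Sym, of n] finite_permutations[of "{1..n}"] by simp

lemma card_Sym: "card (Sym n) = fact n"
  using bij_betw_same_card[OF bij_betw_app_Sym, of n] card_permutations[of "{1..n}" n] by simp

lemma zero_in_Sym [simp]: "0 \<in> Sym n"
  by (simp add: Sym_def zero_fperm.rep_eq permutes_id)

lemma plus_in_Sym: "a \<in> Sym n \<Longrightarrow> b \<in> Sym n \<Longrightarrow> a + b \<in> Sym n"
  by (simp add: Sym_def plus_fperm.rep_eq permutes_compose)

lemma uminus_in_Sym [simp]: "- a \<in> Sym n \<longleftrightarrow> a \<in> Sym n"
  by (metis Sym_def mem_Collect_eq minus_minus permutes_inv uminus_fperm.rep_eq)

lemma add_subgroup_Sym: "add_subgroup (Sym n)"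
  by (simp add: add_subgroup_def plus_in_Sym)

lemma fswap_in_Sym: "a \<in> {1..n} \<Longrightarrow> b \<in> {1..n} \<Longrightarrow> fswap a b \<in> Sym n"
  by (simp add: Sym_def app_fswap permutes_swap_id)

lemma Sym_mono: "m \<le> n \<Longrightarrow> Sym m \<subseteq> Sym n"
  by (auto simp: Sym_def intro: permutes_subset)

lemma app_in_iff: "a \<in> Sym n \<Longrightarrow> app a x \<in> {1..n} \<longleftrightarrow> x \<in> {1..n}"
  by (simp only: Sym_def mem_Collect_eq permutes_in_image)

lemma app_outside: "a \<in> Sym n \<Longrightarrow> x \<notin> {1..n} \<Longrightarrow> app a x = x"
  by (simp add: Sym_def permutes_not_in del: atLeastAtMost_iff)

lemma Sym_Suc_fixing: "a \<in> Sym (Suc n) \<Longrightarrow> app a (Suc n) = Suc n \<Longrightarrow> a \<in> Sym n"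
  unfolding Sym_def mem_Collect_eq
  by (rule permutes_superset) (auto simp: le_Suc_eq)

lemma Sym_0: "Sym 0 = {0}"
  by (auto simp: Sym_def zero_fperm.rep_eq permutes_id intro!: fperm_eqI)

type_synonym galg = "fperm \<Rightarrow>\<^sub>0 complex"

definition CSym :: "nat \<Rightarrow> galg set" where
  "CSym n = {x. Poly_Mapping.keys x \<subseteq> Sym n}"

lemma coef_outside_Sym: "x \<in> CSym n \<Longrightarrow> a \<notin> Sym n \<Longrightarrow> coef x a = 0"
  by (auto simp: CSym_def in_keys_iff)

lemma CSym_I: "(\<And>a. a \<notin> Sym n \<Longrightarrow> coef x a = 0) \<Longrightarrow> x \<in> CSym n"
  by (auto simp: CSym_def in_keys_iff)

lemma CSym_delta [simp]: "a \<in> Sym n \<Longrightarrow> delta a \<in> CSym n"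
  by (auto simp: CSym_def)

lemma CSym_one [simp]: "1 \<in> CSym n"
  using CSym_delta[OF zero_in_Sym] by simp

lemma CSym_add: "x \<in> CSym n \<Longrightarrow> y \<in> CSym n \<Longrightarrow> x + y \<in> CSym n"
  by (auto simp: lookup_add coef_outside_Sym intro!: CSym_I)

lemma CSym_scale: "x \<in> CSym n \<Longrightarrow> c \<star> x \<in> CSym n"
  by (auto simp: coef_outside_Sym intro!: CSym_I)

lemma CSym_sum: "(\<And>i. i \<in> I \<Longrightarrow> f i \<in> CSym n) \<Longrightarrow> sum f I \<in> CSym n"
  by (intro CSym_I) (auto simp: lookup_sum intro!: sum.neutral intro: coef_outside_Sym)

lemma CSym_mult: "x \<in> CSym n \<Longrightarrow> y \<in> CSym n \<Longrightarrow> x * y \<in> CSym n"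
  using keys_mult[of x y] by (auto simp: CSym_def plus_in_Sym subset_iff)

lemmas CSym_closed = CSym_add CSym_scale CSym_sum CSym_mult

lemma CSym_power: "x \<in> CSym n \<Longrightarrow> x ^ k \<in> CSym n"
  by (induction k) (auto simp: CSym_mult)

lemma CSym_mono: "m \<le> n \<Longrightarrow> CSym m \<subseteq> CSym n"
  using Sym_mono by (fastforce simp: CSym_def)

lemma CSym_SucI: "x \<in> CSym n \<Longrightarrow> x \<in> CSym (Suc n)"
  using CSym_mono[of n "Suc n"] by auto

lemma CSym_expand: "x \<in> CSym n \<Longrightarrow> x = (\<Sum>a\<in>Sym n. coef x a \<star> delta a)"
  by (rule group_algebra_expand) (auto simp: CSym_def)

lemma CSym_induct [consumes 1, case_names zero delta add]:
  assumes "x \<in> CSym n" "Q 0" "\<And>a c. a \<in> Sym n \<Longrightarrow> Q (c \<star> delta a)"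
    "\<And>x y. Q x \<Longrightarrow> Q y \<Longrightarrow> Q (x + y)"
  shows "Q x"
  using assms group_algebra_induct[of x "Sym n" Q] by (auto simp: CSym_def)

lemma CSym_0: "x \<in> CSym 0 \<Longrightarrow> \<exists>c. x = c \<star> 1"
  by (rule exI[of _ "trace x"], rule trans[OF CSym_expand]) (auto simp: Sym_0)

lemma CSym_commute:
  assumes "x \<in> CSym n" "\<And>a. a \<in> Sym n \<Longrightarrow> y * delta a = delta a * y"
  shows "y * x = x * y"
  using assms(1)
  by (induction rule: CSym_induct)
    (simp_all add: distrib_left distrib_right scale_simps assms(2))

section \<open>Row symmetrizers and column antisymmetrizers\<close>

text \<open>Labelling every entry of a tableau by the index of its row, respectively column, gives the row,
  respectively column, stabilizer.\<close>

definition label_stab :: "nat \<Rightarrow> (nat \<Rightarrow> nat) \<Rightarrow> fperm set" where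
  "label_stab n f = {a \<in> Sym n. \<forall>x\<in>{1..n}. f (app a x) = f x}"

definition symmetrizer :: "nat \<Rightarrow> (nat \<Rightarrow> nat) \<Rightarrow> galg" where
  "symmetrizer n f = char_sum (\<lambda>a. 1) (label_stab n f)"

definition antisymmetrizer :: "nat \<Rightarrow> (nat \<Rightarrow> nat) \<Rightarrow> galg" where
  "antisymmetrizer n f = char_sum fsign (label_stab n f)"

lemma label_stab_subset: "label_stab n f \<subseteq> Sym n"
  by (auto simp: label_stab_def)

lemma finite_label_stab [simp]: "finite (label_stab n f)"
  using finite_subset[OF label_stab_subset] by simp

lemma add_subgroup_label_stab: "add_subgroup (label_stab n f)"
  unfolding add_subgroup_def
proof (intro conjI ballI)
  show "0 \<in> label_stab n f" by (simp add: label_stab_def)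
  show "a + b \<in> label_stab n f" if "a \<in> label_stab n f" "b \<in> label_stab n f" for a b
    using that app_in_iff[of b n] by (simp add: label_stab_def plus_in_Sym del: atLeastAtMost_iff)
  show "- a \<in> label_stab n f" if a: "a \<in> label_stab n f" for a
  proof -
    have "f (app (- a) x) = f x" if "x \<in> {1..n}" for x
    proof -
      have "app (- a) x \<in> {1..n}"
        using app_in_iff[of "- a" n x] a that by (simp add: label_stab_def)
      then have "f (app a (app (- a) x)) = f (app (- a) x)"
        using a by (simp add: label_stab_def del: app_uminus_app)
      then show ?thesis by simp
    qed
    then show ?thesis using a by (simp add: label_stab_def)
  qed
qed

lemmas label_stab_closed [simp] = add_subgroupD[OF add_subgroup_label_stab]

lemma card_label_stab_pos: "card (label_stab n f) > 0"
  by (metis card_gt_0_iff empty_iff finite_label_stab label_stab_closed(1))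

lemma fswap_in_label_stab:
  "a \<in> {1..n} \<Longrightarrow> b \<in> {1..n} \<Longrightarrow> f a = f b \<Longrightarrow> fswap a b \<in> label_stab n f"
  by (simp add: label_stab_def fswap_in_Sym) (simp add: app_fswap Transposition.transpose_def)

lemma symmetrizer_CSym: "symmetrizer n f \<in> CSym n"
  and antisymmetrizer_CSym: "antisymmetrizer n f \<in> CSym n"
  unfolding symmetrizer_def antisymmetrizer_def char_sum_def
  by (auto intro!: CSym_closed CSym_delta dest: label_stab_subset[THEN subsetD])

lemma label_stab_cong: "(\<And>x. x \<in> {1..n} \<Longrightarrow> f x = g x) \<Longrightarrow> label_stab n f = label_stab n g"
  unfolding label_stab_def by (rule Collect_cong) (metis app_in_iff)

lemma symmetrizer_cong: "(\<And>x. x \<in> {1..n} \<Longrightarrow> f x = g x) \<Longrightarrow> symmetrizer n f = symmetrizer n g"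
  and antisymmetrizer_cong: "(\<And>x. x \<in> {1..n} \<Longrightarrow> f x = g x) \<Longrightarrow> antisymmetrizer n f = antisymmetrizer n g"
  using label_stab_cong[of n f g] by (auto simp: symmetrizer_def antisymmetrizer_def)

lemma symmetrizer_absorbs:
  assumes "a \<in> label_stab n f"
  shows "delta a * symmetrizer n f = symmetrizer n f" "symmetrizer n f * delta a = symmetrizer n f"
  unfolding symmetrizer_def
  using char_sum_absorbs[OF add_subgroup_label_stab assms linear_character_one] by simp_all

lemma antisymmetrizer_absorbs:
  assumes "a \<in> label_stab n f"
  shows "delta a * antisymmetrizer n f = fsign a \<star> antisymmetrizer n f"
    and "antisymmetrizer n f * delta a = fsign a \<star> antisymmetrizer n f"
  unfolding antisymmetrizer_def
  using char_sum_absorbs[OF add_subgroup_label_stab assms linear_character_fsign] by simp_all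

lemma symmetrizer_square:
  "symmetrizer n f * symmetrizer n f = of_nat (card (label_stab n f)) \<star> symmetrizer n f"
  unfolding symmetrizer_def by (rule char_sum_square[OF add_subgroup_label_stab linear_character_one])

lemma adjoint_symmetrizer [simp]: "adjoint (symmetrizer n f) = symmetrizer n f"
  and adjoint_antisymmetrizer [simp]: "adjoint (antisymmetrizer n f) = antisymmetrizer n f"
  unfolding symmetrizer_def antisymmetrizer_def
  by (simp_all add: adjoint_char_sum add_subgroup_label_stab)

lemma bij_betw_conj_label_stab:
  assumes "a \<in> Sym n"
  shows "bij_betw (\<lambda>b. a + b + - a) (label_stab n f) (label_stab n (\<lambda>x. f (app (- a) x)))"
proof (rule bij_betw_byWitness[where f' = "\<lambda>b. - a + b + a"])
  show "\<forall>b\<in>label_stab n f. - a + (a + b + - a) + a = b"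
    by (metis add.assoc add.left_neutral add.right_neutral left_minus)
  show "\<forall>b\<in>label_stab n (\<lambda>x. f (app (- a) x)). a + (- a + b + a) + - a = b"
    by (metis add.assoc add.left_neutral add.right_neutral right_minus)
  have in_iff: "app (- a) x \<in> {1..n} \<longleftrightarrow> x \<in> {1..n}" "app a x \<in> {1..n} \<longleftrightarrow> x \<in> {1..n}" for x
    using app_in_iff assms uminus_in_Sym by blast+
  show "(\<lambda>b. a + b + - a) ` label_stab n f \<subseteq> label_stab n (\<lambda>x. f (app (- a) x))"
    using assms in_iff
    by (auto simp: label_stab_def plus_in_Sym simp del: add_uminus_conv_diff atLeastAtMost_iff)
  show "(\<lambda>b. - a + b + a) ` label_stab n (\<lambda>x. f (app (- a) x)) \<subseteq> label_stab n f"
    using assms in_iff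
    by (auto simp: label_stab_def plus_in_Sym simp del: add_uminus_conv_diff atLeastAtMost_iff)
qed

lemma delta_symmetrizer:
  "a \<in> Sym n \<Longrightarrow> delta a * symmetrizer n f = symmetrizer n (\<lambda>x. f (app (- a) x)) * delta a"
  unfolding symmetrizer_def
  by (rule delta_conj_char_sum[OF linear_character_one bij_betw_conj_label_stab])

lemma delta_antisymmetrizer:
  "a \<in> Sym n \<Longrightarrow> delta a * antisymmetrizer n f = antisymmetrizer n (\<lambda>x. f (app (- a) x)) * delta a"
  unfolding antisymmetrizer_def
  by (rule delta_conj_char_sum[OF linear_character_fsign bij_betw_conj_label_stab])

lemma symmetrizer_antisymmetrizer_eq_zero:
  assumes "a \<in> {1..n}" "b \<in> {1..n}" "a \<noteq> b" "f a = f b" "g a = g b"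
  shows "symmetrizer n f * antisymmetrizer n g = 0" "antisymmetrizer n g * symmetrizer n f = 0"
proof -
  let ?t = "fswap a b"
  have sign: "fsign ?t = - 1" using assms fsign_fswap by simp
  have stab: "?t \<in> label_stab n f" "?t \<in> label_stab n g" using assms fswap_in_label_stab by blast+
  have zero_if_eq_neg: "x = 0" if "x = (- 1) \<star> x" for x :: galg
  proof (rule poly_mapping_eqI)
    show "coef x k = coef 0 k" for k
      using arg_cong[OF that, of "\<lambda>y. coef y k"] by simp
  qed
  have "symmetrizer n f * antisymmetrizer n g = symmetrizer n f * (delta ?t * antisymmetrizer n g)"
    by (simp flip: mult.assoc add: symmetrizer_absorbs stab)
  then show "symmetrizer n f * antisymmetrizer n g = 0"
    by (intro zero_if_eq_neg) (simp add: antisymmetrizer_absorbs stab sign scale_simps)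
  have "antisymmetrizer n g * symmetrizer n f = (antisymmetrizer n g * delta ?t) * symmetrizer n f"
    by (simp add: mult.assoc symmetrizer_absorbs stab)
  then show "antisymmetrizer n g * symmetrizer n f = 0"
    by (intro zero_if_eq_neg) (simp add: antisymmetrizer_absorbs stab sign scale_simps)
qed

lemma symmetrizer_antisymmetrizer_nonzero_imp_inj:
  "symmetrizer n f * antisymmetrizer n g \<noteq> 0 \<Longrightarrow> inj_on (\<lambda>x. (f x, g x)) {1..n}"
  "antisymmetrizer n g * symmetrizer n f \<noteq> 0 \<Longrightarrow> inj_on (\<lambda>x. (f x, g x)) {1..n}"
  by (rule inj_onI, rule ccontr, simp add: symmetrizer_antisymmetrizer_eq_zero)+

lemma label_stab_Suc_inter: "label_stab (Suc n) f \<inter> Sym n = label_stab n f"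
  using Sym_mono[of n "Suc n"] by (auto simp: label_stab_def le_Suc_eq app_outside)

text \<open>A product \<open>p q\<close> of a row and a column permutation fixes \<open>n + 1\<close> only if both factors do, because
  \<open>q (n + 1) = p\<^sup>-\<^sup>1 (n + 1)\<close> lies both in the row and in the column of \<open>n + 1\<close>.\<close>

lemma label_stab_plus_in_SymD:
  assumes inj: "inj_on (\<lambda>x. (f x, g x)) {1..Suc n}"
    and p: "p \<in> label_stab (Suc n) f" and q: "q \<in> label_stab (Suc n) g" and "p + q \<in> Sym n"
  shows "p \<in> label_stab n f" "q \<in> label_stab n g"
proof -
  have "app p (app q (Suc n)) = Suc n"
    using app_outside[OF assms(4), of "Suc n"] by simp
  then have q_image: "app q (Suc n) = app (- p) (Suc n)" by (metis app_uminus_app(1))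
  have "g (app q (Suc n)) = g (Suc n)" using q by (simp add: label_stab_def)
  moreover have "f (app q (Suc n)) = f (Suc n)"
    using label_stab_closed(3)[of p "Suc n" f] p unfolding q_image by (simp add: label_stab_def)
  moreover have "app q (Suc n) \<in> {1..Suc n}"
    using q app_in_iff[of q "Suc n" "Suc n"] by (simp add: label_stab_def)
  ultimately have "app q (Suc n) = Suc n"
    by (intro inj_onD[OF inj]) auto
  moreover from this have "app p (Suc n) = Suc n" using q_image by (metis app_uminus_app(2))
  ultimately have "p \<in> Sym n" "q \<in> Sym n" using p q Sym_Suc_fixing by (auto simp: label_stab_def)
  then show "p \<in> label_stab n f" "q \<in> label_stab n g" using p q label_stab_Suc_inter by blast+
qed

lemma trace_mult_symmetrizer_antisymmetrizer:
  "trace (x * (symmetrizer n f * antisymmetrizer n g)) =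
    (\<Sum>(p, q)\<in>label_stab n f \<times> label_stab n g. fsign q * coef x (- (p + q)))"
proof -
  have "x * (symmetrizer n f * antisymmetrizer n g) =
      (\<Sum>(p, q)\<in>label_stab n f \<times> label_stab n g. fsign q \<star> (x * delta (p + q)))"
    unfolding symmetrizer_def antisymmetrizer_def char_sum_def sum_product sum.cartesian_product delta_plus
    unfolding sum_distrib_left
    by (rule sum.cong) (auto simp: scale_simps)
  then show ?thesis
    by (simp add: lookup_sum trace_mult_delta case_prod_unfold del: minus_add)
qed

lemma trace_symmetrizer_antisymmetrizer_Suc:
  assumes inj: "inj_on (\<lambda>x. (f x, g x)) {1..Suc n}" and x: "x \<in> CSym n"
  shows "trace (x * (symmetrizer (Suc n) f * antisymmetrizer (Suc n) g)) =
    trace (x * (symmetrizer n f * antisymmetrizer n g))"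
  unfolding trace_mult_symmetrizer_antisymmetrizer
proof (rule sum.mono_neutral_right)
  show "label_stab n f \<times> label_stab n g \<subseteq> label_stab (Suc n) f \<times> label_stab (Suc n) g"
    using label_stab_Suc_inter by blast
  have "coef x (- (p + q)) = 0"
    if "p \<in> label_stab (Suc n) f" "q \<in> label_stab (Suc n) g"
      "p \<notin> label_stab n f \<or> q \<notin> label_stab n g" for p q
    using label_stab_plus_in_SymD[OF inj that(1,2)] that(3) coef_outside_Sym[OF x] uminus_in_Sym by blast
  then show "\<forall>pq\<in>label_stab (Suc n) f \<times> label_stab (Suc n) g - label_stab n f \<times> label_stab n g.
      (case pq of (p, q) \<Rightarrow> fsign q * coef x (- (p + q))) = 0"
    by (auto simp del: minus_add) metis+
qed simp

lemma trace_symmetrizer_antisymmetrizer: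
  assumes "inj_on (\<lambda>x. (f x, g x)) {1..n}"
  shows "trace (symmetrizer n f * antisymmetrizer n g) = 1"
  using assms
proof (induction n)
  case 0
  have "label_stab 0 f = {0}" for f using label_stab_subset[of 0 f] label_stab_closed(1)[of 0 f] Sym_0
    by blast
  then show ?case
    by (simp add: symmetrizer_def antisymmetrizer_def char_sum_def linear_characterD(1)[OF linear_character_fsign])
next
  case (Suc n)
  have "inj_on (\<lambda>x. (f x, g x)) {1..n}" by (rule inj_on_subset[OF Suc.prems]) auto
  then show ?case using trace_symmetrizer_antisymmetrizer_Suc[OF Suc.prems, of 1] Suc.IH by simp
qed

section \<open>Fillings of Young diagrams\<close>

definition decreasing_shape :: "nat \<Rightarrow> (nat \<Rightarrow> nat) \<Rightarrow> bool" where
  "decreasing_shape n l \<longleftrightarrow> (\<forall>i j. i \<le> j \<longrightarrow> l j \<le> l i) \<and> (\<forall>i\<ge>n. l i = 0)"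

abbreviation cells :: "(nat \<Rightarrow> nat) \<Rightarrow> (nat \<times> nat) set" where
  "cells l \<equiv> {(i, c). c < l i}"

definition filling :: "(nat \<Rightarrow> nat) \<Rightarrow> nat \<Rightarrow> (nat \<Rightarrow> nat) \<Rightarrow> (nat \<Rightarrow> nat) \<Rightarrow> bool" where
  "filling l n f g \<longleftrightarrow> bij_betw (\<lambda>x. (f x, g x)) {1..n} (cells l) \<and> decreasing_shape n l"

lemma filling_inj: "filling l n f g \<Longrightarrow> inj_on (\<lambda>x. (f x, g x)) {1..n}"
  by (simp add: filling_def bij_betw_def)

lemma filling_cell: "filling l n f g \<Longrightarrow> x \<in> {1..n} \<Longrightarrow> g x < l (f x)"
  by (auto simp: filling_def bij_betw_def)

lemma filling_row_less: "filling l n f g \<Longrightarrow> x \<in> {1..n} \<Longrightarrow> f x < n"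
  using filling_cell[of l n f g x] by (auto simp: filling_def decreasing_shape_def not_less[symmetric])

lemma filling_conj:
  assumes "filling l n f g" "a \<in> Sym n"
  shows "filling l n (\<lambda>x. f (app a x)) (\<lambda>x. g (app a x))"
proof -
  have "bij_betw (app a) {1..n} {1..n}"
    using assms(2) by (simp add: Sym_def permutes_imp_bij)
  then have "bij_betw ((\<lambda>x. (f x, g x)) \<circ> app a) {1..n} (cells l)"
    using assms(1) by (auto simp: filling_def intro: bij_betw_trans)
  then show ?thesis using assms(1) by (simp add: filling_def o_def)
qed

lemma card_row_part:
  assumes "filling l n f g"
  shows "card {x\<in>{1..n}. f x = i \<and> g x < k} = min (l i) k"
proof -
  have bij: "bij_betw (\<lambda>x. (f x, g x)) {1..n} (cells l)"
    using assms by (simp add: filling_def)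
  let ?F = "\<lambda>x. (f x, g x)"
  have "?F ` {x\<in>{1..n}. f x = i \<and> g x < k} = ?F ` {1..n} \<inter> {i} \<times> {..<k}"
    by auto
  also have "\<dots> = {i} \<times> {..<min (l i) k}"
    using bij by (auto simp: bij_betw_def)
  finally have card_cells: "card (?F ` {x\<in>{1..n}. f x = i \<and> g x < k}) = min (l i) k" by simp
  have inj: "inj_on ?F {x\<in>{1..n}. f x = i \<and> g x < k}"
    by (rule inj_on_subset[OF filling_inj[OF assms]]) auto
  show ?thesis using card_cells by (rule trans[OF card_image[OF inj, symmetric]])
qed

lemma card_row:
  assumes "filling l n f g"
  shows "card {x\<in>{1..n}. f x = i} = l i"
proof -
  have "{x\<in>{1..n}. f x = i} = {x\<in>{1..n}. f x = i \<and> g x < l i}"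
    using filling_cell[OF assms] by auto
  then show ?thesis using card_row_part[OF assms, of i "l i"] by simp
qed

lemma card_by_rows:
  assumes "filling l n f g"
  shows "card {x\<in>{1..n}. g' x < k} = (\<Sum>i<n. card {x\<in>{1..n}. f x = i \<and> g' x < k})"
proof -
  have "{x\<in>{1..n}. g' x < k} = (\<Union>i<n. {x\<in>{1..n}. f x = i \<and> g' x < k})"
    using filling_row_less[OF assms] by auto
  then show ?thesis by (simp only:) (subst card_UN_disjoint, auto)
qed

lemma card_columns_less:
  assumes "filling l n f g"
  shows "card {x\<in>{1..n}. g x < k} = (\<Sum>i<n. min (l i) k)"
  using card_by_rows[OF assms, of g k] card_row_part[OF assms] by simp

lemma card_row_part_le:
  assumes "filling l n f g" "inj_on (\<lambda>x. (f x, g' x)) {1..n}"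
  shows "card {x\<in>{1..n}. f x = i \<and> g' x < k} \<le> min (l i) k"
proof -
  have "card {x\<in>{1..n}. f x = i \<and> g' x < k} \<le> card {x\<in>{1..n}. f x = i}"
    by (rule card_mono) auto
  moreover have "card {x\<in>{1..n}. f x = i \<and> g' x < k} \<le> card {..<k}"
  proof (rule card_inj_on_le[of g'])
    show "inj_on g' {x\<in>{1..n}. f x = i \<and> g' x < k}"
      by (rule inj_onI, rule inj_onD[OF assms(2)]) auto
  qed auto
  ultimately show ?thesis using card_row[OF assms(1)] by simp
qed

lemma filling_transversal_dominance:
  assumes "filling l n f g" "filling l' n f' g'" "inj_on (\<lambda>x. (f x, g' x)) {1..n}"
  shows "(\<Sum>i<n. min (l' i) k) \<le> (\<Sum>i<n. min (l i) k)"
  using card_columns_less[OF assms(2), of k] card_by_rows[OF assms(1), of g' k]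
    card_row_part_le[OF assms(1,3)] by (simp add: sum_mono)

lemma filling_transversal_same_shape:
  assumes f: "filling l n f g" and f': "filling l n f' g'"
    and inj: "inj_on (\<lambda>x. (f x, g' x)) {1..n}"
  shows "filling l n f g'"
proof -
  let ?D = "cells l"
  have row_counts: "card {x\<in>{1..n}. f x = i \<and> g' x < k} = min (l i) k" if "i < n" for i k
  proof (rule ccontr)
    assume smaller: "card {x\<in>{1..n}. f x = i \<and> g' x < k} \<noteq> min (l i) k"
    have "(\<Sum>i<n. card {x\<in>{1..n}. f x = i \<and> g' x < k}) < (\<Sum>i<n. min (l i) k)"
    proof (rule sum_strict_mono_ex1)
      show "\<forall>i\<in>{..<n}. card {x\<in>{1..n}. f x = i \<and> g' x < k} \<le> min (l i) k"
        using card_row_part_le[OF f inj] by blast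
      have "card {x\<in>{1..n}. f x = i \<and> g' x < k} < min (l i) k"
        using card_row_part_le[OF f inj] smaller le_neq_implies_less by blast
      then show "\<exists>i\<in>{..<n}. card {x\<in>{1..n}. f x = i \<and> g' x < k} < min (l i) k"
        using that by blast
    qed simp
    then show False
      using card_columns_less[OF f', of k] card_by_rows[OF f, of g' k] by simp
  qed
  have "g' x < l (f x)" if x: "x \<in> {1..n}" for x
  proof -
    have "card {y\<in>{1..n}. f y = f x \<and> g' y < l (f x)} = card {y\<in>{1..n}. f y = f x}"
      using row_counts[OF filling_row_less[OF f x]] card_row[OF f] by simp
    then have "{y\<in>{1..n}. f y = f x \<and> g' y < l (f x)} = {y\<in>{1..n}. f y = f x}"
      by (intro card_subset_eq) auto
    then show ?thesis using x by blast
  qed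
  then have sub: "(\<lambda>x. (f x, g' x)) ` {1..n} \<subseteq> ?D" by auto
  have "card ?D = n" "finite ?D"
    using f bij_betw_same_card[of _ "{1..n}" ?D] bij_betw_finite[of _ "{1..n}" ?D]
    by (auto simp: filling_def)
  then have "(\<lambda>x. (f x, g' x)) ` {1..n} = ?D"
    using sub inj by (intro card_subset_eq) (auto simp: card_image)
  then show ?thesis using f inj by (simp add: filling_def bij_betw_def)
qed

lemma downset_eq_lessThan_card:
  fixes A :: "nat set"
  assumes "finite A" "\<And>i j. j \<in> A \<Longrightarrow> i \<le> j \<Longrightarrow> i \<in> A"
  shows "A = {..<card A}"
proof (cases "A = {}")
  case False
  define m where "m = Max A"
  have "A = {..m}" using assms(1) assms(2)[OF Max_in[OF assms(1) False]] by (auto simp: m_def)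
  then show ?thesis by (simp add: lessThan_Suc_atMost)
qed simp

lemma sum_min_Suc:
  fixes l :: "'a \<Rightarrow> nat"
  assumes "finite A"
  shows "(\<Sum>i\<in>A. min (l i) (Suc k)) = (\<Sum>i\<in>A. min (l i) k) + card {i \<in> A. k < l i}"
proof -
  have "(\<Sum>i\<in>A. min (l i) (Suc k)) = (\<Sum>i\<in>A. min (l i) k + (if k < l i then 1 else 0))"
    by (rule sum.cong) auto
  then show ?thesis using assms by (simp add: sum.distrib sum.If_cases Int_def)
qed

lemma sum_min_determines_shape:
  fixes l l' :: "nat \<Rightarrow> nat"
  assumes l: "decreasing_shape n l" and l': "decreasing_shape n l'"
    and sums_eq: "\<And>k. (\<Sum>i<n. min (l i) k) = (\<Sum>i<n. min (l' i) k)"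
  shows "l = l'"
proof
  fix i
  have level_sets: "{i \<in> {..<n}. k < l i} = {i \<in> {..<n}. k < l' i}" for k
  proof -
    have down: "{i \<in> {..<n}. k < m i} = {..<card {i \<in> {..<n}. k < m i}}"
      if "decreasing_shape n m" for m
      by (rule downset_eq_lessThan_card)
        (use that in \<open>auto simp: decreasing_shape_def intro: less_le_trans\<close>)
    have "card {i \<in> {..<n}. k < l i} = card {i \<in> {..<n}. k < l' i}"
      using sum_min_Suc[of "{..<n}" l k] sum_min_Suc[of "{..<n}" l' k] sums_eq by simp
    then show ?thesis using down[OF l] down[OF l'] by simp
  qed
  have "k < l i \<longleftrightarrow> k < l' i" for k
    using level_sets[of k] l l' by (cases "i < n") (auto simp: decreasing_shape_def)
  from this[of "l i"] this[of "l' i"] show "l i = l' i" by simp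
qed

lemma filling_shapes_eq:
  assumes f: "filling l n f g" and f': "filling l' n f' g'"
    and "inj_on (\<lambda>x. (f x, g' x)) {1..n}" "inj_on (\<lambda>x. (h' x, h x)) {1..n}"
    and h: "filling l n k h" "filling l' n h' k'"
  shows "l = l'"
proof (rule sum_min_determines_shape[of n])
  show "(\<Sum>i<n. min (l i) k) = (\<Sum>i<n. min (l' i) k)" for k
    using filling_transversal_dominance[OF f f' assms(3), of k]
      filling_transversal_dominance[OF h(2,1) assms(4), of k] by simp
qed (use f f' in \<open>simp_all add: filling_def\<close>)

lemma filling_transport:
  assumes "filling l n f g" "filling l n f' g'"
  obtains p where "p \<in> Sym n" "\<And>x. x \<in> {1..n} \<Longrightarrow> f (app p x) = f' x"
    "\<And>x. x \<in> {1..n} \<Longrightarrow> g (app p x) = g' x"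
proof -
  let ?F = "\<lambda>x. (f x, g x)" and ?F' = "\<lambda>x. (f' x, g' x)" and ?D = "cells l"
  have F: "bij_betw ?F {1..n} ?D" and F': "bij_betw ?F' {1..n} ?D"
    using assms by (auto simp: filling_def)
  define h where "h = (\<lambda>x. if x \<in> {1..n} then inv_into {1..n} ?F (?F' x) else x)"
  have "bij_betw (inv_into {1..n} ?F \<circ> ?F') {1..n} {1..n}"
    using F' bij_betw_inv_into[OF F] by (rule bij_betw_trans)
  then have "bij_betw h {1..n} {1..n}"
    by (rule bij_betw_cong[THEN iffD1, rotated]) (simp add: h_def)
  then have h: "h permutes {1..n}"
    by (rule bij_imp_permutes) (simp add: h_def del: atLeastAtMost_iff)
  have "?F (h x) = ?F' x" if "x \<in> {1..n}" for x
  proof -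
    have "?F' x \<in> ?F ` {1..n}" using that F F' unfolding bij_betw_def by blast
    from f_inv_into_f[OF this] show ?thesis using that by (simp only: h_def if_True)
  qed
  then show ?thesis using that[of "Fperm h"] Fperm_in_Sym[OF h] by (simp add: app_Fperm[OF h])
qed

text \<open>Von Neumann's lemma: \<open>P \<sigma> N = 0\<close> unless \<open>\<sigma>\<close> is a product of a row and a column permutation. If no two
  entries share both a row of the filling and a column of its \<open>\<sigma>\<close>-translate, counting the entries in the first
  columns shows that each row of the filling meets the leftmost columns of the translate.\<close>

lemma symmetrizer_delta_antisymmetrizer_cases:
  assumes fg: "filling l n f g" and a: "a \<in> Sym n"
  obtains "symmetrizer n f * delta a * antisymmetrizer n g = 0" |
    p where "p \<in> label_stab n f" "p + a \<in> label_stab n g"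
proof -
  let ?g = "\<lambda>x. g (app (- a) x)"
  have translate: "symmetrizer n f * delta a * antisymmetrizer n g =
      symmetrizer n f * antisymmetrizer n ?g * delta a"
    by (simp add: mult.assoc delta_antisymmetrizer[OF a])
  show thesis
  proof (cases "inj_on (\<lambda>x. (f x, ?g x)) {1..n}")
    case False
    then obtain x y where "x \<in> {1..n}" "y \<in> {1..n}" "x \<noteq> y" "f x = f y" "?g x = ?g y"
      by (auto simp: inj_on_def)
    then have "symmetrizer n f * antisymmetrizer n ?g = 0" by (rule symmetrizer_antisymmetrizer_eq_zero)
    then show ?thesis using that(1) translate by simp
  next
    case True
    have "filling l n f ?g"
      by (rule filling_transversal_same_shape[OF fg filling_conj[OF fg] True]) (simp add: a)
    from filling_transport[OF fg this] obtain p where p: "p \<in> Sym n"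
      "\<And>x. x \<in> {1..n} \<Longrightarrow> f (app p x) = f x" "\<And>x. x \<in> {1..n} \<Longrightarrow> g (app p x) = ?g x" by metis
    have "p \<in> label_stab n f" using p by (simp add: label_stab_def)
    moreover have "p + a \<in> label_stab n g"
      unfolding label_stab_def using p(1,3) a app_in_iff[OF a]
      by (simp add: plus_in_Sym del: atLeastAtMost_iff)
    ultimately show ?thesis by (rule that(2))
  qed
qed

lemma symmetrizer_delta_antisymmetrizer_factor:
  assumes "p \<in> label_stab n f" "p + a \<in> label_stab n g"
  shows "symmetrizer n f * delta a * antisymmetrizer n g =
    fsign (p + a) \<star> (symmetrizer n f * antisymmetrizer n g)"
proof -
  have "delta a = (delta (- p) * delta (p + a) :: galg)"
    by (simp flip: delta_plus)
  then have "symmetrizer n f * delta a * antisymmetrizer n g =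
      (symmetrizer n f * delta (- p)) * (delta (p + a) * antisymmetrizer n g)"
    by (simp only: mult.assoc)
  also have "\<dots> = fsign (p + a) \<star> (symmetrizer n f * antisymmetrizer n g)"
    using assms by (simp only: symmetrizer_absorbs antisymmetrizer_absorbs label_stab_closed(3) scale_simps)
  finally show ?thesis .
qed

lemma symmetrizer_CSym_antisymmetrizer:
  assumes fg: "filling l n f g" and x: "x \<in> CSym n"
  shows "\<exists>c. symmetrizer n f * x * antisymmetrizer n g = c \<star> (symmetrizer n f * antisymmetrizer n g)"
  using x
proof (induction rule: CSym_induct)
  case zero
  show ?case by (rule exI[of _ 0]) simp
next
  case (delta a c)
  from fg delta have "\<exists>d. symmetrizer n f * delta a * antisymmetrizer n g =
      d \<star> (symmetrizer n f * antisymmetrizer n g)"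
    by (cases rule: symmetrizer_delta_antisymmetrizer_cases[of l n f g a])
      (auto simp: symmetrizer_delta_antisymmetrizer_factor intro: exI[of _ 0])
  then show ?case by (auto simp: scale_simps)
next
  case (add x y)
  then obtain c d where "symmetrizer n f * x * antisymmetrizer n g =
      c \<star> (symmetrizer n f * antisymmetrizer n g)"
    "symmetrizer n f * y * antisymmetrizer n g = d \<star> (symmetrizer n f * antisymmetrizer n g)" by blast
  then have "symmetrizer n f * (x + y) * antisymmetrizer n g =
      (c + d) \<star> (symmetrizer n f * antisymmetrizer n g)"
    by (simp add: distrib_left distrib_right scale_distrib)
  then show ?case ..
qed

lemma CSym_nonzero_sandwich:
  assumes "y \<in> CSym n" "u * y * v \<noteq> 0"
  shows "\<exists>a\<in>Sym n. u * delta a * v \<noteq> 0"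
proof (rule ccontr)
  assume "\<not> (\<exists>a\<in>Sym n. u * delta a * v \<noteq> 0)"
  then have zero: "u * delta a * v = 0" if "a \<in> Sym n" for a using that by blast
  have "u * y * v = 0" using assms(1)
    by (induction rule: CSym_induct) (simp_all add: distrib_left distrib_right scale_simps zero)
  then show False using assms(2) by simp
qed

lemma symmetrizer_antisymmetrizer_different_shapes:
  assumes fg: "filling l n f g" and fg': "filling l' n f' g'" and "l \<noteq> l'" and x: "x \<in> CSym n"
  shows "symmetrizer n f * antisymmetrizer n g * x * (symmetrizer n f' * antisymmetrizer n g') = 0"
proof (rule ccontr)
  assume "symmetrizer n f * antisymmetrizer n g * x * (symmetrizer n f' * antisymmetrizer n g') \<noteq> 0"
  then have outer: "symmetrizer n f * (antisymmetrizer n g * x * symmetrizer n f') * antisymmetrizer n g' \<noteq> 0"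
    by (simp add: mult.assoc)
  then have "antisymmetrizer n g * x * symmetrizer n f' \<noteq> 0" by (rule contrapos_nn) simp
  from CSym_nonzero_sandwich[OF x this] obtain a where
    a: "a \<in> Sym n" "antisymmetrizer n g * delta a * symmetrizer n f' \<noteq> 0" ..
  have "antisymmetrizer n g * x * symmetrizer n f' \<in> CSym n"
    by (intro CSym_mult antisymmetrizer_CSym symmetrizer_CSym x)
  from CSym_nonzero_sandwich[OF this outer] obtain b where
    b: "b \<in> Sym n" "symmetrizer n f * delta b * antisymmetrizer n g' \<noteq> 0" ..
  let ?f' = "\<lambda>x. f' (app (- a) x)" and ?g' = "\<lambda>x. g' (app (- b) x)"
  have "antisymmetrizer n g * symmetrizer n ?f' * delta a \<noteq> 0"
    using a(2) delta_symmetrizer[OF a(1), of f'] by (simp add: mult.assoc)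
  then have "antisymmetrizer n g * symmetrizer n ?f' \<noteq> 0" by (rule contrapos_nn) simp
  then have row_inj: "inj_on (\<lambda>x. (?f' x, g x)) {1..n}"
    by (rule symmetrizer_antisymmetrizer_nonzero_imp_inj(2))
  have "symmetrizer n f * antisymmetrizer n ?g' * delta b \<noteq> 0"
    using b(2) delta_antisymmetrizer[OF b(1), of g'] by (simp add: mult.assoc)
  then have "symmetrizer n f * antisymmetrizer n ?g' \<noteq> 0" by (rule contrapos_nn) simp
  then have col_inj: "inj_on (\<lambda>x. (f x, ?g' x)) {1..n}"
    by (rule symmetrizer_antisymmetrizer_nonzero_imp_inj(1))
  have "filling l' n ?f' (\<lambda>x. g' (app (- a) x))" "filling l' n (\<lambda>x. f' (app (- b) x)) ?g'"
    using filling_conj[OF fg'] a(1) b(1) by simp_all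
  from filling_shapes_eq[OF fg this(2) col_inj row_inj fg this(1)] show False using \<open>l \<noteq> l'\<close> by simp
qed

section \<open>Yamanouchi words\<close>

definition addable :: "(nat \<Rightarrow> nat) \<Rightarrow> nat \<Rightarrow> bool" where
  "addable l r \<longleftrightarrow> r = 0 \<or> l r < l (r - 1)"

lemma addable_less_iff:
  assumes decreasing: "\<And>i j. i \<le> j \<Longrightarrow> l j \<le> l i" and "addable l r"
  shows "l r < l i \<longleftrightarrow> i < r"
proof
  assume "l r < l i"
  then show "i < r" using decreasing[of r i] by (metis leD leI)
next
  assume "i < r"
  then have "l r < l (r - 1)" "i \<le> r - 1" using assms(2) by (auto simp: addable_def)
  then show "l r < l i" using decreasing[of i "r - 1"] by simp
qed

lemma card_addable_column:
  assumes fg: "filling l n f g" and "addable l r"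
  shows "card {x \<in> {1..n}. g x = l r} = r"
proof -
  let ?X = "{x \<in> {1..n}. g x = l r}" and ?F = "\<lambda>x. (f x, g x)"
  have "l r < l i \<longleftrightarrow> i < r" for i
    using fg by (intro addable_less_iff assms(2)) (simp add: filling_def decreasing_shape_def)
  then have "?F ` {1..n} \<inter> (UNIV \<times> {l r}) = {..<r} \<times> {l r}"
    using fg unfolding filling_def bij_betw_def by auto
  moreover have "?F ` ?X = ?F ` {1..n} \<inter> (UNIV \<times> {l r})" by auto
  ultimately have card_cells: "card (?F ` ?X) = r" by (simp add: card_cartesian_product)
  have "inj_on ?F ?X" by (rule inj_on_subset[OF filling_inj[OF fg]]) auto
  from card_image[OF this] card_cells show ?thesis by simp
qed

abbreviation shape :: "nat list \<Rightarrow> nat \<Rightarrow> nat" where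
  "shape \<equiv> count_list"

text \<open>The word \<open>r # w\<close> stands for the tableau obtained from that of \<open>w\<close> by appending the entry
  \<open>length w + 1\<close> to row \<open>r\<close>; row \<open>i\<close> then has length \<open>shape (r # w) i\<close>. Rows and columns are counted from 0.\<close>

primrec yamanouchi :: "nat list \<Rightarrow> bool" where
  "yamanouchi [] \<longleftrightarrow> True"
| "yamanouchi (r # w) \<longleftrightarrow> yamanouchi w \<and> addable (shape w) r"

primrec row_of :: "nat list \<Rightarrow> nat \<Rightarrow> nat" where
  "row_of [] x = 0"
| "row_of (r # w) x = (if x = Suc (length w) then r else row_of w x)"

primrec col_of :: "nat list \<Rightarrow> nat \<Rightarrow> nat" where
  "col_of [] x = 0"
| "col_of (r # w) x = (if x = Suc (length w) then shape w r else col_of w x)"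

lemma yamanouchi_antimono: "yamanouchi w \<Longrightarrow> i \<le> j \<Longrightarrow> shape w j \<le> shape w i"
proof -
  assume "yamanouchi w"
  then have "shape w (Suc i) \<le> shape w i" for i
    by (induction w) (auto simp: addable_def le_Suc_eq)
  then show "i \<le> j \<Longrightarrow> shape w j \<le> shape w i" by (rule lift_Suc_antimono_le)
qed

lemma yamanouchi_letter_less: "yamanouchi w \<Longrightarrow> r \<in> set w \<Longrightarrow> r < length w"
proof (induction w arbitrary: r)
  case (Cons s w)
  have "s < Suc (length w)"
  proof (cases "s = 0")
    case False
    then have "shape w (s - 1) \<noteq> 0" using Cons.prems by (auto simp: addable_def)
    then have "s - 1 \<in> set w" using count_notin by fastforce
    then show ?thesis using Cons by fastforce
  qed simp
  then show ?case using Cons by fastforce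
qed simp

lemma bij_betw_cells:
  "bij_betw (\<lambda>x. (row_of w x, col_of w x)) {1..length w} (cells (shape w))"
proof (induction w)
  case (Cons r w)
  let ?F = "\<lambda>x. (row_of (r # w) x, col_of (r # w) x)"
  have "bij_betw ?F {1..length w} (cells (shape w))"
    by (rule bij_betw_cong[THEN iffD1, OF _ Cons.IH]) auto
  then have "bij_betw ?F ({1..length w} \<union> {Suc (length w)})
      (cells (shape w) \<union> {?F (Suc (length w))})"
    by (intro notIn_Un_bij_betw) auto
  also have "{1..length w} \<union> {Suc (length w)} = {1..length (r # w)}" by auto
  also have "cells (shape w) \<union> {?F (Suc (length w))} = cells (shape (r # w))"
    by (auto split: if_splits)
  finally show ?case .
qed (simp add: bij_betw_def)

lemma yamanouchi_filling: "yamanouchi w \<Longrightarrow> filling (shape w) (length w) (row_of w) (col_of w)"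
  unfolding filling_def decreasing_shape_def
  using bij_betw_cells yamanouchi_antimono yamanouchi_letter_less
  by (metis count_notin leD)

section \<open>Young's seminormal units\<close>

definition young_product :: "nat list \<Rightarrow> galg" where
  "young_product w = symmetrizer (length w) (row_of w) * antisymmetrizer (length w) (col_of w)"

definition young_scalar :: "nat list \<Rightarrow> complex" where
  "young_scalar w = trace (young_product w * young_product w)"

lemma young_product_CSym: "young_product w \<in> CSym (length w)"
  by (simp add: young_product_def CSym_mult symmetrizer_CSym antisymmetrizer_CSym)

lemma trace_young_product: "yamanouchi w \<Longrightarrow> trace (young_product w) = 1"
  unfolding young_product_def
  by (rule trace_symmetrizer_antisymmetrizer[OF filling_inj[OF yamanouchi_filling]])

lemma young_product_corner:
  assumes w: "yamanouchi w" and x: "x \<in> CSym (length w)"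
  shows "young_product w * x * young_product w =
      trace (young_product w * x * young_product w) \<star> young_product w"
proof -
  let ?P = "symmetrizer (length w) (row_of w)" and ?N = "antisymmetrizer (length w) (col_of w)"
  have "?N * x * ?P \<in> CSym (length w)" by (intro CSym_mult symmetrizer_CSym antisymmetrizer_CSym x)
  from symmetrizer_CSym_antisymmetrizer[OF yamanouchi_filling[OF w] this]
  obtain c where "young_product w * x * young_product w = c \<star> young_product w"
    by (auto simp: young_product_def mult.assoc)
  moreover from this have "trace (young_product w * x * young_product w) = c"
    by (simp add: trace_young_product[OF w])
  ultimately show ?thesis by (simp only:)
qed

lemma young_product_square:
  "yamanouchi w \<Longrightarrow> young_product w * young_product w = young_scalar w \<star> young_product w"
  using young_product_corner[OF _ CSym_one] by (simp add: young_scalar_def)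

lemma young_product_sandwich:
  assumes w: "yamanouchi w" and x: "x \<in> CSym (length w)"
  shows "young_product w * x * young_product w =
      (young_scalar w * trace (x * young_product w)) \<star> young_product w"
proof -
  have "trace (young_product w * x * young_product w) = trace (x * (young_product w * young_product w))"
    by (metis mult.assoc trace_commute)
  also have "\<dots> = young_scalar w * trace (x * young_product w)"
    by (simp add: young_product_square[OF w] scale_simps)
  finally show ?thesis using young_product_corner[OF w x] by simp
qed

lemma young_scalar_nonzero:
  assumes w: "yamanouchi w"
  shows "young_scalar w \<noteq> 0"
proof
  assume zero: "young_scalar w = 0"
  let ?k = "of_nat (card (label_stab (length w) (row_of w))) :: complex"
  define P where "P = symmetrizer (length w) (row_of w)"
  define N where "N = antisymmetrizer (length w) (col_of w)"
  have PN: "young_product w = P * N" by (simp add: young_product_def P_def N_def)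
  have PP: "P * P = ?k \<star> P" unfolding P_def by (rule symmetrizer_square)
  have "P * N * P * adjoint (P * N * P) = P * N * (P * P) * N * P"
    by (simp add: adjoint_mult P_def N_def mult.assoc)
  also have "\<dots> = ?k \<star> (young_product w * young_product w * P)"
    by (simp add: PP PN scale_simps mult.assoc)
  also have "\<dots> = 0"
    by (simp add: young_product_square[OF w] zero)
  finally have "P * N * P = 0"
    using trace_mult_adjoint_eq_zero_iff[of "P * N * P"] by simp
  moreover have "trace (P * N * P) = trace (P * P * N)" by (metis mult.assoc trace_commute)
  then have "trace (P * N * P) = ?k"
    using trace_young_product[OF w] by (simp add: PP PN scale_simps)
  ultimately show False using card_label_stab_pos[of "length w" "row_of w"] by simp
qed

primrec seminormal :: "nat list \<Rightarrow> galg" where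
  "seminormal [] = 1"
| "seminormal (r # w) =
    (1 / young_scalar (r # w)) \<star> (seminormal w * young_product (r # w) * seminormal w)"

lemma seminormal_CSym: "seminormal w \<in> CSym (length w)"
proof (induction w)
  case (Cons r w)
  then have "seminormal w \<in> CSym (length (r # w))" by (simp add: CSym_SucI)
  then show ?case using young_product_CSym[of "r # w"] by (simp add: CSym_scale CSym_mult)
qed simp

lemma seminormal_CSym_Suc: "seminormal w \<in> CSym (Suc (length w))"
  by (rule CSym_SucI[OF seminormal_CSym])

lemma trace_seminormal_young_product_Cons:
  assumes "yamanouchi (r # w)"
  shows "trace (seminormal w * young_product (r # w)) = trace (seminormal w * young_product w)"
proof -
  let ?f = "row_of (r # w)" and ?g = "col_of (r # w)" and ?n = "length w"
  have "inj_on (\<lambda>x. (?f x, ?g x)) {1..Suc ?n}"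
    using filling_inj[OF yamanouchi_filling[OF assms]] by simp
  from trace_symmetrizer_antisymmetrizer_Suc[OF this seminormal_CSym]
  have "trace (seminormal w * young_product (r # w)) =
      trace (seminormal w * (symmetrizer ?n ?f * antisymmetrizer ?n ?g))"
    by (simp add: young_product_def del: row_of.simps col_of.simps)
  moreover have "symmetrizer ?n ?f = symmetrizer ?n (row_of w)"
    "antisymmetrizer ?n ?g = antisymmetrizer ?n (col_of w)"
    by (auto intro!: symmetrizer_cong antisymmetrizer_cong)
  ultimately show ?thesis by (simp add: young_product_def)
qed

lemma trace_seminormal_young_product: "yamanouchi w \<Longrightarrow> trace (seminormal w * young_product w) = 1"
proof (induction w)
  case Nil
  then show ?case using trace_young_product[of "[]"] by simp
next
  case (Cons r w)
  let ?y = "young_product (r # w)" and ?\<theta> = "young_scalar (r # w)"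
  have IH: "trace (seminormal w * ?y) = 1" using Cons trace_seminormal_young_product_Cons[of r w] by simp
  have "?y * seminormal w * ?y = ?\<theta> \<star> ?y"
    using young_product_sandwich[OF Cons.prems, of "seminormal w"] seminormal_CSym_Suc IH by simp
  then have "seminormal w * (?y * seminormal w * ?y) = ?\<theta> \<star> (seminormal w * ?y)"
    by (simp add: scale_simps)
  then have "seminormal (r # w) * ?y = seminormal w * ?y"
    using young_scalar_nonzero[OF Cons.prems] by (simp add: scale_simps mult.assoc)
  then show ?case using IH by simp
qed

lemma young_product_seminormal_tail_young_product:
  assumes "yamanouchi (r # w)"
  shows "young_product (r # w) * seminormal w * young_product (r # w) =
    young_scalar (r # w) \<star> young_product (r # w)"
  using young_product_sandwich[OF assms, of "seminormal w"] seminormal_CSym_Suc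
    trace_seminormal_young_product_Cons[OF assms] trace_seminormal_young_product[of w] assms
  by simp

lemma young_product_seminormal_tail_young_product_left:
  "yamanouchi (r # w) \<Longrightarrow> young_product (r # w) * (seminormal w * (young_product (r # w) * x)) =
    young_scalar (r # w) \<star> (young_product (r # w) * x)"
  using arg_cong[OF young_product_seminormal_tail_young_product, of r w "\<lambda>y. y * x"]
  by (simp only: mult.assoc scale_simps(3))

lemma seminormal_idem: "yamanouchi w \<Longrightarrow> seminormal w * seminormal w = seminormal w"
proof (induction w)
  case (Cons r w)
  then have "seminormal w * seminormal w = seminormal w" by simp
  then have "seminormal w * (seminormal w * x) = seminormal w * x" for x by (metis mult.assoc)
  then show ?case
    using Cons.prems young_scalar_nonzero[OF Cons.prems]
    by (simp add: scale_simps mult.assoc young_product_seminormal_tail_young_product_left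
        del: yamanouchi.simps)
qed simp

lemma seminormal_idem_left: "yamanouchi w \<Longrightarrow> seminormal w * (seminormal w * x) = seminormal w * x"
  by (metis mult.assoc seminormal_idem)

lemma seminormal_Cons_absorb:
  assumes "yamanouchi (r # w)"
  shows "seminormal w * seminormal (r # w) = seminormal (r # w)"
    and "seminormal (r # w) * seminormal w = seminormal (r # w)"
  using assms by (simp_all add: scale_simps mult.assoc seminormal_idem seminormal_idem_left)

lemma trace_seminormal: "yamanouchi w \<Longrightarrow> trace (seminormal w) = 1 / young_scalar w"
proof (cases w)
  case Nil
  assume "yamanouchi w"
  then have "young_scalar [] = 1"
    using young_product_square[of "[]"] trace_young_product[of "[]"]
      CSym_0[OF young_product_CSym[of "[]", simplified]]
    by (auto simp: young_scalar_def)
  then show ?thesis by (simp add: Nil)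
next
  case (Cons r v)
  assume w: "yamanouchi w"
  have "trace (seminormal v * young_product w * seminormal v) =
      trace (seminormal v * (seminormal v * young_product w))"
    by (rule trace_commute)
  also have "\<dots> = 1"
    using w trace_seminormal_young_product[of v] trace_seminormal_young_product_Cons[of r v]
    by (simp add: Cons seminormal_idem_left)
  finally show ?thesis by (simp add: Cons)
qed

lemma seminormal_nonzero: "yamanouchi w \<Longrightarrow> seminormal w \<noteq> 0"
  using trace_seminormal[of w] young_scalar_nonzero[of w] by auto

lemma seminormal_corner:
  assumes w: "yamanouchi w" and x: "x \<in> CSym (length w)"
  shows "\<exists>c. seminormal w * x * seminormal w = c \<star> seminormal w"
proof (cases w)
  case Nil
  then show ?thesis using x CSym_0[of x] by auto
next
  case (Cons r v)
  let ?\<theta> = "young_scalar w" and ?y = "young_product w"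
  have "seminormal v * x * seminormal v \<in> CSym (length w)"
    using seminormal_CSym_Suc[of v] x by (simp add: Cons CSym_mult)
  from young_product_sandwich[OF w this]
  obtain c where c: "?y * (seminormal v * x * seminormal v) * ?y = c \<star> ?y" by blast
  have "seminormal w * x * seminormal w =
      (1 / ?\<theta> * (1 / ?\<theta>)) \<star> (seminormal v * (?y * (seminormal v * x * seminormal v) * ?y) * seminormal v)"
    by (simp add: Cons scale_simps mult.assoc)
  also have "\<dots> = (c / ?\<theta>) \<star> seminormal w"
    unfolding c by (simp add: Cons scale_simps mult.assoc)
  finally show ?thesis by blast
qed

lemma seminormal_different_shapes:
  assumes "yamanouchi w" "yamanouchi v" "length w = length v" "shape w \<noteq> shape v" "x \<in> CSym (length w)"
  shows "seminormal w * x * seminormal v = 0"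
proof -
  obtain r w' s v' where w: "w = r # w'" "v = s # v'"
    using assms(3,4) by (cases w; cases v) auto
  have "seminormal w' * x * seminormal v' \<in> CSym (length w)"
    using seminormal_CSym_Suc[of w'] seminormal_CSym_Suc[of v'] assms(3,5)
    by (auto simp: w intro!: CSym_mult)
  then have "young_product w * (seminormal w' * x * seminormal v') * young_product v = 0"
    unfolding young_product_def
    using symmetrizer_antisymmetrizer_different_shapes[OF yamanouchi_filling[OF assms(1)],
        of "shape v" "row_of v" "col_of v"]
      yamanouchi_filling[OF assms(2)] assms(3,4) by simp
  then have "seminormal w' *
      (young_product w * (seminormal w' * x * seminormal v') * young_product v) * seminormal v' = 0"
    by simp
  then show ?thesis by (simp add: w scale_simps mult.assoc)
qed

lemma shape_Cons_eq_imp_same_row: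
  assumes "shape (r # w) = shape (s # w)"
  shows "r = s"
  using fun_cong[OF assms, of r] by (auto split: if_splits)

lemma seminormal_orthogonal:
  "yamanouchi w \<Longrightarrow> yamanouchi v \<Longrightarrow> length w = length v \<Longrightarrow> w \<noteq> v \<Longrightarrow> seminormal w * seminormal v = 0"
proof (induction w arbitrary: v)
  case (Cons r w)
  then obtain s u where v: "v = s # u" by (cases v) auto
  show ?case
  proof (cases "u = w")
    case True
    then have "shape (r # w) \<noteq> shape v" using Cons.prems(4) v shape_Cons_eq_imp_same_row by metis
    from seminormal_different_shapes[OF Cons.prems(1-3) this, of 1] show ?thesis by simp
  next
    case False
    then have orth: "seminormal w * seminormal u = 0" using Cons v by simp
    have "seminormal (r # w) * seminormal v =
        seminormal (r # w) * seminormal w * (seminormal u * seminormal v)"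
      using seminormal_Cons_absorb Cons.prems v by metis
    also have "\<dots> = seminormal (r # w) * (seminormal w * seminormal u) * seminormal v"
      by (simp only: mult.assoc)
    finally show ?thesis by (simp only: orth mult_zero_left mult_zero_right)
  qed
qed simp

lemma same_shape_length:
  assumes "shape w = shape v"
  shows "length w = length v"
  using assms sum_count_set[of w "set w \<union> set v"] sum_count_set[of v "set w \<union> set v"] by simp

lemma young_product_conjugate:
  assumes w: "yamanouchi w" and v: "yamanouchi v" and same_shape: "shape w = shape v"
  obtains p where "p \<in> Sym (length w)" "young_product w = delta (- p) * young_product v * delta p"
proof -
  let ?n = "length w"
  have len: "length v = ?n" using same_shape_length[OF same_shape] by simp
  have "filling (shape w) ?n (row_of v) (col_of v)" using yamanouchi_filling[OF v] same_shape len by simp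
  from filling_transport[OF this yamanouchi_filling[OF w]] obtain p where p: "p \<in> Sym ?n"
    "\<And>x. x \<in> {1..?n} \<Longrightarrow> row_of v (app p x) = row_of w x"
    "\<And>x. x \<in> {1..?n} \<Longrightarrow> col_of v (app p x) = col_of w x" by metis
  have "delta (- p) * symmetrizer ?n (row_of v) = symmetrizer ?n (row_of w) * delta (- p)"
    using delta_symmetrizer[of "- p" ?n "row_of v"] p
      symmetrizer_cong[of ?n "\<lambda>x. row_of v (app p x)" "row_of w"]
    by simp
  moreover have "delta (- p) * antisymmetrizer ?n (col_of v) =
      antisymmetrizer ?n (col_of w) * delta (- p)"
    using delta_antisymmetrizer[of "- p" ?n "col_of v"] p
      antisymmetrizer_cong[of ?n "\<lambda>x. col_of v (app p x)" "col_of w"]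
    by simp
  ultimately have "delta (- p) * young_product v = young_product w * delta (- p)"
    unfolding young_product_def len by (metis (no_types, lifting) mult.assoc)
  then have "young_product w = delta (- p) * young_product v * delta p"
    by (simp add: mult.assoc)
  with p(1) show ?thesis by (rule that)
qed

lemma seminormal_same_shape_factor:
  assumes w: "yamanouchi w" and v: "yamanouchi v" and same_shape: "shape w = shape v"
  obtains x y where "x \<in> CSym (length w)" "y \<in> CSym (length w)" "seminormal w = x * seminormal v * y"
proof (cases w)
  case Nil
  then have "v = []" using same_shape_length[OF same_shape] by simp
  then show ?thesis using Nil that[of 1 1] by simp
next
  case (Cons r w')
  have len: "length v = length w" using same_shape_length[OF same_shape] by simp
  then obtain s v' where v_eq: "v = s # v'" using Cons by (cases v) auto
  from young_product_conjugate[OF assms] obtain p where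
    p: "p \<in> Sym (length w)" "young_product w = delta (- p) * young_product v * delta p" .
  have "young_product v * seminormal v * young_product v = young_scalar v \<star> young_product v"
    using young_scalar_nonzero[OF v] v unfolding v_eq
    by (simp add: scale_simps mult.assoc young_product_seminormal_tail_young_product_left
        young_product_seminormal_tail_young_product[unfolded mult.assoc] del: yamanouchi.simps)
  then have "(1 / young_scalar v) \<star> (young_product v * seminormal v * young_product v) = young_product v"
    using young_scalar_nonzero[OF v] by (simp add: scale_simps)
  then have "young_product w =
      delta (- p) * ((1 / young_scalar v) \<star> (young_product v * seminormal v * young_product v)) * delta p"
    using p(2) by (simp only:)
  then have factor: "seminormal w =
      ((1 / young_scalar w * (1 / young_scalar v)) \<star> (seminormal w' * delta (- p) * young_product v)) *
      seminormal v * (young_product v * delta p * seminormal w')"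
    by (simp add: Cons scale_simps mult.assoc)
  show ?thesis
    by (rule that[OF _ _ factor])
      (use p(1) young_product_CSym[of v] seminormal_CSym_Suc[of w'] len in
        \<open>auto simp: Cons intro!: CSym_scale CSym_mult\<close>)
qed

definition matrix_units :: "nat \<Rightarrow> galg \<Rightarrow> galg \<Rightarrow> galg \<Rightarrow> galg \<Rightarrow> bool" where
  "matrix_units n e f a b \<longleftrightarrow>
    a \<in> CSym n \<and> b \<in> CSym n \<and> a * b = e \<and> b * a = f \<and> a * f = a \<and> f * b = b"

lemma matrix_unitsD:
  assumes "matrix_units n e f a b"
  shows "a \<in> CSym n" "b \<in> CSym n" "a * b = e" "b * a = f" "a * f = a" "f * b = b" "e * a = a" "b * e = b"
proof -
  show units: "a \<in> CSym n" "b \<in> CSym n" "a * b = e" "b * a = f" "a * f = a" "f * b = b"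
    using assms unfolding matrix_units_def by blast+
  have "a * b * a = a" by (simp only: mult.assoc units(4,5))
  then show "e * a = a" by (simp only: units(3))
  have "b * a * b = b" by (simp only: units(4,6))
  then show "b * e = b" by (simp only: units(3) mult.assoc)
qed

lemma seminormal_matrix_units:
  assumes w: "yamanouchi w" and v: "yamanouchi v" and same_shape: "shape w = shape v"
  obtains a b where "matrix_units (length w) (seminormal w) (seminormal v) a b"
proof -
  let ?n = "length w"
  have len: "length v = ?n" using same_shape_length[OF same_shape] by simp
  from seminormal_same_shape_factor[OF assms] obtain x y where
    xy: "x \<in> CSym ?n" "y \<in> CSym ?n" "seminormal w = x * seminormal v * y" .
  define a where "a = seminormal w * x * seminormal v"
  define b where "b = seminormal v * y * seminormal w"
  have CSym: "a \<in> CSym ?n" "b \<in> CSym ?n"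
    using xy(1,2) seminormal_CSym[of w] seminormal_CSym[of v] len
    by (auto simp: a_def b_def intro!: CSym_mult)
  have "a * b = seminormal w * (x * seminormal v * y) * seminormal w"
    by (simp add: a_def b_def mult.assoc seminormal_idem_left[OF v])
  then have ab: "a * b = seminormal w" by (simp add: xy(3)[symmetric] seminormal_idem[OF w])
  have absorb: "a * seminormal v = a" "seminormal v * b = b" "seminormal w * a = a"
    by (simp_all add: a_def b_def mult.assoc seminormal_idem seminormal_idem_left v w)
  have "y * seminormal w * (seminormal w * x) \<in> CSym (length v)"
    using xy(1,2) seminormal_CSym[of w] len by (auto intro!: CSym_mult)
  from seminormal_corner[OF v this] obtain c where c: "b * a = c \<star> seminormal v"
    by (auto simp: a_def b_def mult.assoc)
  have "c \<star> a = a * (b * a)" by (simp add: c scale_simps absorb)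
  also have "\<dots> = a" by (simp add: ab absorb flip: mult.assoc)
  finally have "(c - 1) \<star> a = 0" by (simp add: scale_distrib)
  moreover have "a \<noteq> 0" using ab seminormal_nonzero[OF w] by auto
  ultimately have "c = 1" by simp
  then have "matrix_units ?n (seminormal w) (seminormal v) a b"
    using CSym ab absorb c by (simp add: matrix_units_def)
  then show ?thesis by (rule that)
qed

section \<open>Completeness of the seminormal units\<close>

lemma combination_of_orthogonal_idempotents_mult:
  fixes f :: "'i \<Rightarrow> ('a::group_add \<Rightarrow>\<^sub>0 'b::comm_ring_1)"
  assumes "finite I" "i \<in> I" "f i * f i = f i" and orthogonal: "\<And>j. j \<in> I \<Longrightarrow> j \<noteq> i \<Longrightarrow> f j * f i = 0"
  shows "(\<Sum>j\<in>I. u j \<star> f j) * f i = u i \<star> f i"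
proof -
  have "(\<Sum>j\<in>I. u j \<star> f j) * f i = (\<Sum>j\<in>I. if j = i then u i \<star> f i else 0)"
    unfolding sum_distrib_right scale_simps
    by (rule sum.cong) (use assms(3) in \<open>auto simp: orthogonal\<close>)
  then show ?thesis using assms(1,2) by simp
qed

lemma independent_orthogonal_idempotents:
  fixes f :: "'i \<Rightarrow> ('a::group_add \<Rightarrow>\<^sub>0 'b::field)"
  assumes "finite I" and nonzero: "\<And>i. i \<in> I \<Longrightarrow> f i \<noteq> 0" and idempotent: "\<And>i. i \<in> I \<Longrightarrow> f i * f i = f i"
    and orthogonal: "\<And>i j. i \<in> I \<Longrightarrow> j \<in> I \<Longrightarrow> i \<noteq> j \<Longrightarrow> f i * f j = 0"
  shows "inj_on f I" "group_algebra.independent (f ` I)"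
proof -
  show inj: "inj_on f I"
    by (rule inj_onI, rule ccontr) (metis nonzero idempotent orthogonal)
  show "group_algebra.independent (f ` I)"
  proof (rule group_algebra.independent_if_scalars_zero)
    fix u x assume sum0: "(\<Sum>x\<in>f ` I. u x \<star> x) = 0" and "x \<in> f ` I"
    then obtain i where i: "i \<in> I" "x = f i" by blast
    have "0 = (\<Sum>j\<in>I. u (f j) \<star> f j) * f i"
      using sum0 by (simp add: sum.reindex[OF inj])
    also have "\<dots> = u x \<star> f i"
      unfolding i(2)
      by (rule combination_of_orthogonal_idempotents_mult) (use \<open>finite I\<close> i(1) idempotent orthogonal in auto)
    finally have "u x \<star> f i = 0" by (rule sym)
    then show "u x = 0" using nonzero[OF i(1)] by simp
  qed (use \<open>finite I\<close> in simp)
qed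

lemma eq_sum_of_orthogonal_idempotents:
  fixes e :: "'a::group_add \<Rightarrow>\<^sub>0 'b::field"
  assumes F: "finite F" "card F \<le> card I" and I: "finite I"
    and span: "e \<in> group_algebra.span F" "\<And>i. i \<in> I \<Longrightarrow> f i \<in> group_algebra.span F"
    and nonzero: "\<And>i. i \<in> I \<Longrightarrow> f i \<noteq> 0" and idempotent: "\<And>i. i \<in> I \<Longrightarrow> f i * f i = f i"
    and orthogonal: "\<And>i j. i \<in> I \<Longrightarrow> j \<in> I \<Longrightarrow> i \<noteq> j \<Longrightarrow> f i * f j = 0"
    and absorb: "\<And>i. i \<in> I \<Longrightarrow> e * f i = f i"
  shows "e = (\<Sum>i\<in>I. f i)"
proof -
  note indep = independent_orthogonal_idempotents[of I f, OF I nonzero idempotent orthogonal]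
  have "e \<in> group_algebra.span (f ` I)"
  proof (rule ccontr)
    assume e: "e \<notin> group_algebra.span (f ` I)"
    then have "group_algebra.independent (insert e (f ` I))"
      using indep(2) by (rule group_algebra.independent_insertI)
    then have "card (insert e (f ` I)) \<le> card F"
      using group_algebra.independent_span_bound[OF F(1)] span by auto
    moreover have "e \<notin> f ` I" using e group_algebra.span_base by blast
    ultimately show False using F(2) I by (simp add: card_image[OF indep(1)])
  qed
  then obtain u where "e = (\<Sum>x\<in>f ` I. u x \<star> x)"
    using I group_algebra.span_finite[of "f ` I"] by auto
  then have e: "e = (\<Sum>i\<in>I. u (f i) \<star> f i)" by (simp add: sum.reindex[OF indep(1)])
  have "u (f i) \<star> f i = f i" if i: "i \<in> I" for i
  proof -
    have "f i = (\<Sum>j\<in>I. u (f j) \<star> f j) * f i" using absorb[OF i] e by simp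
    also have "\<dots> = u (f i) \<star> f i"
      by (rule combination_of_orthogonal_idempotents_mult) (use I i idempotent orthogonal in auto)
    finally show ?thesis by (rule sym)
  qed
  then show ?thesis using e by simp
qed

definition yamanouchi_words :: "nat \<Rightarrow> nat list set" where
  "yamanouchi_words n = {w. yamanouchi w \<and> length w = n}"

definition addable_rows :: "nat list \<Rightarrow> nat set" where
  "addable_rows w = {r. addable (shape w) r}"

definition removable_rows :: "nat list \<Rightarrow> nat set" where
  "removable_rows w = {r. shape w (Suc r) < shape w r}"

lemma yamanouchi_wordsD:
  assumes "w \<in> yamanouchi_words n"
  shows "yamanouchi w" "length w = n"
  using assms by (simp_all add: yamanouchi_words_def)

lemma seminormal_in_CSym: "w \<in> yamanouchi_words n \<Longrightarrow> seminormal w \<in> CSym n"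
  using seminormal_CSym[of w] by (simp add: yamanouchi_words_def)

lemma finite_yamanouchi_words [simp]: "finite (yamanouchi_words n)"
proof (rule finite_subset)
  show "yamanouchi_words n \<subseteq> {w. set w \<subseteq> {..<n} \<and> length w = n}"
    using yamanouchi_letter_less by (auto simp: yamanouchi_words_def)
qed (simp add: finite_lists_length_eq)

lemma finite_removable_rows: "finite (removable_rows w)"
proof (rule finite_subset)
  show "removable_rows w \<subseteq> set w"
  proof
    fix r assume "r \<in> removable_rows w"
    then have "shape w r \<noteq> 0" by (simp add: removable_rows_def)
    then show "r \<in> set w" by (metis count_notin)
  qed
qed simp

lemma addable_rows_eq: "addable_rows w = insert 0 (Suc ` removable_rows w)"
proof (rule Set.set_eqI)
  show "r \<in> addable_rows w \<longleftrightarrow> r \<in> insert 0 (Suc ` removable_rows w)" for r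
    by (cases r) (auto simp: addable_rows_def addable_def removable_rows_def)
qed

lemma finite_addable_rows [simp]: "finite (addable_rows w)"
  by (simp add: addable_rows_eq finite_removable_rows)

lemma card_addable_rows: "card (addable_rows w) = Suc (card (removable_rows w))"
  by (simp add: addable_rows_eq finite_removable_rows card_image card_insert_if)

lemma Cons_in_yamanouchi_words:
  "r # w \<in> yamanouchi_words (Suc n) \<longleftrightarrow> w \<in> yamanouchi_words n \<and> r \<in> addable_rows w"
  by (auto simp: yamanouchi_words_def addable_rows_def)

lemma yamanouchi_words_0 [simp]: "yamanouchi_words 0 = {[]}"
  by (auto simp: yamanouchi_words_def)

lemma yamanouchi_words_Suc:
  "yamanouchi_words (Suc n) = (\<lambda>(w, r). r # w) ` (SIGMA w:yamanouchi_words n. addable_rows w)"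
proof (rule Set.set_eqI)
  show "v \<in> yamanouchi_words (Suc n) \<longleftrightarrow>
      v \<in> (\<lambda>(w, r). r # w) ` (SIGMA w:yamanouchi_words n. addable_rows w)" for v
    by (cases v) (auto simp: Cons_in_yamanouchi_words image_iff, simp add: yamanouchi_words_def)
qed

lemma sum_yamanouchi_words_Suc:
  "(\<Sum>v\<in>yamanouchi_words (Suc n). h v) = (\<Sum>w\<in>yamanouchi_words n. \<Sum>r\<in>addable_rows w. h (r # w))"
  unfolding yamanouchi_words_Suc
  by (subst sum.reindex) (auto simp: inj_on_def sum.Sigma case_prod_unfold)

lemma Sym_Suc_double_coset:
  assumes "a \<in> Sym (Suc (Suc m))" "a \<notin> Sym (Suc m)"
  obtains b c where "b \<in> Sym (Suc m)" "c \<in> Sym (Suc m)"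
    "a = b + fswap (Suc m) (Suc (Suc m)) + c"
proof -
  let ?s = "fswap (Suc m) (Suc (Suc m))"
  define j where "j = app a (Suc (Suc m))"
  have "j \<noteq> Suc (Suc m)" using assms Sym_Suc_fixing by (auto simp: j_def)
  moreover have "j \<in> {1..Suc (Suc m)}"
    using app_in_iff[OF assms(1), of "Suc (Suc m)"] by (simp add: j_def)
  ultimately have j: "j \<in> {1..Suc m}" by auto
  define b where "b = fswap j (Suc m)"
  have b: "b \<in> Sym (Suc m)" using j by (simp add: b_def fswap_in_Sym)
  define c where "c = ?s + b + a"
  have "b \<in> Sym (Suc (Suc m))" using b Sym_mono[of "Suc m" "Suc (Suc m)"] by auto
  then have "c \<in> Sym (Suc (Suc m))"
    using assms(1) by (auto simp: c_def intro!: plus_in_Sym fswap_in_Sym)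
  moreover have "app c (Suc (Suc m)) = Suc (Suc m)"
    using j by (simp add: c_def b_def j_def[symmetric] app_fswap)
  ultimately have c: "c \<in> Sym (Suc m)" by (rule Sym_Suc_fixing)
  have "b + b = 0" "?s + ?s = 0" by (simp_all add: b_def)
  then have "b + ?s + c = a"
    unfolding c_def by (metis add.assoc add.left_neutral)
  then show ?thesis using that b c by blast
qed

lemma fswap_commute_CSym:
  assumes "x \<in> CSym m"
  shows "delta (fswap (Suc m) (Suc (Suc m))) * x = x * delta (fswap (Suc m) (Suc (Suc m)))"
proof (rule CSym_commute[OF assms])
  fix a assume a: "a \<in> Sym m"
  let ?s = "fswap (Suc m) (Suc (Suc m))"
  have "?s + a = a + ?s"
  proof (rule fperm_eqI)
    fix x
    have fixed: "app a (Suc m) = Suc m" "app a (Suc (Suc m)) = Suc (Suc m)"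
      using app_outside[OF a] by auto
    moreover from fixed have "app a x = Suc m \<longleftrightarrow> x = Suc m" "app a x = Suc (Suc m) \<longleftrightarrow> x = Suc (Suc m)"
      using app_eq_iff[of a x "Suc m"] app_eq_iff[of a x "Suc (Suc m)"] by simp_all
    ultimately show "app (?s + a) x = app (a + ?s) x"
      by (simp add: app_fswap Transposition.transpose_def)
  qed
  then show "delta ?s * delta a = (delta a * delta ?s :: galg)" by (simp flip: delta_plus)
qed

definition seminormal_branches :: "nat \<Rightarrow> bool" where
  "seminormal_branches n \<longleftrightarrow>
    (\<forall>w\<in>yamanouchi_words n. seminormal w = (\<Sum>r\<in>addable_rows w. seminormal (r # w)))"

lemma seminormal_sum_if_branches:
  "(\<And>k. k < n \<Longrightarrow> seminormal_branches k) \<Longrightarrow> (\<Sum>w\<in>yamanouchi_words n. seminormal w) = 1"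
proof (induction n)
  case (Suc n)
  have "(\<Sum>w\<in>yamanouchi_words (Suc n). seminormal w) = (\<Sum>w\<in>yamanouchi_words n. seminormal w)"
    unfolding sum_yamanouchi_words_Suc using Suc.prems[of n]
    by (intro sum.cong refl) (simp add: seminormal_branches_def del: seminormal.simps)
  then show ?case using Suc by simp
qed simp

lemma seminormal_refine:
  assumes w: "w \<in> yamanouchi_words (Suc m)" and R: "R \<in> yamanouchi_words m"
    and branches: "seminormal_branches m" and x: "x \<in> CSym (Suc m)"
  defines "S \<equiv> {r \<in> addable_rows R. shape (r # R) = shape w}"
  shows "seminormal w * x * seminormal R = (\<Sum>r\<in>S. seminormal w * x * seminormal (r # R))"
    and "seminormal R * x * seminormal w = (\<Sum>r\<in>S. seminormal (r # R) * x * seminormal w)"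
proof -
  have branch: "seminormal R = (\<Sum>r\<in>addable_rows R. seminormal (r # R))"
    using branches R by (simp add: seminormal_branches_def del: seminormal.simps)
  have zero: "seminormal w * x * seminormal (r # R) = 0" "seminormal (r # R) * x * seminormal w = 0"
    if r: "r \<in> addable_rows R - S" for r
  proof -
    have "r # R \<in> yamanouchi_words (Suc m)" "shape (r # R) \<noteq> shape w"
      using r R by (auto simp: S_def Cons_in_yamanouchi_words)
    then show "seminormal w * x * seminormal (r # R) = 0" "seminormal (r # R) * x * seminormal w = 0"
      using w x by (metis seminormal_different_shapes yamanouchi_wordsD)+
  qed
  have S: "S \<subseteq> addable_rows R" by (auto simp: S_def)
  show "seminormal w * x * seminormal R = (\<Sum>r\<in>S. seminormal w * x * seminormal (r # R))"
    unfolding branch sum_distrib_left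
    by (rule sum.mono_neutral_right) (use S zero in \<open>auto simp del: seminormal.simps\<close>)
  show "seminormal R * x * seminormal w = (\<Sum>r\<in>S. seminormal (r # R) * x * seminormal w)"
    unfolding branch sum_distrib_right
    by (rule sum.mono_neutral_right) (use S zero in \<open>auto simp del: seminormal.simps\<close>)
qed

lemma seminormal_refine_unique:
  assumes "w \<in> yamanouchi_words (Suc m)" "R \<in> yamanouchi_words m" "seminormal_branches m"
    "x \<in> CSym (Suc m)"
    and r: "r \<in> addable_rows R" "shape (r # R) = shape w"
  shows "seminormal w * x * seminormal R = seminormal w * x * seminormal (r # R)"
    and "seminormal R * x * seminormal w = seminormal (r # R) * x * seminormal w"
proof -
  have "s = r" if "shape (s # R) = shape w" for s
    by (rule shape_Cons_eq_imp_same_row[of s R r]) (simp only: that r(2))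
  then have single: "{r \<in> addable_rows R. shape (r # R) = shape w} = {r}" using r by blast
  show "seminormal w * x * seminormal R = seminormal w * x * seminormal (r # R)"
    and "seminormal R * x * seminormal w = seminormal (r # R) * x * seminormal w"
    using seminormal_refine[OF assms(1-4)] unfolding single by simp_all
qed

text \<open>The corner \<open>e \<complex>[S\<^sub>n\<^sub>+\<^sub>1] e\<close> at a unit \<open>e\<close> of shape \<open>\<nu> \<turnstile> n\<close> is spanned by \<open>e\<close> and one element
  \<open>a s b\<close> for each shape \<open>\<rho>\<close> obtained from \<open>\<nu>\<close> by removing a cell, because
  \<open>\<complex>[S\<^sub>n\<^sub>+\<^sub>1] = \<complex>[S\<^sub>n] + \<complex>[S\<^sub>n] s \<complex>[S\<^sub>n]\<close> and \<open>s = (n n+1)\<close> commutes with \<open>\<complex>[S\<^sub>n\<^sub>-\<^sub>1]\<close>. As \<open>\<nu>\<close> has one more addable than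
  removable cell, the units refining \<open>e\<close> already exhaust the corner.\<close>

lemma swap_corner_scalar:
  fixes m :: nat
  defines "s \<equiv> delta (fswap (Suc m) (Suc (Suc m))) :: galg"
  assumes w: "w \<in> yamanouchi_words (Suc m)" and R: "R \<in> yamanouchi_words m"
    and branches: "seminormal_branches m" and r: "r \<in> addable_rows R" "shape (r # R) = shape w"
    and units: "matrix_units (Suc m) (seminormal w) (seminormal (r # R)) a b"
    and x: "x \<in> CSym (Suc m)" and y: "y \<in> CSym (Suc m)"
  shows "\<exists>c. seminormal w * x * (s * seminormal R) * y * seminormal w = c \<star> (a * s * b)"
proof -
  note ab = matrix_unitsD[OF units]
  note refine = seminormal_refine_unique[OF w R branches _ r]
  have sandwich: "seminormal R * s * seminormal R = s * seminormal R"
    unfolding s_def fswap_commute_CSym[OF seminormal_in_CSym[OF R], symmetric]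
    by (simp only: mult.assoc seminormal_idem[OF yamanouchi_wordsD(1)[OF R]])
  have split: "seminormal w * x * (s * seminormal R) * y * seminormal w =
      (seminormal w * x * seminormal R) * s * (seminormal R * y * seminormal w)"
    unfolding sandwich[symmetric] by (simp only: mult.assoc)
  have "seminormal w * x * seminormal R = seminormal w * x * (b * seminormal w * a)"
    unfolding refine(1)[OF x] ab(8) ab(4) ..
  then have left: "seminormal w * x * seminormal R = seminormal w * (x * b) * seminormal w * a"
    by (simp only: mult.assoc)
  have "seminormal R * y * seminormal w = b * seminormal w * a * y * seminormal w"
    unfolding refine(2)[OF y] ab(8) ab(4) ..
  then have right: "seminormal R * y * seminormal w = b * (seminormal w * (a * y) * seminormal w)"
    by (simp only: mult.assoc)
  obtain c where c: "seminormal w * (x * b) * seminormal w = c \<star> seminormal w"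
    using seminormal_corner[of w "x * b"] yamanouchi_wordsD[OF w] CSym_mult[OF x ab(2)] by auto
  obtain d where d: "seminormal w * (a * y) * seminormal w = d \<star> seminormal w"
    using seminormal_corner[of w "a * y"] yamanouchi_wordsD[OF w] CSym_mult[OF ab(1) y] by auto
  have "seminormal w * x * (s * seminormal R) * y * seminormal w = (d * c) \<star> (a * s * b)"
    unfolding split left right c d by (simp add: scale_simps ab)
  then show ?thesis by blast
qed

lemma swap_corner_transfer:
  fixes m :: nat
  defines "s \<equiv> delta (fswap (Suc m) (Suc (Suc m))) :: galg"
  assumes "matrix_units m e f u v"
  shows "s * e = u * (s * f) * v"
proof -
  note uv = matrix_unitsD[OF assms(2)]
  have "s * e = (s * u) * f * v" unfolding uv(3)[symmetric] by (simp only: mult.assoc uv(6))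
  then show ?thesis unfolding s_def fswap_commute_CSym[OF uv(1)] by (simp only: mult.assoc)
qed

lemma swap_corner_line:
  fixes m :: nat
  defines "s \<equiv> delta (fswap (Suc m) (Suc (Suc m))) :: galg"
  assumes w: "w \<in> yamanouchi_words (Suc m)" and branches: "seminormal_branches m"
  shows "\<exists>k. \<forall>R\<in>yamanouchi_words m. r \<in> addable_rows R \<longrightarrow> shape (r # R) = shape w \<longrightarrow>
    (\<forall>x\<in>CSym (Suc m). \<forall>y\<in>CSym (Suc m). \<exists>c. seminormal w * x * (s * seminormal R) * y * seminormal w = c \<star> k)"
proof (cases "\<exists>R\<in>yamanouchi_words m. r \<in> addable_rows R \<and> shape (r # R) = shape w")
  case True
  then obtain R' where R': "R' \<in> yamanouchi_words m" "r \<in> addable_rows R'" "shape (r # R') = shape w"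
    by blast
  have "r # R' \<in> yamanouchi_words (Suc m)" using R' by (simp add: Cons_in_yamanouchi_words)
  then obtain a b where ab: "matrix_units (Suc m) (seminormal w) (seminormal (r # R')) a b"
    using seminormal_matrix_units[of w "r # R'"] R'(3) yamanouchi_wordsD w by metis
  have "\<exists>c. seminormal w * x * (s * seminormal R) * y * seminormal w = c \<star> (a * s * b)"
    if R: "R \<in> yamanouchi_words m" "shape (r # R) = shape w" and xy: "x \<in> CSym (Suc m)" "y \<in> CSym (Suc m)"
    for R x y
  proof -
    have "shape R = shape R'"
    proof
      show "shape R i = shape R' i" for i
        using fun_cong[OF R(2), of i] fun_cong[OF R'(3), of i] by (simp split: if_splits)
    qed
    then obtain u v where uv: "matrix_units m (seminormal R) (seminormal R') u v"
      using seminormal_matrix_units[of R R'] R(1) R'(1) yamanouchi_wordsD by metis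
    have "x * u \<in> CSym (Suc m)" "v * y \<in> CSym (Suc m)"
      using xy matrix_unitsD(1,2)[OF uv] by (simp_all add: CSym_mult CSym_SucI)
    from swap_corner_scalar[OF w R'(1) branches R'(2,3) ab this]
    show ?thesis unfolding s_def swap_corner_transfer[OF uv] by (simp only: mult.assoc)
  qed
  then show ?thesis by blast
qed blast

lemma swap_corner_summand_spanned:
  fixes m :: nat
  defines "s \<equiv> delta (fswap (Suc m) (Suc (Suc m))) :: galg"
  assumes w: "w \<in> yamanouchi_words (Suc m)" and branches: "seminormal_branches m"
  obtains F where "finite F" "card F \<le> card (removable_rows w)"
    "\<And>R x y. \<lbrakk>R \<in> yamanouchi_words m; x \<in> CSym (Suc m); y \<in> CSym (Suc m)\<rbrakk> \<Longrightarrow>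
      seminormal w * x * (s * seminormal R) * y * seminormal w \<in> group_algebra.span F"
proof -
  from swap_corner_line[OF w branches] obtain k where
    k: "\<And>r R x y. \<lbrakk>R \<in> yamanouchi_words m; r \<in> addable_rows R; shape (r # R) = shape w;
      x \<in> CSym (Suc m); y \<in> CSym (Suc m)\<rbrakk> \<Longrightarrow>
      \<exists>c. seminormal w * x * (s * seminormal R) * y * seminormal w = c \<star> k r"
    unfolding s_def by metis
  let ?F = "k ` removable_rows w"
  have "seminormal w * x * (s * seminormal R) * y * seminormal w \<in> group_algebra.span ?F"
    if R: "R \<in> yamanouchi_words m" and xy: "x \<in> CSym (Suc m)" "y \<in> CSym (Suc m)" for R x y
  proof (cases "\<exists>r. r \<in> addable_rows R \<and> shape (r # R) = shape w")
    case True
    then obtain r where r: "r \<in> addable_rows R" "shape (r # R) = shape w" by blast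
    have "shape w (Suc r) < shape w r"
      using yamanouchi_antimono[OF yamanouchi_wordsD(1)[OF R], of r "Suc r"] by (simp flip: r(2))
    then have "k r \<in> ?F" by (simp add: removable_rows_def)
    then show ?thesis using k[OF R r xy] group_algebra.span_scale group_algebra.span_base by metis
  next
    case False
    then have none: "{r \<in> addable_rows R. shape (r # R) = shape w} = {}" by blast
    have "seminormal R * y * seminormal w = 0"
      using seminormal_refine(2)[OF w R branches xy(2)] unfolding none by simp
    then have "seminormal w * x * s * (seminormal R * y * seminormal w) = 0" by simp
    then show ?thesis by (simp only: mult.assoc group_algebra.span_zero)
  qed
  then show ?thesis
    by (rule that[OF finite_imageI[OF finite_removable_rows] card_image_le[OF finite_removable_rows]])
qed

lemma swap_corner_spanned:
  fixes m :: nat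
  defines "s \<equiv> delta (fswap (Suc m) (Suc (Suc m))) :: galg"
  assumes w: "w \<in> yamanouchi_words (Suc m)" and branches: "\<And>k. k \<le> m \<Longrightarrow> seminormal_branches k"
  obtains F where "finite F" "card F \<le> card (removable_rows w)"
    "\<And>x y. x \<in> CSym (Suc m) \<Longrightarrow> y \<in> CSym (Suc m) \<Longrightarrow>
      seminormal w * (x * s * y) * seminormal w \<in> group_algebra.span F"
proof -
  from swap_corner_summand_spanned[OF w branches[OF order_refl]] obtain F where
    F: "finite F" "card F \<le> card (removable_rows w)"
    "\<And>R x y. \<lbrakk>R \<in> yamanouchi_words m; x \<in> CSym (Suc m); y \<in> CSym (Suc m)\<rbrakk> \<Longrightarrow>
      seminormal w * x * (s * seminormal R) * y * seminormal w \<in> group_algebra.span F"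
    unfolding s_def by blast
  have one: "(\<Sum>R\<in>yamanouchi_words m. seminormal R) = 1"
    by (rule seminormal_sum_if_branches) (simp add: branches)
  have "seminormal w * (x * s * y) * seminormal w \<in> group_algebra.span F"
    if xy: "x \<in> CSym (Suc m)" "y \<in> CSym (Suc m)" for x y
  proof -
    have "seminormal w * (x * s * y) * seminormal w =
        seminormal w * x * s * (\<Sum>R\<in>yamanouchi_words m. seminormal R) * y * seminormal w"
      by (simp add: one mult.assoc)
    also have "\<dots> = (\<Sum>R\<in>yamanouchi_words m. seminormal w * x * (s * seminormal R) * y * seminormal w)"
      by (simp add: sum_distrib_left sum_distrib_right mult.assoc)
    also have "\<dots> \<in> group_algebra.span F" by (intro group_algebra.span_sum F(3) xy)
    finally show ?thesis .
  qed
  with F(1,2) show ?thesis by (rule that)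
qed

lemma seminormal_corner_new_perms_spanned:
  assumes w: "w \<in> yamanouchi_words n" and branches: "\<And>k. k < n \<Longrightarrow> seminormal_branches k"
  obtains F where "finite F" "card F \<le> card (removable_rows w)"
    "\<And>a. a \<in> Sym (Suc n) \<Longrightarrow> a \<notin> Sym n \<Longrightarrow> seminormal w * delta a * seminormal w \<in> group_algebra.span F"
proof (cases n)
  case 0
  have "Sym (Suc 0) \<subseteq> Sym 0"
    using app_in_iff[of _ "Suc 0" "Suc 0"] Sym_Suc_fixing[of _ 0] by auto
  then show thesis by (intro that[of "{}"]) (auto simp: 0)
next
  case (Suc m)
  from swap_corner_spanned[of w m] w branches obtain F where
    F: "finite F" "card F \<le> card (removable_rows w)"
    "\<And>x y. x \<in> CSym (Suc m) \<Longrightarrow> y \<in> CSym (Suc m) \<Longrightarrow>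
      seminormal w * (x * delta (fswap (Suc m) (Suc (Suc m))) * y) * seminormal w \<in> group_algebra.span F"
    unfolding Suc less_Suc_eq_le by metis
  have "seminormal w * delta a * seminormal w \<in> group_algebra.span F"
    if "a \<in> Sym (Suc n)" "a \<notin> Sym n" for a
    using Sym_Suc_double_coset[of a m] F(3)[of "delta _" "delta _"] that
    by (metis CSym_delta Suc delta_plus)
  with F(1,2) show thesis by (rule that)
qed

lemma seminormal_corner_spanned:
  assumes w: "w \<in> yamanouchi_words n" and branches: "\<And>k. k < n \<Longrightarrow> seminormal_branches k"
  obtains F where "finite F" "card F \<le> card (addable_rows w)"
    "\<And>x. x \<in> CSym (Suc n) \<Longrightarrow> seminormal w * x * seminormal w \<in> group_algebra.span F"
proof -
  obtain F where F: "finite F" "card F \<le> card (removable_rows w)"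
    "\<And>a. a \<in> Sym (Suc n) \<Longrightarrow> a \<notin> Sym n \<Longrightarrow> seminormal w * delta a * seminormal w \<in> group_algebra.span F"
    using seminormal_corner_new_perms_spanned[OF assms] by blast
  let ?F = "insert (seminormal w) F"
  have delta: "seminormal w * delta a * seminormal w \<in> group_algebra.span ?F" if "a \<in> Sym (Suc n)" for a
  proof (cases "a \<in> Sym n")
    case True
    then obtain d where "seminormal w * delta a * seminormal w = d \<star> seminormal w"
      using seminormal_corner[of w "delta a"] yamanouchi_wordsD[OF w] by auto
    then show ?thesis by (simp add: group_algebra.span_base group_algebra.span_scale)
  next
    case False
    then show ?thesis using F(3)[OF that] group_algebra.span_mono[of F ?F] by blast
  qed
  have "seminormal w * x * seminormal w \<in> group_algebra.span ?F" if "x \<in> CSym (Suc n)" for x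
    using that
    by (induction rule: CSym_induct)
      (simp_all add: delta distrib_left distrib_right scale_simps
        group_algebra.span_zero group_algebra.span_scale group_algebra.span_add)
  moreover have "card ?F \<le> card (addable_rows w)"
    using F(1,2) by (simp add: card_addable_rows card_insert_if)
  ultimately show ?thesis using that[of ?F] F(1) by simp
qed

lemma seminormal_branches_step:
  assumes "\<And>k. k < n \<Longrightarrow> seminormal_branches k"
  shows "seminormal_branches n"
  unfolding seminormal_branches_def
proof
  fix w assume w: "w \<in> yamanouchi_words n"
  from seminormal_corner_spanned[OF w assms] obtain F where F: "finite F" "card F \<le> card (addable_rows w)"
    "\<And>x. x \<in> CSym (Suc n) \<Longrightarrow> seminormal w * x * seminormal w \<in> group_algebra.span F" by blast
  have yam: "yamanouchi w" using yamanouchi_wordsD[OF w] by simp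
  have refined: "r # w \<in> yamanouchi_words (Suc n)" if "r \<in> addable_rows w" for r
    using that w by (simp add: Cons_in_yamanouchi_words)
  note yam_refined = yamanouchi_wordsD(1)[OF refined]
  note absorb = seminormal_Cons_absorb[OF yam_refined]
  show "seminormal w = (\<Sum>r\<in>addable_rows w. seminormal (r # w))"
  proof (rule eq_sum_of_orthogonal_idempotents[OF F(1,2)])
    show "seminormal w \<in> group_algebra.span F"
      using F(3)[OF CSym_one] by (simp add: seminormal_idem[OF yam])
    show "seminormal (r # w) \<in> group_algebra.span F" if r: "r \<in> addable_rows w" for r
      using F(3)[OF seminormal_in_CSym[OF refined[OF r]]] by (simp only: absorb[OF r])
    show "seminormal (r # w) * seminormal (t # w) = 0"
      if "r \<in> addable_rows w" "t \<in> addable_rows w" "r \<noteq> t" for r t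
      using that by (intro seminormal_orthogonal yam_refined) auto
  qed (simp_all only: finite_addable_rows seminormal_nonzero seminormal_idem yam_refined absorb not_False_eq_True)
qed

lemma seminormal_branches: "seminormal_branches n"
  by (induction n rule: less_induct) (rule seminormal_branches_step)

lemma seminormal_sum: "(\<Sum>w\<in>yamanouchi_words n. seminormal w) = 1"
  by (rule seminormal_sum_if_branches) (rule seminormal_branches)

section \<open>The normalising constant counts standard tableaux\<close>

definition words_of_shape :: "nat \<Rightarrow> (nat \<Rightarrow> nat) \<Rightarrow> nat list set" where
  "words_of_shape n l = {w \<in> yamanouchi_words n. shape w = l}"

lemma words_of_shape_subset: "words_of_shape n l \<subseteq> yamanouchi_words n"
  by (auto simp: words_of_shape_def)

lemma finite_words_of_shape [simp]: "finite (words_of_shape n l)"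
  using words_of_shape_subset by (rule finite_subset) simp

lemma young_scalar_same_shape:
  assumes "yamanouchi w" "yamanouchi v" "shape w = shape v"
  shows "young_scalar w = young_scalar v"
proof -
  obtain a b where "matrix_units (length w) (seminormal w) (seminormal v) a b"
    using seminormal_matrix_units[OF assms] .
  then have "trace (seminormal w) = trace (seminormal v)"
    by (metis matrix_unitsD(3,4) trace_commute)
  then show ?thesis using trace_seminormal assms by simp
qed

lemma seminormal_delta_seminormal:
  assumes "yamanouchi w" "a \<in> Sym (length w)"
  shows "seminormal w * delta a * seminormal w =
      (young_scalar w * coef (seminormal w) (- a)) \<star> seminormal w"
proof -
  obtain c where c: "seminormal w * delta a * seminormal w = c \<star> seminormal w"
    using seminormal_corner[OF assms(1), of "delta a"] assms(2) by auto
  have "trace (seminormal w * delta a * seminormal w) = trace (seminormal w * (seminormal w * delta a))"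
    by (rule trace_commute)
  then have "trace (seminormal w * delta a * seminormal w) = coef (seminormal w) (- a)"
    by (simp add: seminormal_idem_left[OF assms(1)] trace_mult_delta)
  moreover have "trace (seminormal w * delta a * seminormal w) = c / young_scalar w"
    unfolding c by (simp add: trace_seminormal[OF assms(1)])
  ultimately show ?thesis using young_scalar_nonzero[OF assms(1)] c by (simp add: field_simps)
qed

definition conj_average :: "nat \<Rightarrow> galg \<Rightarrow> galg" where
  "conj_average n x = (\<Sum>a\<in>Sym n. delta a * x * delta (- a))"

lemma conj_average_central:
  assumes "y \<in> CSym n"
  shows "conj_average n x * y = y * conj_average n x"
proof (rule CSym_commute[OF assms])
  fix b assume b: "b \<in> Sym n"
  have "conj_average n x = (\<Sum>a\<in>Sym n. delta (b + a) * x * delta (- (b + a)))"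
    unfolding conj_average_def
    by (rule sum.reindex_bij_betw[OF bij_betw_plus_subgroup(1)[OF add_subgroup_Sym b], symmetric])
  also have "\<dots> = (\<Sum>a\<in>Sym n. delta b * (delta a * x * delta (- a)) * delta (- b))"
    by (rule sum.cong) (simp_all only: minus_add delta_plus mult.assoc)
  also have "\<dots> = delta b * conj_average n x * delta (- b)"
    by (simp add: conj_average_def sum_distrib_left sum_distrib_right)
  finally have "conj_average n x * delta b = delta b * conj_average n x * delta (- b) * delta b"
    by (rule arg_cong)
  then show "conj_average n x * delta b = delta b * conj_average n x" by (simp add: mult.assoc)
qed

lemma trace_conj_average: "trace (conj_average n x) = fact n * trace x"
proof -
  have "trace (delta a * x * delta (- a)) = trace x" for a
    by (subst trace_commute) simp
  then show ?thesis by (simp add: conj_average_def lookup_sum card_Sym)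
qed

lemma seminormal_mult_own_conj_average:
  assumes w: "w \<in> yamanouchi_words n"
  shows "seminormal w * conj_average n (seminormal w) = young_scalar w \<star> seminormal w"
proof -
  have yam: "yamanouchi w" "length w = n" using yamanouchi_wordsD[OF w] .
  have "seminormal w * conj_average n (seminormal w) =
      (\<Sum>a\<in>Sym n. (seminormal w * delta a * seminormal w) * delta (- a))"
    by (simp add: conj_average_def sum_distrib_left mult.assoc)
  also have "\<dots> = (\<Sum>a\<in>Sym n. young_scalar w \<star> (seminormal w * (coef (seminormal w) (- a) \<star> delta (- a))))"
    by (rule sum.cong) (simp_all add: seminormal_delta_seminormal[OF yam(1)] yam(2) scale_simps)
  also have "\<dots> = young_scalar w \<star> (seminormal w * (\<Sum>a\<in>Sym n. coef (seminormal w) (- a) \<star> delta (- a)))"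
    by (simp add: scale_sum sum_distrib_left)
  also have "(\<Sum>a\<in>Sym n. coef (seminormal w) (- a) \<star> delta (- a)) =
      (\<Sum>a\<in>Sym n. coef (seminormal w) a \<star> (delta a :: galg))"
    by (rule sum.reindex_bij_witness[of _ uminus uminus]) auto
  also have "\<dots> = seminormal w" by (rule CSym_expand[OF seminormal_in_CSym[OF w], symmetric])
  finally show ?thesis by (simp add: seminormal_idem[OF yam(1)])
qed

lemma seminormal_mult_conj_average:
  assumes v: "v \<in> yamanouchi_words n" and w: "w \<in> yamanouchi_words n"
  shows "seminormal v * conj_average n (seminormal w) =
    (if shape v = shape w then young_scalar w else 0) \<star> seminormal v"
proof (cases "shape v = shape w")
  case True
  obtain x y where xy: "x \<in> CSym n" "y \<in> CSym n" "seminormal v = x * seminormal w * y"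
    using seminormal_same_shape_factor[of v w] yamanouchi_wordsD[OF v]
      yamanouchi_wordsD[OF w] True by metis
  have "seminormal v * conj_average n (seminormal w) =
      x * (seminormal w * conj_average n (seminormal w)) * y"
    unfolding xy(3) by (simp add: mult.assoc conj_average_central[OF xy(2)])
  then show ?thesis
    unfolding seminormal_mult_own_conj_average[OF w] using True by (simp add: scale_simps xy(3))
next
  case False
  have "seminormal v * (delta a * seminormal w * delta (- a)) = 0" if "a \<in> Sym n" for a
  proof -
    have "seminormal v * delta a * seminormal w = 0"
      using yamanouchi_wordsD[OF v] yamanouchi_wordsD[OF w] False that
      by (intro seminormal_different_shapes) auto
    then show ?thesis by (simp flip: mult.assoc)
  qed
  then show ?thesis using False by (simp add: conj_average_def sum_distrib_left)
qed

lemma young_scalar_mult_card_words_of_shape: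
  assumes w: "w \<in> yamanouchi_words n"
  shows "young_scalar w * of_nat (card (words_of_shape n (shape w))) = fact n"
proof -
  let ?S = "words_of_shape n (shape w)" and ?W = "conj_average n (seminormal w)"
  have yam: "yamanouchi w" using yamanouchi_wordsD[OF w] by simp
  have "?W = (\<Sum>v\<in>yamanouchi_words n. seminormal v * ?W)"
    by (simp add: seminormal_sum flip: sum_distrib_right)
  also have "\<dots> = (\<Sum>v\<in>yamanouchi_words n. if shape v = shape w then young_scalar w \<star> seminormal v else 0)"
    by (intro sum.cong refl) (simp add: seminormal_mult_conj_average w)
  also have "\<dots> = (\<Sum>v\<in>?S. young_scalar w \<star> seminormal v)"
    unfolding words_of_shape_def by (rule sum.inter_filter[symmetric]) simp
  finally have "trace ?W = (\<Sum>v\<in>?S. young_scalar w * trace (seminormal v))" by (simp add: lookup_sum)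
  also have "\<dots> = (\<Sum>v\<in>?S. 1)"
  proof (intro sum.cong refl)
    fix v assume "v \<in> ?S"
    then have "yamanouchi v" "young_scalar v = young_scalar w"
      using young_scalar_same_shape[OF _ yam] by (auto simp: words_of_shape_def yamanouchi_words_def)
    then show "young_scalar w * trace (seminormal v) = 1"
      using young_scalar_nonzero[OF yam] by (simp add: trace_seminormal)
  qed
  finally have "fact n / young_scalar w = of_nat (card ?S)"
    by (simp add: trace_conj_average trace_seminormal[OF yam])
  then show ?thesis using young_scalar_nonzero[OF yam] by (simp add: field_simps)
qed

section \<open>Jucys--Murphy elements\<close>

definition jm :: "nat \<Rightarrow> galg" where
  "jm n = (\<Sum>j\<in>{1..<n}. delta (fswap j n))"

definition off_diag :: "nat \<Rightarrow> (nat \<times> nat) set" where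
  "off_diag n = {(a, b) \<in> {1..n} \<times> {1..n}. a \<noteq> b}"

text \<open>Summing over ordered pairs, each transposition is counted twice.\<close>

definition fswap_sum :: "nat \<Rightarrow> galg" where
  "fswap_sum n = (\<Sum>(a, b)\<in>off_diag n. delta (fswap a b))"

lemma finite_off_diag [simp]: "finite (off_diag n)"
  by (rule finite_subset[of _ "{1..n} \<times> {1..n}"]) (auto simp: off_diag_def)

lemma sum_off_diag_Suc:
  fixes h :: "nat \<Rightarrow> nat \<Rightarrow> 'a::comm_monoid_add"
  shows "(\<Sum>(a, b)\<in>off_diag (Suc n). h a b) =
    (\<Sum>(a, b)\<in>off_diag n. h a b) + ((\<Sum>a\<in>{1..n}. h a (Suc n)) + (\<Sum>a\<in>{1..n}. h (Suc n) a))"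
proof -
  have "off_diag (Suc n) = off_diag n \<union> ((\<lambda>a. (a, Suc n)) ` {1..n} \<union> (\<lambda>a. (Suc n, a)) ` {1..n})"
    by (auto simp: off_diag_def le_Suc_eq)
  moreover have "off_diag n \<inter> ((\<lambda>a. (a, Suc n)) ` {1..n} \<union> (\<lambda>a. (Suc n, a)) ` {1..n}) = {}"
    "(\<lambda>a. (a, Suc n)) ` {1..n} \<inter> (\<lambda>a. (Suc n, a)) ` {1..n} = {}"
    by (auto simp: off_diag_def)
  ultimately show ?thesis
    by (simp add: sum.union_disjoint sum.reindex inj_on_def)
qed

lemma fswap_sum_Suc: "fswap_sum (Suc n) = fswap_sum n + 2 \<star> jm (Suc n)"
proof -
  have "jm (Suc n) = (\<Sum>a\<in>{1..n}. delta (fswap a (Suc n)))"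
    by (simp add: jm_def atLeastLessThanSuc_atLeastAtMost)
  moreover have "2 \<star> x = x + x" for x :: galg
    using scale_distrib(2)[of 1 1 x] by simp
  ultimately show ?thesis
    unfolding fswap_sum_def sum_off_diag_Suc by (simp add: fswap_commute[of "Suc n"])
qed

lemma plus_fswap:
  assumes "a \<in> Sym n" "x \<in> {1..n}" "y \<in> {1..n}"
  shows "a + fswap x y = fswap (app a x) (app a y) + a"
proof (rule fperm_eqI)
  fix z
  have "app a x \<in> {1..n}" "app a y \<in> {1..n}" using assms app_in_iff by blast+
  then show "app (a + fswap x y) z = app (fswap (app a x) (app a y) + a) z"
    using assms by (simp add: app_fswap Transposition.transpose_def)
qed

lemma fswap_sum_central:
  assumes "x \<in> CSym n"
  shows "fswap_sum n * x = x * fswap_sum n"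
proof (rule CSym_commute[OF assms])
  fix a assume a: "a \<in> Sym n"
  have in_iff: "app a x \<in> {1..n} \<longleftrightarrow> x \<in> {1..n}" "app (- a) x \<in> {1..n} \<longleftrightarrow> x \<in> {1..n}" for x
    using app_in_iff[of a n] app_in_iff[of "- a" n] a by simp_all
  have "delta a * fswap_sum n = (\<Sum>(x, y)\<in>off_diag n. delta a * delta (fswap x y))"
    by (simp add: fswap_sum_def sum_distrib_left case_prod_unfold)
  also have "\<dots> = (\<Sum>(x, y)\<in>off_diag n. delta (fswap (app a x) (app a y)) * delta a)"
    by (rule sum.cong)
      (auto simp: off_diag_def plus_fswap[OF a] simp flip: delta_plus simp del: atLeastAtMost_iff)
  also have "\<dots> = (\<Sum>(x, y)\<in>off_diag n. delta (fswap x y) * delta a)"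
    by (rule sum.reindex_bij_witness[of _ "\<lambda>(x, y). (app (- a) x, app (- a) y)"
          "\<lambda>(x, y). (app a x, app a y)"])
      (auto simp: off_diag_def in_iff simp del: atLeastAtMost_iff One_nat_def)
  also have "\<dots> = fswap_sum n * delta a"
    by (simp add: fswap_sum_def sum_distrib_right case_prod_unfold)
  finally show "fswap_sum n * delta a = delta a * fswap_sum n" ..
qed

text \<open>A transposition \<open>\<tau> = (a b)\<close> that is a product of a row permutation \<open>p\<^sup>-\<^sup>1\<close> and a column permutation preserves
  rows or columns, since \<open>p\<close> fixes every entry not moved by \<open>\<tau>\<close>.\<close>

lemma fswap_row_column_factor:
  assumes inj: "inj_on (\<lambda>x. (f x, g x)) {1..n}" and ab: "a \<in> {1..n}" "b \<in> {1..n}" "a \<noteq> b"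
    and p: "p \<in> label_stab n f" "p + fswap a b \<in> label_stab n g"
  shows "f a = f b \<or> g a = g b"
proof -
  have row: "f (app p x) = f x" if "x \<in> {1..n}" for x using p(1) that by (simp add: label_stab_def)
  have col: "g (app p (app (fswap a b) x)) = g x" if "x \<in> {1..n}" for x
    using p(2) that by (simp add: label_stab_def)
  have app_swap: "app (fswap a b) x = (if x = a then b else if x = b then a else x)" for x
    using ab by (simp add: app_fswap Transposition.transpose_def)
  have p_in: "app p x \<in> {1..n}" if "x \<in> {1..n}" for x
    using p(1) that app_in_iff[of p n x] by (simp add: label_stab_def)
  have p_fix: "app p x = x" if "x \<in> {1..n}" "x \<noteq> a" "x \<noteq> b" for x
    using that row col[OF that(1)] p_in by (intro inj_onD[OF inj]) (auto simp: app_swap)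
  have "app p a = a \<or> app p a = b"
    using p_fix[OF p_in[OF ab(1)]] app_eq_iff[of p "app p a" a] by blast
  then show ?thesis
  proof
    assume "app p a = a"
    then have "g a = g b" using col[OF ab(2)] ab(3) by (simp add: app_swap)
    then show ?thesis ..
  next
    assume "app p a = b"
    then show ?thesis using row[OF ab(1)] by simp
  qed
qed

lemma symmetrizer_fswap_antisymmetrizer:
  assumes fg: "filling l n f g" and ab: "a \<in> {1..n}" "b \<in> {1..n}" "a \<noteq> b"
  shows "symmetrizer n f * delta (fswap a b) * antisymmetrizer n g =
    ((if f a = f b then 1 else 0) - (if g a = g b then 1 else 0)) \<star>
      (symmetrizer n f * antisymmetrizer n g)"
proof -
  let ?t = "fswap a b"
  have swap: "?t \<in> Sym n" "fsign ?t = - 1" using ab by (simp_all add: fswap_in_Sym fsign_fswap)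
  consider (row) "f a = f b" "g a \<noteq> g b" | (col) "f a \<noteq> f b" "g a = g b"
    | (neither) "f a \<noteq> f b" "g a \<noteq> g b"
    using inj_onD[OF filling_inj[OF fg], of a b] ab by auto
  then show ?thesis
  proof cases
    case row
    then have "?t \<in> label_stab n f" using ab by (simp add: fswap_in_label_stab)
    then show ?thesis using row by (simp add: symmetrizer_absorbs)
  next
    case col
    then have "?t \<in> label_stab n g" using ab by (simp add: fswap_in_label_stab)
    then show ?thesis using col swap(2) by (simp add: mult.assoc antisymmetrizer_absorbs scale_simps)
  next
    case neither
    from fg swap(1) have "symmetrizer n f * delta ?t * antisymmetrizer n g = 0"
      using fswap_row_column_factor[OF filling_inj[OF fg] ab] neither
      by (cases rule: symmetrizer_delta_antisymmetrizer_cases) auto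
    then show ?thesis using neither by simp
  qed
qed

definition twice_content_sum :: "nat list \<Rightarrow> complex" where
  "twice_content_sum w = (\<Sum>(a, b)\<in>off_diag (length w).
     (if row_of w a = row_of w b then 1 else 0) - (if col_of w a = col_of w b then 1 else 0))"

lemma fswap_sum_young_product:
  assumes "yamanouchi w"
  shows "fswap_sum (length w) * young_product w = twice_content_sum w \<star> young_product w"
proof -
  let ?P = "symmetrizer (length w) (row_of w)" and ?N = "antisymmetrizer (length w) (col_of w)"
  have "fswap_sum (length w) * young_product w = ?P * fswap_sum (length w) * ?N"
    unfolding young_product_def by (simp add: fswap_sum_central[OF symmetrizer_CSym] flip: mult.assoc)
  also have "\<dots> = (\<Sum>(a, b)\<in>off_diag (length w). ?P * delta (fswap a b) * ?N)"
    by (simp add: fswap_sum_def sum_distrib_left sum_distrib_right case_prod_unfold)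
  also have "\<dots> = twice_content_sum w \<star> young_product w"
    unfolding twice_content_sum_def sum_scale young_product_def
    by (rule sum.cong)
      (auto simp: off_diag_def symmetrizer_fswap_antisymmetrizer[OF yamanouchi_filling[OF assms]])
  finally show ?thesis .
qed

lemma fswap_sum_seminormal:
  assumes "yamanouchi w"
  shows "fswap_sum (length w) * seminormal w = twice_content_sum w \<star> seminormal w"
proof (cases w)
  case Nil
  then show ?thesis by (simp add: fswap_sum_def twice_content_sum_def off_diag_def)
next
  case (Cons r v)
  have "fswap_sum (length w) * seminormal w =
      (1 / young_scalar w) \<star> (fswap_sum (length w) * seminormal v * young_product w * seminormal v)"
    by (simp add: Cons scale_simps mult.assoc)
  also have "fswap_sum (length w) * seminormal v * young_product w * seminormal v =
      seminormal v * (fswap_sum (length w) * young_product w) * seminormal v"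
    using fswap_sum_central[of "seminormal v" "length w"] seminormal_CSym_Suc[of v] Cons
    by (simp add: mult.assoc)
  finally show ?thesis
    unfolding fswap_sum_young_product[OF assms] by (simp add: Cons scale_simps mult.commute)
qed

text \<open>The letter \<^term>\<open>hd w\<close> is the row of the largest entry, so this is its column minus its row.\<close>

definition last_content :: "nat list \<Rightarrow> int" where
  "last_content w = int (shape (tl w) (hd w)) - int (hd w)"

lemma twice_content_sum_Cons:
  assumes "yamanouchi (r # w)"
  shows "twice_content_sum (r # w) = twice_content_sum w + 2 * of_int (last_content (r # w))"
proof -
  let ?n = "length w"
  let ?h = "\<lambda>v a b. ((if row_of v a = row_of v b then 1 else 0) -
      (if col_of v a = col_of v b then 1 else 0))
    :: complex"
  have old: "(\<Sum>(a, b)\<in>off_diag ?n. ?h (r # w) a b) = twice_content_sum w"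
    unfolding twice_content_sum_def by (rule sum.cong) (auto simp: off_diag_def)
  have new: "(\<Sum>a\<in>{1..?n}. ?h (r # w) a (Suc ?n)) = of_int (last_content (r # w))"
  proof -
    have "(\<Sum>a\<in>{1..?n}. ?h (r # w) a (Suc ?n)) =
        (\<Sum>a\<in>{1..?n}. if row_of w a = r then 1 else 0) -
        (\<Sum>a\<in>{1..?n}. if col_of w a = shape w r then 1 else 0)"
      unfolding sum_subtractf[symmetric] by (rule sum.cong) auto
    also have "\<dots> = of_nat (card {a \<in> {1..?n}. row_of w a = r}) -
        of_nat (card {a \<in> {1..?n}. col_of w a = shape w r})"
      by (simp add: sum.If_cases Int_def)
    finally show ?thesis
      using card_addable_column[OF yamanouchi_filling, of w r] card_row[OF yamanouchi_filling, of w r] assms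
      by (simp add: last_content_def)
  qed
  have sym: "(\<Sum>a\<in>{1..?n}. ?h (r # w) (Suc ?n) a) = (\<Sum>a\<in>{1..?n}. ?h (r # w) a (Suc ?n))"
    by (simp only: eq_commute[of "row_of (r # w) (Suc ?n)"] eq_commute[of "col_of (r # w) (Suc ?n)"])
  have "twice_content_sum (r # w) = (\<Sum>(a, b)\<in>off_diag ?n. ?h (r # w) a b) +
      ((\<Sum>a\<in>{1..?n}. ?h (r # w) a (Suc ?n)) + (\<Sum>a\<in>{1..?n}. ?h (r # w) (Suc ?n) a))"
    unfolding twice_content_sum_def list.size add_0_right add_Suc_right by (rule sum_off_diag_Suc)
  then show ?thesis unfolding old sym new by simp
qed

lemma jm_seminormal:
  assumes w: "w \<in> yamanouchi_words (Suc n)"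
  shows "jm (Suc n) * seminormal w = of_int (last_content w) \<star> seminormal w"
proof -
  obtain r v where w_eq: "w = r # v" and v: "yamanouchi v" "length v = n" and yam: "yamanouchi (r # v)"
    using w by (cases w) (auto simp: yamanouchi_words_def)
  note absorb = seminormal_Cons_absorb(1)[OF yam, folded w_eq]
  have "fswap_sum n * seminormal w = fswap_sum n * seminormal v * seminormal w"
    unfolding mult.assoc absorb ..
  also have "\<dots> = twice_content_sum v \<star> seminormal w"
    using fswap_sum_seminormal[OF v(1)] v(2) by (simp add: scale_simps absorb)
  finally have "2 \<star> (jm (Suc n) * seminormal w) =
      fswap_sum (Suc n) * seminormal w - twice_content_sum v \<star> seminormal w"
    by (simp add: fswap_sum_Suc distrib_right scale_simps)
  also have "fswap_sum (Suc n) * seminormal w = twice_content_sum w \<star> seminormal w"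
    using fswap_sum_seminormal[of w] yamanouchi_wordsD[OF w] by simp
  also have "twice_content_sum w \<star> seminormal w - twice_content_sum v \<star> seminormal w =
      2 \<star> (of_int (last_content w) \<star> seminormal w)"
    unfolding w_eq twice_content_sum_Cons[OF yam] scale_distrib(4)[symmetric] scale_simps by simp
  finally show ?thesis by (rule scale_left_cancel[rotated]) simp
qed

lemma jm_CSym: "jm n \<in> CSym n"
  by (auto simp: jm_def fswap_in_Sym intro!: CSym_sum)

lemma jm_commute:
  assumes "x \<in> CSym n"
  shows "jm (Suc n) * x = x * jm (Suc n)"
proof -
  have "fswap_sum (Suc n) * x = x * fswap_sum (Suc n)"
    by (rule fswap_sum_central[OF CSym_SucI[OF assms]])
  then have "2 \<star> (jm (Suc n) * x) = 2 \<star> (x * jm (Suc n))"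
    using fswap_sum_central[OF assms] by (simp add: fswap_sum_Suc distrib_left distrib_right scale_simps)
  then show ?thesis by (rule scale_left_cancel[rotated]) simp
qed

lemma jm_power:
  "jm (Suc n) ^ k = (\<Sum>w\<in>yamanouchi_words (Suc n). of_int (last_content w) ^ k \<star> seminormal w)"
proof (induction k)
  case 0
  then show ?case by (simp add: seminormal_sum)
next
  case (Suc k)
  then show ?case
    by (simp add: sum_distrib_left scale_simps jm_seminormal mult.commute)
qed

section \<open>Shape projections\<close>

definition shape_projection :: "nat \<Rightarrow> (nat \<Rightarrow> nat) \<Rightarrow> galg" where
  "shape_projection n l = (\<Sum>w\<in>words_of_shape n l. seminormal w)"

lemma shape_projection_central:
  assumes "x \<in> CSym n"
  shows "shape_projection n l * x = x * shape_projection n l"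
proof -
  let ?L = "words_of_shape n l"
  have zero: "seminormal w * x * seminormal v = 0"
    if "w \<in> yamanouchi_words n" "v \<in> yamanouchi_words n" "shape w \<noteq> shape v" for w v
    using that assms by (intro seminormal_different_shapes) (auto simp: yamanouchi_words_def)
  have "shape_projection n l * x = shape_projection n l * x * (\<Sum>v\<in>yamanouchi_words n. seminormal v)"
    by (simp add: seminormal_sum)
  also have "\<dots> = (\<Sum>w\<in>?L. \<Sum>v\<in>yamanouchi_words n. seminormal w * x * seminormal v)"
    by (simp add: shape_projection_def sum_distrib_left sum_distrib_right)
      (rule sum.swap)
  also have "\<dots> = (\<Sum>w\<in>?L. \<Sum>v\<in>?L. seminormal w * x * seminormal v)"
    by (intro sum.cong refl sum.mono_neutral_right) (auto simp: words_of_shape_def intro: zero)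
  also have "\<dots> = (\<Sum>v\<in>?L. \<Sum>w\<in>?L. seminormal w * x * seminormal v)" by (rule sum.swap)
  also have "\<dots> = (\<Sum>v\<in>?L. \<Sum>w\<in>yamanouchi_words n. seminormal w * x * seminormal v)"
    by (intro sum.cong refl sum.mono_neutral_left) (auto simp: words_of_shape_def intro: zero)
  also have "\<dots> = (\<Sum>v\<in>yamanouchi_words n. seminormal v) * x * shape_projection n l"
    by (simp add: shape_projection_def sum_distrib_left sum_distrib_right)
  finally show ?thesis by (simp add: seminormal_sum)
qed

lemma seminormal_mult_lower:
  assumes w: "w \<in> yamanouchi_words (Suc n)" and v: "v \<in> yamanouchi_words n"
  shows "seminormal w * seminormal v = (if v = tl w then seminormal w else 0)"
proof -
  obtain r u where w_eq: "w = r # u" using w by (cases w) (auto simp: yamanouchi_words_def)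
  have u: "u \<in> yamanouchi_words n" using w by (simp add: w_eq Cons_in_yamanouchi_words)
  note absorb = seminormal_Cons_absorb(2)[OF yamanouchi_wordsD(1)[OF w[unfolded w_eq]], folded w_eq]
  show ?thesis
  proof (cases "v = u")
    case True
    then show ?thesis using absorb by (simp add: w_eq del: seminormal.simps)
  next
    case False
    then have "seminormal u * seminormal v = 0"
      using yamanouchi_wordsD[OF u] yamanouchi_wordsD[OF v] by (intro seminormal_orthogonal) auto
    then have "seminormal w * seminormal u * seminormal v = 0" by (simp add: mult.assoc)
    then show ?thesis using False unfolding absorb by (simp add: w_eq del: seminormal.simps)
  qed
qed

lemma shape_projection_mult_lower:
  "shape_projection (Suc n) l * shape_projection n l' =
    (\<Sum>w | w \<in> words_of_shape (Suc n) l \<and> shape (tl w) = l'. seminormal w)"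
proof -
  let ?L = "words_of_shape (Suc n) l" and ?L' = "words_of_shape n l'"
  have "shape_projection (Suc n) l * shape_projection n l' = (\<Sum>w\<in>?L. \<Sum>v\<in>?L'. seminormal w * seminormal v)"
    unfolding shape_projection_def by (rule sum_product)
  also have "\<dots> = (\<Sum>w\<in>?L. \<Sum>v\<in>?L'. if v = tl w then seminormal w else 0)"
    by (intro sum.cong refl) (auto simp: seminormal_mult_lower words_of_shape_def)
  also have "\<dots> = (\<Sum>w\<in>?L. if tl w \<in> ?L' then seminormal w else 0)"
    by (intro sum.cong refl) simp
  also have "\<dots> = (\<Sum>w\<in>{w \<in> ?L. tl w \<in> ?L'}. seminormal w)"
    by (rule sum.inter_filter[symmetric]) simp
  also have "{w \<in> ?L. tl w \<in> ?L'} = {w. w \<in> ?L \<and> shape (tl w) = l'}"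
  proof -
    have "tl w \<in> yamanouchi_words n" if "w \<in> ?L" for w
      using that by (cases w) (auto simp: words_of_shape_def yamanouchi_words_def)
    then show ?thesis by (auto simp: words_of_shape_def)
  qed
  finally show ?thesis .
qed

lemma last_row_determined:
  assumes "yamanouchi (r # w)" "yamanouchi (s # v)" "shape (r # w) = shape (s # v)"
    "shape (r # w) r = shape (s # v) s"
  shows "shape w = shape v"
proof -
  have less: "shape (r # w) s < shape (r # w) r" if "yamanouchi (r # w)" "r < s" for r s w
    using yamanouchi_antimono[of w r s] that by (auto simp: le_imp_less_Suc)
  have "r = s"
    using less[OF assms(1), of s] less[OF assms(2), of r] assms(3,4)
    by (metis less_irrefl linorder_neqE_nat)
  then show ?thesis
    using assms(3) by (auto simp: fun_eq_iff split: if_splits)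
qed

definition marked_words :: "nat \<Rightarrow> (nat \<Rightarrow> nat) \<Rightarrow> nat \<Rightarrow> nat list set" where
  "marked_words n l j = {w \<in> words_of_shape n l. l (hd w) = j}"

lemma marked_words_eq:
  assumes v: "v \<in> marked_words (Suc n) l j"
  shows "marked_words (Suc n) l j = {w. w \<in> words_of_shape (Suc n) l \<and> shape (tl w) = shape (tl v)}"
proof -
  have row_iff: "l (hd w) = j \<longleftrightarrow> shape (tl w) = shape (tl v)" if w: "w \<in> words_of_shape (Suc n) l" for w
  proof -
    obtain r u where w_eq: "w = r # u" using w
      by (cases w) (auto simp: words_of_shape_def yamanouchi_words_def)
    obtain s t where v_eq: "v = s # t" using v
      by (cases v) (auto simp: marked_words_def words_of_shape_def yamanouchi_words_def)
    have yam: "yamanouchi (r # u)" "yamanouchi (s # t)"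
      and l: "shape (r # u) = l" "shape (s # t) = l" "l s = j"
      using v w by (auto simp: marked_words_def words_of_shape_def yamanouchi_words_def w_eq v_eq
          simp del: yamanouchi.simps)
    show ?thesis
    proof
      assume "l (hd w) = j"
      then show "shape (tl w) = shape (tl v)"
        using last_row_determined[OF yam] l by (simp add: w_eq v_eq)
    next
      assume "shape (tl w) = shape (tl v)"
      then have "r = s"
        using fun_cong[OF l(1), of r] fun_cong[OF l(2), of r] by (auto simp: w_eq v_eq split: if_splits)
      then show "l (hd w) = j" using l(3) by (simp add: w_eq)
    qed
  qed
  then show ?thesis by (auto simp: marked_words_def)
qed

lemma marked_words_sum_commute:
  assumes "x \<in> CSym n"
  shows "(\<Sum>w\<in>marked_words (Suc n) l j. seminormal w) * x =
      x * (\<Sum>w\<in>marked_words (Suc n) l j. seminormal w)"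
proof (cases "marked_words (Suc n) l j = {}")
  case False
  then obtain v where v: "v \<in> marked_words (Suc n) l j" by blast
  have product: "(\<Sum>w\<in>marked_words (Suc n) l j. seminormal w) =
      shape_projection (Suc n) l * shape_projection n (shape (tl v))"
    unfolding shape_projection_mult_lower marked_words_eq[OF v, symmetric] ..
  have "shape_projection (Suc n) l * shape_projection n (shape (tl v)) * x =
      shape_projection (Suc n) l * x * shape_projection n (shape (tl v))"
    by (simp only: mult.assoc shape_projection_central[OF assms])
  also have "\<dots> = x * (shape_projection (Suc n) l * shape_projection n (shape (tl v)))"
    by (simp only: shape_projection_central[OF CSym_SucI[OF assms]] mult.assoc)
  finally show ?thesis unfolding product .
qed simp

section \<open>Comparison with the function model of the group algebra\<close>

lemma carrier_sym_group: "carrier (sym_group n) = {p. p permutes {1..n}}"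
  by (simp add: sym_group_def)

lemma carrier_sym_group_app: "carrier (sym_group n) = app ` Sym n"
  using bij_betw_app_Sym[of n] by (simp add: carrier_sym_group bij_betw_def)

lemma app_in_sym_group_iff: "app a \<in> carrier (sym_group n) \<longleftrightarrow> a \<in> Sym n"
  by (simp add: carrier_sym_group Sym_def)

lemma abelian_monoid_sym_alg: "abelian_monoid (sym_alg n)"
  by (rule abelian_monoidI) (auto simp: sym_alg_def ac_simps)

lemma finsum_sym_alg:
  assumes "finite A" "\<And>x. x \<in> A \<Longrightarrow> f x \<in> carrier (sym_alg n)"
  shows "finsum (sym_alg n) f A = (\<lambda>\<sigma>. \<Sum>x\<in>A. f x \<sigma>)"
  using assms
proof (induction A rule: finite_induct)
  case empty
  then show ?case
    by (simp add: abelian_monoid.finsum_empty[OF abelian_monoid_sym_alg]) (simp add: sym_alg_def)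
next
  case (insert x A)
  then have "finsum (sym_alg n) f (insert x A) = f x \<oplus>\<^bsub>sym_alg n\<^esub> finsum (sym_alg n) f A"
    by (intro abelian_monoid.finsum_insert[OF abelian_monoid_sym_alg]) auto
  then show ?case using insert by (simp add: sym_alg_def)
qed

definition to_alg :: "galg \<Rightarrow> alg_elt" where
  "to_alg x = (\<lambda>\<sigma>. if \<exists>m. \<sigma> permutes {1..m} then coef x (Fperm \<sigma>) else 0)"

lemma to_alg_app [simp]: "to_alg x (app a) = coef x a"
  using app[of a] by (simp add: to_alg_def app_inverse)

lemma to_alg_outside:
  assumes x: "x \<in> CSym n" and \<sigma>: "\<sigma> \<notin> carrier (sym_group n)"
  shows "to_alg x \<sigma> = 0"
proof (cases "\<exists>m. \<sigma> permutes {1..m}")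
  case True
  then obtain a where "\<sigma> = app a" by (metis app_Fperm)
  then show ?thesis using \<sigma> coef_outside_Sym[OF x, of a] by (simp add: app_in_sym_group_iff)
qed (simp add: to_alg_def)

lemma to_alg_carrier: "x \<in> CSym n \<Longrightarrow> to_alg x \<in> carrier (sym_alg n)"
  using to_alg_outside by (simp add: sym_alg_def)

lemma sym_alg_eqI:
  assumes "g \<in> carrier (sym_alg n)" "h \<in> carrier (sym_alg n)" "\<And>a. a \<in> Sym n \<Longrightarrow> g (app a) = h (app a)"
  shows "g = h"
proof
  fix \<sigma>
  show "g \<sigma> = h \<sigma>"
    using assms by (cases "\<sigma> \<in> carrier (sym_group n)") (auto simp: sym_alg_def carrier_sym_group_app)
qed

lemma to_alg_sum: "to_alg (sum f A) = (\<lambda>\<sigma>. \<Sum>x\<in>A. to_alg (f x) \<sigma>)"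
  by (simp add: to_alg_def lookup_sum fun_eq_iff)

lemma finsum_to_alg:
  assumes "inj_on t A" "finite A" "\<And>x. x \<in> A \<Longrightarrow> h x \<in> CSym n" "\<And>x. x \<in> A \<Longrightarrow> f (t x) = to_alg (h x)"
  shows "finsum (sym_alg n) f (t ` A) = to_alg (sum h A)"
proof -
  have "finsum (sym_alg n) f (t ` A) = (\<lambda>\<sigma>. \<Sum>y\<in>t ` A. f y \<sigma>)"
    using assms by (intro finsum_sym_alg) (auto simp: to_alg_carrier)
  also have "\<dots> = to_alg (sum h A)"
    by (simp add: sum.reindex[OF assms(1)] to_alg_sum assms(4) fun_eq_iff)
  finally show ?thesis .
qed

lemma to_alg_smult: "c \<odot>\<^bsub>sym_alg n\<^esub> to_alg x = to_alg (c \<star> x)"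
  by (simp add: sym_alg_def to_alg_def fun_eq_iff)

lemma to_alg_delta: "to_alg (delta a) = of_perm (app a)"
proof
  fix \<sigma>
  show "to_alg (delta a) \<sigma> = of_perm (app a) \<sigma>"
  proof (cases "\<exists>m. \<sigma> permutes {1..m}")
    case True
    then obtain b where "\<sigma> = app b" by (metis app_Fperm)
    then show ?thesis by (auto simp: of_perm_def lookup_single when_def app_inject)
  next
    case False
    then have "\<sigma> \<noteq> app a" using app[of a] by blast
    then show ?thesis using False by (simp add: to_alg_def of_perm_def)
  qed
qed

lemma to_alg_one: "to_alg 1 = \<one>\<^bsub>sym_alg n\<^esub>"
  using to_alg_delta[of 0] by (simp add: sym_alg_def zero_fperm.rep_eq)

lemma sym_alg_mult_closed:
  assumes "g \<in> carrier (sym_alg n)" "h \<in> carrier (sym_alg n)"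
  shows "g \<otimes>\<^bsub>sym_alg n\<^esub> h \<in> carrier (sym_alg n)"
proof -
  have "h (Hilbert_Choice.inv \<rho> \<circ> \<sigma>) = 0" if \<rho>: "\<rho> permutes {1..n}" and \<sigma>: "\<not> \<sigma> permutes {1..n}" for \<rho> \<sigma>
  proof -
    have "\<sigma> = \<rho> \<circ> (Hilbert_Choice.inv \<rho> \<circ> \<sigma>)"
      using permutes_inv_o(1)[OF \<rho>] by (simp flip: comp_assoc)
    then have "\<not> (Hilbert_Choice.inv \<rho> \<circ> \<sigma>) permutes {1..n}"
      using permutes_compose[OF _ \<rho>] \<sigma> by metis
    then show ?thesis using assms(2) by (simp add: sym_alg_def carrier_sym_group)
  qed
  then show ?thesis by (simp add: sym_alg_def carrier_sym_group)
qed

lemma to_alg_mult: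
  assumes x: "x \<in> CSym n" and y: "y \<in> CSym n"
  shows "to_alg x \<otimes>\<^bsub>sym_alg n\<^esub> to_alg y = to_alg (x * y)"
proof (rule sym_alg_eqI[of _ n])
  show "to_alg x \<otimes>\<^bsub>sym_alg n\<^esub> to_alg y \<in> carrier (sym_alg n)" "to_alg (x * y) \<in> carrier (sym_alg n)"
    using assms by (simp_all add: CSym_mult to_alg_carrier sym_alg_mult_closed)
  fix a
  have "(to_alg x \<otimes>\<^bsub>sym_alg n\<^esub> to_alg y) (app a) = (\<Sum>b\<in>Sym n. coef x b * to_alg y (app (- b) \<circ> app a))"
    using sum.reindex_bij_betw[OF bij_betw_app_Sym[of n],
        of "\<lambda>\<rho>. to_alg x \<rho> * to_alg y (Hilbert_Choice.inv \<rho> \<circ> app a)"]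
    by (simp add: sym_alg_def carrier_sym_group uminus_fperm.rep_eq)
  also have "\<dots> = (\<Sum>b\<in>Sym n. coef x b * coef y (- b + a))"
    by (simp flip: plus_fperm.rep_eq)
  also have "\<dots> = coef (x * y) a"
    using x by (simp add: coef_mult[of "Sym n"] CSym_def)
  finally show "(to_alg x \<otimes>\<^bsub>sym_alg n\<^esub> to_alg y) (app a) = to_alg (x * y) (app a)" by simp
qed

lemma to_alg_power: "x \<in> CSym n \<Longrightarrow> to_alg x [^]\<^bsub>sym_alg n\<^esub> k = to_alg (x ^ k)" for k :: nat
  by (induction k) (simp_all add: nat_pow_def to_alg_one[symmetric] to_alg_mult CSym_power power_Suc2
      del: power_Suc)

lemma jucys_murphy_eq: "jucys_murphy n = to_alg (jm n)"
proof -
  have "jucys_murphy n = finsum (sym_alg n) (\<lambda>j. of_perm (Transposition.transpose j n)) ((\<lambda>j. j) ` {1..<n})"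
    by (simp add: jucys_murphy_def)
  also have "\<dots> = to_alg (jm n)"
    unfolding jm_def by (rule finsum_to_alg) (auto simp: to_alg_delta fswap_in_Sym app_fswap)
  finally show ?thesis .
qed

lemma foldr_comp_app: "foldr (\<circ>) (map app ts) id = app (sum_list ts)"
  by (induction ts) (simp_all add: zero_fperm.rep_eq plus_fperm.rep_eq)

lemma star_transpositions_eq: "star_transpositions n = app ` (\<lambda>j. fswap j n) ` {1..<n}"
  unfolding star_transpositions_def image_image by (auto simp: app_fswap)

lemma jm_eq_sum_delta: "jm n = (\<Sum>t\<in>(\<lambda>j. fswap j n) ` {1..<n}. delta t)"
proof -
  have "inj_on (\<lambda>j. fswap j n) {1..<n}"
  proof (rule inj_onI)
    fix i j assume "i \<in> {1..<n}" "j \<in> {1..<n}" "fswap i n = fswap j n"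
    then show "i = j"
      using app_fswap[of i n] app_fswap[of j n] transpose_apply_second[of i n]
        transpose_apply_second[of j n]
      by simp
  qed
  then show ?thesis by (simp add: jm_def sum.reindex)
qed

lemma card_star_factorizations:
  "of_nat (card {\<tau>s. length \<tau>s = r \<and> set \<tau>s \<subseteq> star_transpositions n \<and> foldr (\<circ>) \<tau>s id = app a}) =
    coef (jm n ^ r) a"
proof -
  let ?T = "(\<lambda>j. fswap j n) ` {1..<n}"
  have "{\<tau>s. length \<tau>s = r \<and> set \<tau>s \<subseteq> star_transpositions n \<and> foldr (\<circ>) \<tau>s id = app a} =
      map app ` {ts. length ts = r \<and> set ts \<subseteq> ?T \<and> sum_list ts = a}"
  proof -
    have "{\<tau>s. set \<tau>s \<subseteq> app ` ?T} = map app ` {ts. set ts \<subseteq> ?T}"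
      using lists_image[of app ?T] by (simp only: lists_eq_set)
    then have "set \<tau>s \<subseteq> app ` ?T \<longleftrightarrow> (\<exists>ts. set ts \<subseteq> ?T \<and> \<tau>s = map app ts)" for \<tau>s by blast
    then show ?thesis
      unfolding star_transpositions_eq by (auto simp: foldr_comp_app app_inject)
  qed
  moreover have "inj (map app)" by (simp add: inj_def app_inject)
  then have "inj_on (map app) {ts. length ts = r \<and> set ts \<subseteq> ?T \<and> sum_list ts = a}"
    by (rule inj_on_subset) simp
  ultimately have "card {\<tau>s. length \<tau>s = r \<and> set \<tau>s \<subseteq> star_transpositions n \<and> foldr (\<circ>) \<tau>s id = app a} =
      card {ts. length ts = r \<and> set ts \<subseteq> ?T \<and> sum_list ts = a}"
    by (simp only: card_image)
  then show ?thesis unfolding jm_eq_sum_delta by (simp add: coef_power_sum_delta)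
qed

section \<open>Marked classes\<close>

lemma finite_marked_partitions: "finite (marked_partitions n)"
proof (rule finite_subset)
  have size_le: "size \<mu> \<le> \<Sum>\<^sub># \<mu>" if "0 \<notin># \<mu>" for \<mu> :: "nat multiset"
    using that by (induction \<mu>) (auto simp: Suc_le_eq)
  have part_le: "k \<le> \<Sum>\<^sub># \<mu>" if "k \<in># \<mu>" for k and \<mu> :: "nat multiset"
    using that by (auto dest: multi_member_split)
  show "marked_partitions n \<subseteq> (\<Union>k\<le>n. {\<mu>. set_mset \<mu> \<subseteq> {..n} \<and> size \<mu> = k}) \<times> {..n}"
    using size_le part_le by (auto simp: marked_partitions_def partition_of_def)
  have "finite {\<mu>. set_mset \<mu> \<subseteq> {..n} \<and> size \<mu> = k}" for k
    using finite_multisets_of_size[of "{..n}" k] by (simp add: multisets_of_size_def)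
  then show "finite ((\<Union>k\<le>n. {\<mu>. set_mset \<mu> \<subseteq> {..n} \<and> size \<mu> = k}) \<times> {..n})" by auto
qed

lemma permutation_orbit_eq_iff:
  assumes "permutation \<sigma>"
  shows "orbit \<sigma> x = orbit \<sigma> y \<longleftrightarrow> x \<in> orbit \<sigma> y"
  using assms by (metis cyclic_on_orbit' orbit_cyclic_eq3 permutation_self_in_orbit)

lemma Union_orbits:
  assumes "\<sigma> permutes S" "finite S"
  shows "\<Union> (orbit \<sigma> ` S) = S"
proof -
  have "permutation \<sigma>" using assms permutation_permutes by blast
  then show ?thesis
    using permutes_orbit_subset[OF assms(1)] permutation_self_in_orbit[of \<sigma>] by auto
qed

lemma orbit_of_member:
  "permutation \<sigma> \<Longrightarrow> A \<in> orbit \<sigma> ` S \<Longrightarrow> x \<in> A \<Longrightarrow> orbit \<sigma> x = A"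
  by (elim imageE) (simp only: permutation_orbit_eq_iff)

lemma pairwise_disjnt_orbits:
  assumes "permutation \<sigma>"
  shows "pairwise disjnt (orbit \<sigma> ` S)"
proof (rule pairwiseI)
  fix A B assume "A \<in> orbit \<sigma> ` S" "B \<in> orbit \<sigma> ` S" "A \<noteq> B"
  then show "disjnt A B" unfolding disjnt_iff using orbit_of_member[OF assms] by metis
qed

lemma cycle_type_partition:
  assumes "\<sigma> permutes {1..n}"
  shows "cycle_type n \<sigma> \<turnstile> n"
proof -
  let ?C = "orbit \<sigma> ` {1..n}"
  have perm: "permutation \<sigma>" using assms permutation_permutes by blast
  have fin: "finite (orbit \<sigma> x)" for x
    using perm by (simp add: finite_orbit permutation_self_in_orbit)
  have "sum card ?C = card (\<Union> ?C)"
    using fin by (intro card_Union_disjoint[symmetric] pairwise_disjnt_orbits perm) auto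
  then have "\<Sum>\<^sub># (cycle_type n \<sigma>) = n"
    using Union_orbits[OF assms] by (simp add: cycle_type_def sum_unfold_sum_mset)
  moreover have "0 \<notin># cycle_type n \<sigma>"
    using fin orbit_nonempty[of \<sigma>] by (auto simp: cycle_type_def)
  ultimately show ?thesis by (simp add: partition_of_def)
qed

lemma cycle_type_marked_partition:
  assumes "\<sigma> permutes {1..n}" "n \<ge> 1"
  shows "(cycle_type n \<sigma>, card (orbit \<sigma> n)) \<in> marked_partitions n"
  using cycle_type_partition[OF assms(1)] assms(2)
  by (auto simp: marked_partitions_def cycle_type_def)

lemma finite_marked_class: "finite (marked_class n \<mu> j)"
  by (rule finite_subset[of _ "carrier (sym_group n)"])
    (auto simp: marked_class_def carrier_sym_group finite_permutations)

lemma class_sum_eq: "class_sum n \<mu> j = (\<lambda>\<sigma>. if \<sigma> \<in> marked_class n \<mu> j then 1 else 0)"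
proof -
  have "class_sum n \<mu> j = (\<lambda>\<sigma>. \<Sum>\<tau>\<in>marked_class n \<mu> j. of_perm \<tau> \<sigma>)"
    unfolding class_sum_def
    by (rule finsum_sym_alg[OF finite_marked_class]) (auto simp: sym_alg_def of_perm_def marked_class_def)
  then show ?thesis by (simp add: of_perm_def finite_marked_class)
qed

lemma class_sum_combination:
  assumes "n \<ge> 1"
  shows "(\<Oplus>\<^bsub>sym_alg n\<^esub>p\<in>marked_partitions n. a p \<odot>\<^bsub>sym_alg n\<^esub> class_sum n (fst p) (snd p)) =
    (\<lambda>\<sigma>. if \<sigma> \<in> carrier (sym_group n) then a (cycle_type n \<sigma>, card (orbit \<sigma> n)) else 0)"
proof -
  have "(\<Oplus>\<^bsub>sym_alg n\<^esub>p\<in>marked_partitions n. a p \<odot>\<^bsub>sym_alg n\<^esub> class_sum n (fst p) (snd p)) =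
      (\<lambda>\<sigma>. \<Sum>p\<in>marked_partitions n. (a p \<odot>\<^bsub>sym_alg n\<^esub> class_sum n (fst p) (snd p)) \<sigma>)"
    by (rule finsum_sym_alg[OF finite_marked_partitions])
      (auto simp: sym_alg_def class_sum_eq marked_class_def)
  also have "\<dots> = (\<lambda>\<sigma>. if \<sigma> \<in> carrier (sym_group n) then a (cycle_type n \<sigma>, card (orbit \<sigma> n)) else 0)"
  proof
    fix \<sigma>
    let ?q = "(cycle_type n \<sigma>, card (orbit \<sigma> n))"
    have "(\<Sum>p\<in>marked_partitions n. (a p \<odot>\<^bsub>sym_alg n\<^esub> class_sum n (fst p) (snd p)) \<sigma>) =
        (\<Sum>p\<in>marked_partitions n. if p = ?q then if \<sigma> \<in> carrier (sym_group n) then a ?q else 0 else 0)"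
      by (rule sum.cong) (auto simp: sym_alg_def class_sum_eq marked_class_def)
    also have "\<dots> = (if \<sigma> \<in> carrier (sym_group n) then a ?q else 0)"
      using cycle_type_marked_partition[OF _ assms] finite_marked_partitions
      by (auto simp: carrier_sym_group)
    finally show "(\<Sum>p\<in>marked_partitions n. (a p \<odot>\<^bsub>sym_alg n\<^esub> class_sum n (fst p) (snd p)) \<sigma>) =
      (if \<sigma> \<in> carrier (sym_group n) then a ?q else 0)" .
  qed
  finally show ?thesis .
qed

lemma K_coeff_eq_value:
  assumes n: "n \<ge> 1" and g: "g \<in> carrier (sym_alg n)" and member: "\<pi> \<in> marked_class n lam i"
    and const: "\<And>\<mu> j \<sigma> \<tau>. \<sigma> \<in> marked_class n \<mu> j \<Longrightarrow> \<tau> \<in> marked_class n \<mu> j \<Longrightarrow> g \<sigma> = g \<tau>"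
  shows "K_coeff n lam i g = g \<pi>"
  unfolding K_coeff_def class_sum_combination[OF n]
proof (rule the_equality)
  let ?a = "\<lambda>(\<mu>, j). g (SOME \<sigma>. \<sigma> \<in> marked_class n \<mu> j)"
  have pick: "g (SOME \<tau>. \<tau> \<in> marked_class n \<mu> j) = g \<sigma>" if "\<sigma> \<in> marked_class n \<mu> j" for \<sigma> \<mu> j
    using const[OF someI[of "\<lambda>\<tau>. \<tau> \<in> marked_class n \<mu> j", OF that] that] .
  have "g = (\<lambda>\<sigma>. if \<sigma> \<in> carrier (sym_group n) then ?a (cycle_type n \<sigma>, card (orbit \<sigma> n)) else 0)"
  proof
    fix \<sigma>
    show "g \<sigma> = (if \<sigma> \<in> carrier (sym_group n) then ?a (cycle_type n \<sigma>, card (orbit \<sigma> n)) else 0)"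
      using g pick[of \<sigma> "cycle_type n \<sigma>" "card (orbit \<sigma> n)"]
      by (auto simp: sym_alg_def marked_class_def)
  qed
  moreover have "g \<pi> = ?a (lam, i)" using pick[OF member] by simp
  ultimately show "\<exists>a. g \<pi> = a (lam, i) \<and>
    g = (\<lambda>\<sigma>. if \<sigma> \<in> carrier (sym_group n) then a (cycle_type n \<sigma>, card (orbit \<sigma> n)) else 0)" by blast
next
  fix c assume "\<exists>a. c = a (lam, i) \<and>
    g = (\<lambda>\<sigma>. if \<sigma> \<in> carrier (sym_group n) then a (cycle_type n \<sigma>, card (orbit \<sigma> n)) else 0)"
  then obtain a where "c = a (lam, i)"
    "g = (\<lambda>\<sigma>. if \<sigma> \<in> carrier (sym_group n) then a (cycle_type n \<sigma>, card (orbit \<sigma> n)) else 0)" by blast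
  then show "c = g \<pi>" using member by (simp add: marked_class_def)
qed

lemma bij_betw_of_image_mset_eq:
  assumes "finite A" "finite B" "image_mset f (mset_set A) = image_mset g (mset_set B)"
  obtains h where "bij_betw h A B" "\<And>x. x \<in> A \<Longrightarrow> g (h x) = f x"
proof -
  have "card A = card B" using arg_cong[OF assms(3), of size] by simp
  then obtain k where k: "bij_betw k A B" using finite_same_card_bij[OF assms(1,2)] by blast
  then have "mset_set B = image_mset k (mset_set A)"
    by (simp add: bij_betw_def image_mset_mset_set)
  then have "image_mset f (mset_set A) = image_mset (g \<circ> k) (mset_set A)"
    using assms(3) by (simp add: multiset.map_comp)
  from image_mset_eq_implies_permutes[OF assms(1) this]
  obtain p where p: "p permutes A" "\<forall>x\<in>A. f x = (g \<circ> k) (p x)" .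
  show ?thesis
    by (rule that[of "k \<circ> p"])
      (use p bij_betw_trans[OF permutes_imp_bij[OF p(1)] k] in simp_all)
qed

lemma funpow_eq_iff_dvd:
  assumes "permutation \<sigma>" "k \<le> m"
  shows "(\<sigma> ^^ k) b = (\<sigma> ^^ m) b \<longleftrightarrow> card (orbit \<sigma> b) dvd m - k"
proof -
  have "orbit \<sigma> b = set (support \<sigma> b)"
    using support_set[OF assms(1), of b] orbit_altdef_permutation[OF assms(1), of b] by auto
  then have card: "card (orbit \<sigma> b) = least_power \<sigma> b"
    using distinct_card[OF cycle_of_permutation[OF assms(1), of b]] by simp
  have "inj (\<sigma> ^^ k)" using assms(1) by (simp add: permutation_bijective bij_is_inj inj_fn)
  moreover have "(\<sigma> ^^ m) b = (\<sigma> ^^ k) ((\<sigma> ^^ (m - k)) b)"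
    using assms(2) by (metis comp_apply funpow_add le_add_diff_inverse)
  ultimately have "(\<sigma> ^^ k) b = (\<sigma> ^^ m) b \<longleftrightarrow> (\<sigma> ^^ (m - k)) b = b"
    by (metis injD)
  then show ?thesis using least_power_dvd[OF assms(1), of b "m - k"] card by simp
qed

lemma funpow_eq_iff_of_card_orbit_eq:
  assumes "permutation \<sigma>" "permutation \<tau>" "card (orbit \<sigma> b) = card (orbit \<tau> c)"
  shows "(\<sigma> ^^ k) b = (\<sigma> ^^ m) b \<longleftrightarrow> (\<tau> ^^ k) c = (\<tau> ^^ m) c"
proof -
  have ordered: "(\<sigma> ^^ k) b = (\<sigma> ^^ m) b \<longleftrightarrow> (\<tau> ^^ k) c = (\<tau> ^^ m) c" if "k \<le> m" for k m
    using funpow_eq_iff_dvd[OF assms(1) that] funpow_eq_iff_dvd[OF assms(2) that] assms(3) by simp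
  show ?thesis using ordered[of k m] ordered[of m k] by (cases "k \<le> m") (auto simp: eq_commute)
qed

lemma orbit_conjugation:
  assumes perm: "permutation \<sigma>" "permutation \<tau>" and card: "card (orbit \<sigma> b) = card (orbit \<tau> c)"
  obtains f where "bij_betw f (orbit \<sigma> b) (orbit \<tau> c)" "f b = c"
    "\<And>x. x \<in> orbit \<sigma> b \<Longrightarrow> f (\<sigma> x) = \<tau> (f x)"
proof -
  note transfer = funpow_eq_iff_of_card_orbit_eq[OF assms]
  define f where "f x = (\<tau> ^^ (SOME k. (\<sigma> ^^ k) b = x)) c" for x
  have f: "f ((\<sigma> ^^ m) b) = (\<tau> ^^ m) c" for m
    unfolding f_def transfer[symmetric] by (rule someI[of _ m]) simp
  have orbits: "orbit \<sigma> b = range (\<lambda>k. (\<sigma> ^^ k) b)" "orbit \<tau> c = range (\<lambda>k. (\<tau> ^^ k) c)"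
    using orbit_altdef_permutation[OF perm(1)] orbit_altdef_permutation[OF perm(2)] by auto
  show ?thesis
  proof
    have "inj_on f (orbit \<sigma> b)"
      unfolding orbits by (rule inj_onI) (auto simp: f transfer)
    moreover have "f ` orbit \<sigma> b = orbit \<tau> c" unfolding orbits image_image f ..
    ultimately show "bij_betw f (orbit \<sigma> b) (orbit \<tau> c)" by (simp add: bij_betw_def)
    show "f b = c" using f[of 0] by simp
    fix x assume "x \<in> orbit \<sigma> b"
    then obtain m where x: "x = (\<sigma> ^^ m) b" unfolding orbits by blast
    show "f (\<sigma> x) = \<tau> (f x)" using f[of m] f[of "Suc m"] by (simp add: x)
  qed
qed

lemma bij_betw_glue_orbits:
  assumes perm: "\<sigma> permutes S" "\<tau> permutes S" and S: "finite S"
    and h: "bij_betw h (orbit \<sigma> ` S) (orbit \<tau> ` S)"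
    and f: "\<And>A. A \<in> orbit \<sigma> ` S \<Longrightarrow> bij_betw (f A) A (h A)"
  shows "bij_betw (\<lambda>x. f (orbit \<sigma> x) x) S S"
proof -
  have perm': "permutation \<sigma>" "permutation \<tau>" using perm S permutation_permutes by blast+
  have "bij_betw (\<lambda>x. f (orbit \<sigma> x) x) A (h A)" if A: "A \<in> orbit \<sigma> ` S" for A
    using f[OF A] by (rule bij_betw_cong[THEN iffD1, rotated]) (simp add: orbit_of_member[OF perm'(1) A])
  moreover have "disjoint_family_on h (orbit \<sigma> ` S)"
    using h pairwise_disjnt_orbits[OF perm'(2), of S]
    unfolding disjoint_family_on_def bij_betw_def pairwise_def disjnt_def by (metis imageI inj_onD)
  ultimately have "bij_betw (\<lambda>x. f (orbit \<sigma> x) x) (\<Union> A\<in>orbit \<sigma> ` S. A) (\<Union> A\<in>orbit \<sigma> ` S. h A)"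
    by (intro bij_betw_UNION_disjoint)
  moreover have "h ` orbit \<sigma> ` S = orbit \<tau> ` S" using h by (simp add: bij_betw_def)
  ultimately show ?thesis
    using Union_orbits[OF perm(1) S] Union_orbits[OF perm(2) S] by (metis image_ident)
qed

lemma conjugation_from_orbit_bij:
  assumes perm: "\<sigma> permutes S" "\<tau> permutes S" and S: "finite S" "b \<in> S"
    and h: "bij_betw h (orbit \<sigma> ` S) (orbit \<tau> ` S)" "\<And>A. A \<in> orbit \<sigma> ` S \<Longrightarrow> card (h A) = card A"
    and base: "h (orbit \<sigma> b) = orbit \<tau> c"
  obtains \<rho> where "\<rho> permutes S" "\<rho> b = c" "\<rho> \<circ> \<sigma> = \<tau> \<circ> \<rho>"
proof -
  have perm': "permutation \<sigma>" "permutation \<tau>" using perm S(1) permutation_permutes by blast+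
  have "\<exists>f. bij_betw f A (h A) \<and> (\<forall>x\<in>A. f (\<sigma> x) = \<tau> (f x)) \<and> (A = orbit \<sigma> b \<longrightarrow> f b = c)"
    if A: "A \<in> orbit \<sigma> ` S" for A
  proof -
    obtain x y where xy: "A = orbit \<sigma> x" "h A = orbit \<tau> y" "A = orbit \<sigma> b \<longrightarrow> x = b \<and> y = c"
      using A bij_betw_apply[OF h(1) A] base by (cases "A = orbit \<sigma> b") auto
    have "card (orbit \<sigma> x) = card (orbit \<tau> y)" using h(2)[OF A] xy by simp
    from orbit_conjugation[OF perm' this] show ?thesis unfolding xy(1,2) using xy by metis
  qed
  then obtain f where f: "\<And>A. A \<in> orbit \<sigma> ` S \<Longrightarrow> bij_betw (f A) A (h A)"
    "\<And>A x. A \<in> orbit \<sigma> ` S \<Longrightarrow> x \<in> A \<Longrightarrow> f A (\<sigma> x) = \<tau> (f A x)" "f (orbit \<sigma> b) b = c"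
    using S(2) by (metis imageI)
  define \<rho> where "\<rho> x = (if x \<in> S then f (orbit \<sigma> x) x else x)" for x
  have "bij_betw \<rho> S S \<longleftrightarrow> bij_betw (\<lambda>x. f (orbit \<sigma> x) x) S S"
    by (rule bij_betw_cong) (simp add: \<rho>_def)
  then have "bij_betw \<rho> S S" using bij_betw_glue_orbits[OF perm S(1) h(1) f(1)] by simp
  then have "\<rho> permutes S" by (rule bij_imp_permutes) (simp add: \<rho>_def)
  moreover have "\<rho> b = c" using S(2) f(3) by (simp add: \<rho>_def)
  moreover have "\<rho> (\<sigma> x) = \<tau> (\<rho> x)" for x
  proof (cases "x \<in> S")
    case True
    then have "f (orbit \<sigma> x) (\<sigma> x) = \<tau> (f (orbit \<sigma> x) x)"
      by (intro f(2)) (simp_all add: permutation_self_in_orbit[OF perm'(1)])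
    then show ?thesis
      using True permutes_in_image[OF perm(1)] permutation_orbit_step[OF perm'(1)] by (simp add: \<rho>_def)
  qed (use perm in \<open>simp add: \<rho>_def permutes_in_image permutes_not_in\<close>)
  then have "\<rho> \<circ> \<sigma> = \<tau> \<circ> \<rho>" by auto
  ultimately show ?thesis by (rule that)
qed

lemma marked_class_orbit_bij:
  assumes n: "n \<ge> 1" and \<sigma>: "\<sigma> \<in> marked_class n \<mu> j" and \<tau>: "\<tau> \<in> marked_class n \<mu> j"
  obtains h where "bij_betw h (orbit \<sigma> ` {1..n}) (orbit \<tau> ` {1..n})"
    "\<And>A. A \<in> orbit \<sigma> ` {1..n} \<Longrightarrow> card (h A) = card A"
    "h (orbit \<sigma> n) = orbit \<tau> n"
proof -
  define A where "A = orbit \<sigma> ` {1..n} - {orbit \<sigma> n}"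
  define B where "B = orbit \<tau> ` {1..n} - {orbit \<tau> n}"
  have A: "orbit \<sigma> ` {1..n} = insert (orbit \<sigma> n) A" "orbit \<sigma> n \<notin> A" "finite A"
    using n by (auto simp: A_def)
  have B: "orbit \<tau> ` {1..n} = insert (orbit \<tau> n) B" "orbit \<tau> n \<notin> B" "finite B"
    using n by (auto simp: B_def)
  have card_n: "card (orbit \<sigma> n) = card (orbit \<tau> n)"
    and type: "cycle_type n \<sigma> = cycle_type n \<tau>"
    using \<sigma> \<tau> by (auto simp: marked_class_def)
  have "image_mset card (mset_set A) = image_mset card (mset_set B)"
    using type card_n A(2,3) B(2,3) unfolding cycle_type_def A(1) B(1) by simp
  from bij_betw_of_image_mset_eq[OF A(3) B(3) this] obtain h where
    h: "bij_betw h A B" "\<And>x. x \<in> A \<Longrightarrow> card (h x) = card x" by blast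
  let ?h = "h(orbit \<sigma> n := orbit \<tau> n)"
  have "bij_betw ?h A B" using h(1) A(2) by (subst bij_betw_cong[of A ?h h]) auto
  then have "bij_betw ?h (A \<union> {orbit \<sigma> n}) (B \<union> {?h (orbit \<sigma> n)})"
    using A B by (intro notIn_Un_bij_betw) auto
  then have "bij_betw ?h (orbit \<sigma> ` {1..n}) (orbit \<tau> ` {1..n})"
    unfolding A(1) B(1) by simp
  moreover have "card (?h X) = card X" if "X \<in> orbit \<sigma> ` {1..n}" for X
    using that h(2) card_n unfolding A(1) by auto
  ultimately show ?thesis using that[of ?h] by simp
qed

lemma marked_class_conjugate:
  assumes n: "n \<ge> 1" and \<sigma>: "\<sigma> \<in> marked_class n \<mu> j" and \<tau>: "\<tau> \<in> marked_class n \<mu> j"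
  obtains \<rho> where "\<rho> permutes {1..n}" "\<rho> n = n" "\<rho> \<circ> \<sigma> = \<tau> \<circ> \<rho>"
proof -
  have perm: "\<sigma> permutes {1..n}" "\<tau> permutes {1..n}"
    using \<sigma> \<tau> by (auto simp: marked_class_def carrier_sym_group)
  from marked_class_orbit_bij[OF assms] obtain h where
    h: "bij_betw h (orbit \<sigma> ` {1..n}) (orbit \<tau> ` {1..n})"
    "\<And>A. A \<in> orbit \<sigma> ` {1..n} \<Longrightarrow> card (h A) = card A"
    "h (orbit \<sigma> n) = orbit \<tau> n" by blast
  show ?thesis
    by (rule conjugation_from_orbit_bij[OF perm _ _ h]) (use n that in auto)
qed

lemma to_alg_const_on_marked_class:
  assumes "x \<in> CSym (Suc n)" and commute: "\<And>y. y \<in> CSym n \<Longrightarrow> x * y = y * x"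
    and "\<sigma> \<in> marked_class (Suc n) \<mu> j" "\<tau> \<in> marked_class (Suc n) \<mu> j"
  shows "to_alg x \<sigma> = to_alg x \<tau>"
proof -
  from marked_class_conjugate[OF _ assms(3,4)] obtain \<rho> where
    \<rho>: "\<rho> permutes {1..Suc n}" "\<rho> (Suc n) = Suc n" "\<rho> \<circ> \<sigma> = \<tau> \<circ> \<rho>" by auto
  obtain a b where ab: "\<sigma> = app a" "\<tau> = app b"
    using assms(3,4) by (auto simp: marked_class_def carrier_sym_group_app)
  define p where "p = Fperm \<rho>"
  have p: "app p = \<rho>" "p \<in> Sym (Suc n)" using \<rho>(1) by (simp_all add: p_def app_Fperm Fperm_in_Sym)
  then have "p \<in> Sym n" using Sym_Suc_fixing[of p n] \<rho>(2) by simp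
  then have "x * delta p = delta p * x" by (intro commute) simp
  moreover have "p + a = b + p"
    by (rule fperm_eqI) (use fun_cong[OF \<rho>(3)] in \<open>simp add: p ab\<close>)
  ultimately have "coef (x * delta p) (b + p) = coef (delta p * x) (p + a)"
    by simp
  then have "coef x b = coef x a"
    unfolding coef_mult_delta coef_delta_mult by (simp flip: add.assoc)
  then show ?thesis by (simp add: ab)
qed

lemma K_coeff_to_alg:
  assumes "x \<in> CSym (Suc n)" "\<And>y. y \<in> CSym n \<Longrightarrow> x * y = y * x" "\<pi> \<in> marked_class (Suc n) lam i"
  shows "K_coeff (Suc n) lam i (to_alg x) = to_alg x \<pi>"
proof (rule K_coeff_eq_value)
  show "to_alg x \<sigma> = to_alg x \<tau>"
    if "\<sigma> \<in> marked_class (Suc n) \<mu> j" "\<tau> \<in> marked_class (Suc n) \<mu> j" for \<mu> j \<sigma> \<tau>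
    by (rule to_alg_const_on_marked_class[OF assms(1,2) that])
qed (use assms in \<open>auto simp: to_alg_carrier\<close>)

section \<open>Standard tableaux from Yamanouchi words\<close>

definition add_entry :: "nat \<Rightarrow> nat \<Rightarrow> tableau \<Rightarrow> tableau" where
  "add_entry r m T = (if r < length T then T[r := T ! r @ [m]] else T @ [[m]])"

definition row_length :: "tableau \<Rightarrow> nat \<Rightarrow> nat" where
  "row_length T i = (if i < length T then length (T ! i) else 0)"

primrec tableau_of :: "nat list \<Rightarrow> tableau" where
  "tableau_of [] = []"
| "tableau_of (r # w) = add_entry r (Suc (length w)) (tableau_of w)"

lemma row_length_pos_iff: "[] \<notin> set T \<Longrightarrow> 0 < row_length T i \<longleftrightarrow> i < length T"
  by (auto simp: row_length_def in_set_conv_nth)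

lemma less_row_lengthD:
  assumes "c < row_length T i"
  shows "i < length T" "c < length (T ! i)" "T ! i ! c \<in> set (concat T)"
proof -
  show i: "i < length T" and c: "c < length (T ! i)"
    using assms by (auto simp: row_length_def split: if_splits)
  show "T ! i ! c \<in> set (concat T)" using nth_mem[OF i] nth_mem[OF c] by auto
qed

lemma row_length_add_entry:
  "r \<le> length T \<Longrightarrow> row_length (add_entry r m T) i = row_length T i + (if i = r then 1 else 0)"
  by (auto simp: row_length_def add_entry_def nth_append)

lemma nth_add_entry:
  assumes "r \<le> length T" "c < row_length (add_entry r m T) i"
  shows "add_entry r m T ! i ! c = (if i = r \<and> c = row_length T r then m else T ! i ! c)"
  using assms
  by (cases "r < length T")
    (auto simp: add_entry_def row_length_def nth_append nth_list_update split: if_splits)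

lemma add_entry_nonempty: "[] \<notin> set T \<Longrightarrow> [] \<notin> set (add_entry r m T)"
  by (auto simp: add_entry_def dest: set_update_subset_insert[THEN subsetD])

lemma mset_concat_add_entry:
  "mset (concat (add_entry r m T)) = add_mset m (mset (concat T))"
proof (cases "r < length T")
  case True
  have "mset (concat (add_entry r m T)) = mset (concat (take r T @ (T ! r @ [m]) # drop (Suc r) T))"
    using True by (simp add: add_entry_def upd_conv_take_nth_drop)
  also have "\<dots> = add_mset m (mset (concat (take r T @ T ! r # drop (Suc r) T)))" by simp
  also have "take r T @ T ! r # drop (Suc r) T = T" by (rule id_take_nth_drop[OF True, symmetric])
  finally show ?thesis .
qed (simp add: add_entry_def)

lemma addable_le_length:
  assumes "[] \<notin> set T" "addable (row_length T) r"
  shows "r \<le> length T"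
proof (cases "r = 0")
  case False
  then have "0 < row_length T (r - 1)" using assms(2) by (simp add: addable_def)
  then show ?thesis using row_length_pos_iff[OF assms(1)] by fastforce
qed simp

lemma tableau_of_shape:
  assumes "yamanouchi w"
  shows "[] \<notin> set (tableau_of w)" "row_length (tableau_of w) = shape w"
proof -
  have "[] \<notin> set (tableau_of w) \<and> row_length (tableau_of w) = shape w" using assms
  proof (induction w)
    case Nil
    then show ?case by (simp add: row_length_def fun_eq_iff)
  next
    case (Cons r w)
    then have IH: "[] \<notin> set (tableau_of w)" "row_length (tableau_of w) = shape w"
      "addable (row_length (tableau_of w)) r"
      by auto
    then show ?case
      using addable_le_length[OF IH(1,3)]
      by (auto simp: row_length_add_entry add_entry_nonempty fun_eq_iff)
  qed
  then show "[] \<notin> set (tableau_of w)" "row_length (tableau_of w) = shape w" by auto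
qed

lemma tableau_of_addable_le: "yamanouchi (r # w) \<Longrightarrow> r \<le> length (tableau_of w)"
  using addable_le_length[of "tableau_of w" r] tableau_of_shape[of w] by simp

lemma tableau_of_cell_in_row:
  "yamanouchi w \<Longrightarrow> x \<in> {1..length w} \<Longrightarrow> col_of w x < row_length (tableau_of w) (row_of w x)"
  using filling_cell[OF yamanouchi_filling] tableau_of_shape(2) by simp

lemma tableau_of_nth:
  "yamanouchi w \<Longrightarrow> x \<in> {1..length w} \<Longrightarrow> tableau_of w ! row_of w x ! col_of w x = x"
proof (induction w)
  case (Cons r w)
  have yam: "yamanouchi w" and r: "r \<le> length (tableau_of w)"
    using Cons.prems(1) tableau_of_addable_le[of r w] by auto
  note shape = tableau_of_shape(2)[OF yam]
  note cell = tableau_of_cell_in_row[OF Cons.prems, unfolded tableau_of.simps]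
  show ?case
  proof (cases "x = Suc (length w)")
    case True
    then show ?thesis using nth_add_entry[OF r cell] by (simp add: shape)
  next
    case False
    then have x: "x \<in> {1..length w}" using Cons.prems(2) by auto
    have "col_of w x < row_length (tableau_of w) (row_of w x)" by (rule tableau_of_cell_in_row[OF yam x])
    then show ?thesis using nth_add_entry[OF r cell] Cons.IH[OF yam x] False by auto
  qed
qed simp

lemma tableau_of_entry_cell:
  assumes "yamanouchi w" "c < row_length (tableau_of w) i"
  shows "tableau_of w ! i ! c \<in> {1..length w}"
    "row_of w (tableau_of w ! i ! c) = i" "col_of w (tableau_of w ! i ! c) = c"
proof -
  have "(i, c) \<in> (\<lambda>x. (row_of w x, col_of w x)) ` {1..length w}"
    using assms tableau_of_shape(2)[OF assms(1)] bij_betw_cells[of w] unfolding bij_betw_def by simp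
  then obtain x where x: "x \<in> {1..length w}" "row_of w x = i" "col_of w x = c" by auto
  then have "tableau_of w ! i ! c = x" using tableau_of_nth[OF assms(1) x(1)] by simp
  then show "tableau_of w ! i ! c \<in> {1..length w}"
    "row_of w (tableau_of w ! i ! c) = i" "col_of w (tableau_of w ! i ! c) = c"
    using x by auto
qed

lemma set_tableau_of_row:
  assumes w: "yamanouchi w" and i: "i < length (tableau_of w)"
  shows "set (tableau_of w ! i) = {x \<in> {1..length w}. row_of w x = i}"
proof
  show "set (tableau_of w ! i) \<subseteq> {x \<in> {1..length w}. row_of w x = i}"
    using tableau_of_entry_cell[OF w, of _ i] i by (fastforce simp: in_set_conv_nth row_length_def)
  show "{x \<in> {1..length w}. row_of w x = i} \<subseteq> set (tableau_of w ! i)"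
  proof
    fix x assume "x \<in> {x \<in> {1..length w}. row_of w x = i}"
    then have x: "x \<in> {1..length w}" "row_of w x = i" by auto
    show "x \<in> set (tableau_of w ! i)"
      using nth_mem[OF less_row_lengthD(2)[OF tableau_of_cell_in_row[OF w x(1)]]]
      unfolding tableau_of_nth[OF w x(1)] unfolding x(2) .
  qed
qed

lemma tableau_column_tableau_of:
  assumes w: "yamanouchi w"
  shows "tableau_column (tableau_of w) c = {x \<in> {1..length w}. col_of w x = c}"
proof
  show "tableau_column (tableau_of w) c \<subseteq> {x \<in> {1..length w}. col_of w x = c}"
    using tableau_of_entry_cell[OF w] by (fastforce simp: tableau_column_def row_length_def)
  show "{x \<in> {1..length w}. col_of w x = c} \<subseteq> tableau_column (tableau_of w) c"
  proof
    fix x assume "x \<in> {x \<in> {1..length w}. col_of w x = c}"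
    then have x: "x \<in> {1..length w}" "col_of w x = c" by auto
    show "x \<in> tableau_column (tableau_of w) c"
      unfolding tableau_column_def
      using tableau_of_nth[OF w x(1)] less_row_lengthD(1,2)[OF tableau_of_cell_in_row[OF w x(1)]] x(2)
      by (auto intro!: exI[of _ "row_of w x"])
  qed
qed

lemma level_sets_preserved_iff:
  assumes \<sigma>: "\<sigma> permutes S" and S: "finite S"
  shows "(\<forall>i. \<sigma> ` {x \<in> S. f x = i} = {x \<in> S. f x = i}) \<longleftrightarrow> (\<forall>x\<in>S. f (\<sigma> x) = f x)"
proof
  assume preserved: "\<forall>i. \<sigma> ` {x \<in> S. f x = i} = {x \<in> S. f x = i}"
  show "\<forall>x\<in>S. f (\<sigma> x) = f x"
  proof
    fix x assume "x \<in> S"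
    then have "\<sigma> x \<in> \<sigma> ` {y \<in> S. f y = f x}" by auto
    then show "f (\<sigma> x) = f x" using preserved by auto
  qed
next
  assume invariant: "\<forall>x\<in>S. f (\<sigma> x) = f x"
  show "\<forall>i. \<sigma> ` {x \<in> S. f x = i} = {x \<in> S. f x = i}"
  proof
    fix i
    show "\<sigma> ` {x \<in> S. f x = i} = {x \<in> S. f x = i}"
    proof (rule endo_inj_surj)
      show "\<sigma> ` {x \<in> S. f x = i} \<subseteq> {x \<in> S. f x = i}"
        using invariant permutes_in_image[OF \<sigma>] by blast
      show "inj_on \<sigma> {x \<in> S. f x = i}" using permutes_inj_on[OF \<sigma>] .
      show "finite {x \<in> S. f x = i}" using S by simp
    qed
  qed
qed

lemma app_label_stab_eq:
  "{\<sigma> \<in> carrier (sym_group n). \<forall>i. \<sigma> ` {x \<in> {1..n}. f x = i} = {x \<in> {1..n}. f x = i}} =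
      app ` label_stab n f"
proof -
  have "{\<sigma> \<in> carrier (sym_group n). \<forall>i. \<sigma> ` {x \<in> {1..n}. f x = i} = {x \<in> {1..n}. f x = i}} =
      {\<sigma> \<in> carrier (sym_group n). \<forall>x\<in>{1..n}. f (\<sigma> x) = f x}"
    by (rule Collect_cong, rule conj_cong[OF refl], rule level_sets_preserved_iff)
      (simp_all add: carrier_sym_group)
  also have "\<dots> = app ` label_stab n f" unfolding carrier_sym_group_app label_stab_def by blast
  finally show ?thesis .
qed

lemma row_stabilizer_tableau_of:
  assumes w: "yamanouchi w"
  shows "row_stabilizer (length w) (tableau_of w) = app ` label_stab (length w) (row_of w)"
proof -
  let ?T = "tableau_of w" and ?R = "\<lambda>i. {x \<in> {1..length w}. row_of w x = i}"
  have "(\<forall>row\<in>set ?T. \<sigma> ` set row = set row) \<longleftrightarrow> (\<forall>i. \<sigma> ` ?R i = ?R i)" for \<sigma> :: "nat \<Rightarrow> nat"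
  proof -
    have "(\<forall>row\<in>set ?T. \<sigma> ` set row = set row) \<longleftrightarrow> (\<forall>i<length ?T. \<sigma> ` set (?T ! i) = set (?T ! i))"
      by (simp add: all_set_conv_all_nth)
    also have "\<dots> \<longleftrightarrow> (\<forall>i<length ?T. \<sigma> ` ?R i = ?R i)"
      using set_tableau_of_row[OF w] by simp
    also have "\<dots> \<longleftrightarrow> (\<forall>i. \<sigma> ` ?R i = ?R i)"
    proof -
      have "\<sigma> ` ?R i = ?R i" if "\<not> i < length ?T" for i
      proof -
        have none: "?R i = {}" using less_row_lengthD(1)[OF tableau_of_cell_in_row[OF w]] that by blast
        show ?thesis unfolding none by (rule image_empty)
      qed
      then show ?thesis by blast
    qed
    finally show ?thesis .
  qed
  then show ?thesis unfolding row_stabilizer_def app_label_stab_eq[symmetric] by (simp only:)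
qed

lemma column_stabilizer_tableau_of:
  assumes "yamanouchi w"
  shows "column_stabilizer (length w) (tableau_of w) = app ` label_stab (length w) (col_of w)"
  unfolding column_stabilizer_def tableau_column_tableau_of[OF assms] by (rule app_label_stab_eq)

lemma inj_on_app: "inj_on app A"
  by (simp add: inj_on_def app_inject)

lemma row_symmetrizer_tableau_of:
  "yamanouchi w \<Longrightarrow> row_symmetrizer (length w) (tableau_of w) = to_alg (symmetrizer (length w) (row_of w))"
  unfolding row_symmetrizer_def row_stabilizer_tableau_of symmetrizer_def char_sum_def
  by (rule finsum_to_alg[OF inj_on_app])
    (auto simp: to_alg_delta dest: label_stab_subset[THEN subsetD])

lemma column_antisymmetrizer_tableau_of:
  "yamanouchi w \<Longrightarrow>
    column_antisymmetrizer (length w) (tableau_of w) = to_alg (antisymmetrizer (length w) (col_of w))"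
  unfolding column_antisymmetrizer_def column_stabilizer_tableau_of antisymmetrizer_def char_sum_def
  by (rule finsum_to_alg[OF inj_on_app])
    (auto simp: to_alg_smult to_alg_delta[symmetric] fsign_def intro!: CSym_scale
        dest: label_stab_subset[THEN subsetD])

lemma standard_tableau_iff_cells:
  "standard_tableau n T \<longleftrightarrow> [] \<notin> set T \<and> (\<forall>i j. i \<le> j \<longrightarrow> row_length T j \<le> row_length T i) \<and>
    distinct (concat T) \<and> set (concat T) = {1..n} \<and>
    (\<forall>i c c'. c < c' \<longrightarrow> c' < row_length T i \<longrightarrow> T ! i ! c < T ! i ! c') \<and>
    (\<forall>i c. c < row_length T (Suc i) \<longrightarrow> T ! i ! c < T ! Suc i ! c)"
proof -
  have lengths: "sorted_wrt (\<ge>) (map length T) \<longleftrightarrow> (\<forall>i j. i \<le> j \<longrightarrow> row_length T j \<le> row_length T i)"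
  proof
    assume "sorted_wrt (\<ge>) (map length T)"
    then show "\<forall>i j. i \<le> j \<longrightarrow> row_length T j \<le> row_length T i"
      by (auto simp: sorted_wrt_iff_nth_less row_length_def le_less)
  next
    assume decreasing: "\<forall>i j. i \<le> j \<longrightarrow> row_length T j \<le> row_length T i"
    show "sorted_wrt (\<ge>) (map length T)"
      unfolding sorted_wrt_iff_nth_less
    proof (intro allI impI)
      fix i j assume "i < j" "j < length (map length T)"
      then show "map length T ! i \<ge> map length T ! j"
        using decreasing[rule_format, of i j] by (simp add: row_length_def)
    qed
  qed
  have rows: "(\<forall>row\<in>set T. sorted_wrt (<) row) \<longleftrightarrow>
      (\<forall>i c c'. c < c' \<longrightarrow> c' < row_length T i \<longrightarrow> T ! i ! c < T ! i ! c')"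
    by (auto simp: all_set_conv_all_nth sorted_wrt_iff_nth_less row_length_def)
  have columns: "(\<forall>r c. Suc r < length T \<longrightarrow> c < length (T ! Suc r) \<longrightarrow> T ! r ! c < T ! Suc r ! c) \<longleftrightarrow>
      (\<forall>i c. c < row_length T (Suc i) \<longrightarrow> T ! i ! c < T ! Suc i ! c)"
    by (auto simp: row_length_def)
  show ?thesis unfolding standard_tableau_def lengths rows columns ..
qed

lemma standard_tableau_entry:
  assumes "standard_tableau n T" "c < row_length T i"
  shows "T ! i ! c \<in> {1..n}"
  using less_row_lengthD(3)[OF assms(2)] assms(1) by (simp add: standard_tableau_def del: set_concat)

lemma standard_tableau_add_entry:
  assumes T: "standard_tableau n T" and add: "addable (row_length T) r"
  shows "standard_tableau (Suc n) (add_entry r (Suc n) T)"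
proof -
  let ?T = "add_entry r (Suc n) T"
  have cells: "[] \<notin> set T" "\<And>i j. i \<le> j \<Longrightarrow> row_length T j \<le> row_length T i"
    "distinct (concat T)" "set (concat T) = {1..n}"
    "\<And>i c c'. c < c' \<Longrightarrow> c' < row_length T i \<Longrightarrow> T ! i ! c < T ! i ! c'"
    "\<And>i c. c < row_length T (Suc i) \<Longrightarrow> T ! i ! c < T ! Suc i ! c"
    using T unfolding standard_tableau_iff_cells by blast+
  have r: "r \<le> length T" by (rule addable_le_length[OF cells(1) add])
  note len = row_length_add_entry[OF r]
  note entry = standard_tableau_entry[OF T]
  have longer: "row_length T r < row_length T i" if "i < r" for i
    using addable_less_iff[OF cells(2) add] that by blast
  have mset_concat: "mset (concat ?T) = mset (Suc n # concat T)" by (simp add: mset_concat_add_entry)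
  show ?thesis
    unfolding standard_tableau_iff_cells
  proof (intro conjI allI impI)
    show "[] \<notin> set ?T" by (rule add_entry_nonempty[OF cells(1)])
    show "distinct (concat ?T)"
      using mset_eq_imp_distinct_iff[OF mset_concat] cells(3,4) by (simp del: set_concat)
    show "set (concat ?T) = {1..Suc n}"
      using mset_eq_setD[OF mset_concat] cells(4) by (auto simp del: set_concat)
    show "row_length ?T j \<le> row_length ?T i" if "i \<le> j" for i j
      using cells(2)[OF that] longer[of i] that by (auto simp: len le_less)
    show "?T ! i ! c < ?T ! i ! c'" if "c < c'" "c' < row_length ?T i" for i c c'
      using that nth_add_entry[OF r that(2)] nth_add_entry[OF r less_trans[OF that]]
        cells(5)[OF that(1), of i] entry[of c i] by (auto simp: len split: if_splits)
    show "?T ! i ! c < ?T ! Suc i ! c" if c: "c < row_length ?T (Suc i)" for i c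
    proof -
      have old: "c < row_length T i"
        using c cells(2)[of i "Suc i"] longer[of i] by (auto simp: len split: if_splits)
      then have "?T ! i ! c = T ! i ! c" using nth_add_entry[OF r, of c "Suc n" i] by (auto simp: len)
      then show ?thesis
        using nth_add_entry[OF r c] c entry[OF old] cells(6)[of c i] by (auto simp: len split: if_splits)
    qed
  qed
qed

lemma standard_tableau_add_entry_entries:
  assumes T: "standard_tableau (Suc n) (add_entry r (Suc n) T)"
  shows "distinct (concat T)" "set (concat T) = {1..n}"
proof -
  have mset_concat: "mset (concat (add_entry r (Suc n) T)) = mset (Suc n # concat T)"
    by (simp add: mset_concat_add_entry)
  have distinct: "distinct (Suc n # concat T)"
    using mset_eq_imp_distinct_iff[OF mset_concat] T unfolding standard_tableau_def by blast
  then show "distinct (concat T)" by simp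
  have "insert (Suc n) (set (concat T)) = {1..Suc n}"
    using mset_eq_setD[OF mset_concat] T unfolding standard_tableau_def by (simp only: list.set)
  moreover have "Suc n \<notin> set (concat T)" using distinct by (simp only: distinct.simps) simp
  ultimately have "set (concat T) = {1..Suc n} - {Suc n}" by (metis Diff_insert_absorb)
  also have "\<dots> = {1..n}" by auto
  finally show "set (concat T) = {1..n}" .
qed

lemma standard_tableau_add_entryD:
  assumes T: "standard_tableau (Suc n) (add_entry r (Suc n) T)" and nonempty: "[] \<notin> set T" and r: "r \<le> length T"
  shows "standard_tableau n T" "addable (row_length T) r"
proof -
  let ?T = "add_entry r (Suc n) T"
  have cells: "\<And>i j. i \<le> j \<Longrightarrow> row_length ?T j \<le> row_length ?T i"
    "\<And>i c c'. c < c' \<Longrightarrow> c' < row_length ?T i \<Longrightarrow> ?T ! i ! c < ?T ! i ! c'"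
    "\<And>i c. c < row_length ?T (Suc i) \<Longrightarrow> ?T ! i ! c < ?T ! Suc i ! c"
    using T unfolding standard_tableau_iff_cells by blast+
  note len = row_length_add_entry[OF r]
  have old: "c < row_length ?T i" "?T ! i ! c = T ! i ! c" if "c < row_length T i" for i c
    using that nth_add_entry[OF r, of c "Suc n" i] by (auto simp: len)
  note entries = standard_tableau_add_entry_entries[OF T]
  have below: "row_length T (Suc r) \<le> row_length T r"
  proof (rule ccontr)
    assume "\<not> row_length T (Suc r) \<le> row_length T r"
    then have c: "row_length T r < row_length T (Suc r)" by simp
    have "?T ! r ! row_length T r = Suc n"
      using nth_add_entry[OF r, of "row_length T r" "Suc n" r] by (simp add: len)
    then have "Suc n < T ! Suc r ! row_length T r" using cells(3)[OF old(1)[OF c]] old(2)[OF c] by simp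
    then show False using less_row_lengthD(3)[OF c] unfolding entries by simp
  qed
  show "standard_tableau n T"
    unfolding standard_tableau_iff_cells
  proof (intro conjI allI impI)
    show "[] \<notin> set T" "distinct (concat T)" "set (concat T) = {1..n}" by (rule nonempty entries)+
    show "row_length T j \<le> row_length T i" if "i \<le> j" for i j
      using cells(1)[OF that] cells(1)[of "Suc r" j] below that by (auto simp: len split: if_splits)
    show "T ! i ! c < T ! i ! c'" if "c < c'" "c' < row_length T i" for i c c'
      using cells(2)[OF that(1) old(1)[OF that(2)]] old(2)[OF that(2)] old(2)[OF less_trans[OF that]]
      by simp
    show "T ! i ! c < T ! Suc i ! c" if c: "c < row_length T (Suc i)" for i c
    proof -
      have "c < row_length T i"
        using c cells(1)[of i "Suc i"] below by (cases "i = r") (auto simp: len split: if_splits)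
      then show ?thesis using cells(3)[OF old(1)[OF c]] old(2)[OF c] old(2)[of c i] by simp
    qed
  qed
  show "addable (row_length T) r"
    using cells(1)[of "r - 1" r] by (auto simp: addable_def len split: if_splits)
qed

lemma standard_tableau_last_cell:
  assumes T: "standard_tableau (Suc n) T"
  obtains r row where "r < length T" "T ! r = row @ [Suc n]"
proof -
  have "Suc n \<in> set (concat T)" using T by (simp add: standard_tableau_def)
  then obtain t where "t \<in> set T" "Suc n \<in> set t" by auto
  then obtain r where r: "r < length T" "Suc n \<in> set (T ! r)" by (metis in_set_conv_nth)
  then obtain c where c: "c < length (T ! r)" "T ! r ! c = Suc n" by (auto simp: in_set_conv_nth)
  have "\<not> Suc c < length (T ! r)"
  proof
    assume "Suc c < length (T ! r)"
    then have next_cell: "Suc c < row_length T r" using r(1) by (simp add: row_length_def)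
    then have "T ! r ! c < T ! r ! Suc c" using T unfolding standard_tableau_iff_cells by blast
    then show False using standard_tableau_entry[OF T next_cell] c(2) by simp
  qed
  then have "T ! r = butlast (T ! r) @ [Suc n]"
    using c by (metis Suc_lessI append_butlast_last_id diff_Suc_1 last_conv_nth length_0_conv not_less_zero)
  with r(1) show ?thesis by (rule that)
qed

lemma standard_tableau_remove_last:
  assumes T: "standard_tableau (Suc n) T"
  obtains r T' where "standard_tableau n T'" "addable (row_length T') r" "T = add_entry r (Suc n) T'"
proof -
  have nonempty: "[] \<notin> set T" using T by (simp add: standard_tableau_def)
  obtain r row where r: "r < length T" "T ! r = row @ [Suc n]" using standard_tableau_last_cell[OF T] .
  obtain T' where T': "[] \<notin> set T'" "r \<le> length T'" "T = add_entry r (Suc n) T'"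
  proof (cases "row = []")
    case True
    have "\<not> Suc r < length T"
    proof
      assume "Suc r < length T"
      then have "0 < row_length T (Suc r)" using row_length_pos_iff[OF nonempty] by simp
      moreover from this have "T ! r ! 0 < T ! Suc r ! 0"
        using T unfolding standard_tableau_iff_cells by blast
      ultimately show False using standard_tableau_entry[OF T, of 0 "Suc r"] r(2) True by simp
    qed
    then have len: "length T = Suc r" using r(1) by simp
    then have "T = butlast T @ [T ! r]"
      by (metis append_butlast_last_id diff_Suc_1 last_conv_nth list.size(3) nat.distinct(1))
    then have "T = add_entry r (Suc n) (butlast T)" using True r(2) len by (simp add: add_entry_def)
    moreover have "[] \<notin> set (butlast T)" using nonempty in_set_butlastD by metis
    ultimately show thesis using that[of "butlast T"] len by simp
  next
    case False
    have "[] \<notin> set (T[r := row])" using nonempty False by (auto dest: set_update_subset_insert[THEN subsetD])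
    moreover have "T = add_entry r (Suc n) (T[r := row])"
      using r by (simp add: add_entry_def) (metis list_update_id)
    ultimately show thesis using that[of "T[r := row]"] r(1) by simp
  qed
  show ?thesis
    using standard_tableau_add_entryD[of n r T'] T T' by (intro that[of T' r]) simp_all
qed

lemma standard_tableau_of: "yamanouchi w \<Longrightarrow> standard_tableau (length w) (tableau_of w)"
proof (induction w)
  case Nil
  then show ?case by (simp add: standard_tableau_def)
next
  case (Cons r w)
  then show ?case
    using standard_tableau_add_entry[of "length w" "tableau_of w" r] tableau_of_shape(2)[of w] by simp
qed

lemma remove_add_entry:
  assumes "m \<notin> set (concat T)" "[] \<notin> set T"
  shows "remove_entry m (add_entry r m T) = T"
proof -
  have unchanged: "map (removeAll m) T = T" "filter (\<lambda>row. row \<noteq> []) T = T"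
    using assms by (auto intro!: map_idI removeAll_id simp: filter_id_conv)
  show ?thesis
  proof (cases "r < length T")
    case True
    then have "m \<notin> set (T ! r)" using assms(1) by auto
    then have "map (removeAll m) (T[r := T ! r @ [m]]) = T"
      by (simp add: map_update unchanged)
    then show ?thesis using True unchanged by (simp add: remove_entry_def add_entry_def)
  next
    case False
    then show ?thesis using unchanged by (simp add: remove_entry_def add_entry_def)
  qed
qed

lemma remove_entry_tableau_of:
  assumes "yamanouchi (r # w)"
  shows "remove_entry (Suc (length w)) (tableau_of (r # w)) = tableau_of w"
proof -
  have "standard_tableau (length w) (tableau_of w)" using standard_tableau_of assms by simp
  then show ?thesis by (auto simp: standard_tableau_def intro!: remove_add_entry)
qed

lemma standard_tableau_is_tableau_of: "standard_tableau n T \<Longrightarrow> \<exists>w\<in>yamanouchi_words n. T = tableau_of w"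
proof (induction n arbitrary: T)
  case 0
  then have "set T \<subseteq> {[]}" "[] \<notin> set T" by (auto simp: standard_tableau_def)
  then have "T = []" by (cases T) auto
  then show ?case by simp
next
  case (Suc n)
  from standard_tableau_remove_last[OF Suc.prems] obtain r T' where
    T': "standard_tableau n T'" "addable (row_length T') r" "T = add_entry r (Suc n) T'" .
  from Suc.IH[OF T'(1)] obtain w where w: "w \<in> yamanouchi_words n" "T' = tableau_of w" by blast
  then have "r # w \<in> yamanouchi_words (Suc n)"
    using T'(2) tableau_of_shape(2)[of w] by (simp add: yamanouchi_words_def)
  moreover have "T = tableau_of (r # w)" using T'(3) w by (simp add: yamanouchi_words_def)
  ultimately show ?case by blast
qed

lemma standard_tableaux_eq: "{T. standard_tableau n T} = tableau_of ` yamanouchi_words n"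
  using standard_tableau_is_tableau_of standard_tableau_of by (auto simp: yamanouchi_words_def)

lemma inj_on_tableau_of: "inj_on tableau_of (yamanouchi_words n)"
proof (induction n)
  case (Suc n)
  show ?case
  proof (rule inj_onI)
    fix u v assume u: "u \<in> yamanouchi_words (Suc n)" and v: "v \<in> yamanouchi_words (Suc n)"
      and tableaux_eq: "tableau_of u = tableau_of v"
    obtain r u' s v' where uv: "u = r # u'" "v = s # v'"
      using u v by (cases u; cases v) (auto simp: yamanouchi_words_def)
    have yam: "yamanouchi (r # u')" "yamanouchi (s # v')" "length u' = n" "length v' = n"
      using u v uv by (auto simp: yamanouchi_words_def)
    have "tableau_of u' = tableau_of v'"
      using remove_entry_tableau_of[OF yam(1)] remove_entry_tableau_of[OF yam(2)] tableaux_eq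
      by (simp only: uv yam(3,4))
    then have same: "u' = v'" using inj_onD[OF Suc.IH, of u' v'] yam by (simp add: yamanouchi_words_def)
    have "shape u = shape v"
      using tableau_of_shape(2)[of u] tableau_of_shape(2)[of v] tableaux_eq u v
      by (simp add: yamanouchi_words_def)
    then have "shape (r # u') = shape (s # u')" by (simp only: uv same)
    then have "r = s" by (rule shape_Cons_eq_imp_same_row)
    then show "u = v" by (simp only: uv same)
  qed
qed simp

lemma standard_tableau_row_lengths_eq:
  assumes "standard_tableau n T" "standard_tableau n U" "tableau_shape T = tableau_shape U"
  shows "map length T = map length U"
proof -
  have "sorted (rev (map length T))" "sorted (rev (map length U))"
    using assms(1,2) unfolding standard_tableau_def sorted_wrt_rev by auto
  moreover have "mset (rev (map length T)) = mset (rev (map length U))"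
    using assms(3) by (simp add: tableau_shape_def)
  ultimately have "rev (map length T) = rev (map length U)"
    by (metis properties_for_sort)
  then show ?thesis by simp
qed

lemma row_length_eqD:
  assumes "[] \<notin> set T" "[] \<notin> set U" "row_length T = row_length U"
  shows "map length T = map length U"
proof (rule nth_equalityI)
  have "i < length T \<longleftrightarrow> i < length U" for i
    using row_length_pos_iff[OF assms(1), of i] row_length_pos_iff[OF assms(2), of i] assms(3) by simp
  then have len: "length T = length U" by (metis less_irrefl linorder_neqE_nat)
  then show "length (map length T) = length (map length U)" by simp
  show "map length T ! i = map length U ! i" if "i < length (map length T)" for i
    using that fun_cong[OF assms(3), of i] len by (simp add: row_length_def)
qed

lemma tableau_of_shape_eq_iff:
  assumes w: "w \<in> yamanouchi_words n" and v: "v \<in> yamanouchi_words n"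
  shows "tableau_shape (tableau_of v) = tableau_shape (tableau_of w) \<longleftrightarrow> shape v = shape w"
proof
  note yam = yamanouchi_wordsD[OF w] yamanouchi_wordsD[OF v]
  show "shape v = shape w" if "tableau_shape (tableau_of v) = tableau_shape (tableau_of w)"
  proof -
    have "map length (tableau_of v) = map length (tableau_of w)"
      using standard_tableau_row_lengths_eq[of n] standard_tableau_of yam that by metis
    then have "row_length (tableau_of v) = row_length (tableau_of w)"
      unfolding row_length_def fun_eq_iff by (metis length_map nth_map)
    then show ?thesis using tableau_of_shape(2) yam by simp
  qed
  show "tableau_shape (tableau_of v) = tableau_shape (tableau_of w)" if "shape v = shape w"
    using row_length_eqD[of "tableau_of v" "tableau_of w"] tableau_of_shape yam that
    by (simp add: tableau_shape_def)
qed

lemma standard_tableau_shape_partition: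
  assumes "standard_tableau n T"
  shows "tableau_shape T \<turnstile> n"
proof -
  have "sum_list (map length T) = length (concat T)" by (simp add: length_concat)
  also have "\<dots> = card (set (concat T))"
    by (rule distinct_card[symmetric]) (use assms in \<open>simp add: standard_tableau_def\<close>)
  also have "\<dots> = n" using assms by (simp add: standard_tableau_def del: set_concat)
  finally have "\<Sum>\<^sub># (tableau_shape T) = n" unfolding tableau_shape_def sum_mset_sum_list .
  moreover have "0 \<notin># tableau_shape T" using assms by (auto simp: tableau_shape_def standard_tableau_def)
  ultimately show ?thesis by (simp add: partition_of_def)
qed

lemma SYT_eq:
  assumes "\<mu> \<turnstile> n"
  shows "SYT \<mu> = tableau_of ` {w \<in> yamanouchi_words n. tableau_shape (tableau_of w) = \<mu>}"
proof -
  have "SYT \<mu> = {T \<in> {T. standard_tableau n T}. tableau_shape T = \<mu>}"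
    using assms by (auto simp: SYT_def partition_of_def)
  then show ?thesis unfolding standard_tableaux_eq by auto
qed

lemma num_SYT_tableau_of:
  assumes w: "w \<in> yamanouchi_words n"
  shows "num_SYT (tableau_shape (tableau_of w)) = card (words_of_shape n (shape w))"
proof -
  have "standard_tableau n (tableau_of w)" using standard_tableau_of[of w] yamanouchi_wordsD[OF w]
    by simp
  then have "SYT (tableau_shape (tableau_of w)) =
      tableau_of ` {v \<in> yamanouchi_words n. tableau_shape (tableau_of v) = tableau_shape (tableau_of w)}"
    by (intro SYT_eq standard_tableau_shape_partition)
  also have "{v \<in> yamanouchi_words n. tableau_shape (tableau_of v) = tableau_shape (tableau_of w)} =
      words_of_shape n (shape w)"
    using tableau_of_shape_eq_iff[OF w] unfolding words_of_shape_def by blast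
  finally show ?thesis
    unfolding num_SYT_def
    using card_image[OF inj_on_subset[OF inj_on_tableau_of words_of_shape_subset]] by simp
qed

lemma young_symmetrizer_tableau_of:
  assumes "w \<in> yamanouchi_words n"
  shows "young_symmetrizer n (tableau_of w) = to_alg ((1 / young_scalar w) \<star> young_product w)"
proof -
  note yam = yamanouchi_wordsD[OF assms]
  have "of_nat (num_SYT (tableau_shape (tableau_of w))) / fact n = 1 / young_scalar w"
    using young_scalar_mult_card_words_of_shape[OF assms] young_scalar_nonzero[OF yam(1)]
      num_SYT_tableau_of[OF assms]
    by (simp add: field_simps)
  then show ?thesis
    unfolding young_symmetrizer_def
    using row_symmetrizer_tableau_of[OF yam(1)] column_antisymmetrizer_tableau_of[OF yam(1)] yam(2)
    by (simp add: to_alg_mult symmetrizer_CSym antisymmetrizer_CSym to_alg_smult young_product_def)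
qed

lemma seminormal_unit_tableau_of:
  "w \<in> yamanouchi_words n \<Longrightarrow> seminormal_unit n (tableau_of w) = to_alg (seminormal w)"
proof (induction n arbitrary: w)
  case 0
  then show ?case by (simp add: to_alg_one[symmetric])
next
  case (Suc n)
  obtain r v where w: "w = r # v" using Suc.prems by (cases w) (auto simp: yamanouchi_words_def)
  have yam: "yamanouchi (r # v)" "length v = n" and v: "v \<in> yamanouchi_words n"
    using Suc.prems w by (auto simp: yamanouchi_words_def)
  let ?Y = "(1 / young_scalar w) \<star> young_product w"
  have "seminormal_unit n (remove_entry (Suc n) (tableau_of w)) = to_alg (seminormal v)"
    using remove_entry_tableau_of[OF yam(1)] Suc.IH[OF v] yam(2) w by (simp del: tableau_of.simps)
  then have "seminormal_unit (Suc n) (tableau_of w) =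
      to_alg (seminormal v) \<otimes>\<^bsub>sym_alg (Suc n)\<^esub> to_alg ?Y \<otimes>\<^bsub>sym_alg (Suc n)\<^esub> to_alg (seminormal v)"
    unfolding seminormal_unit.simps young_symmetrizer_tableau_of[OF Suc.prems] by (simp only:)
  also have "\<dots> = to_alg (seminormal v * ?Y * seminormal v)"
  proof -
    have "seminormal v \<in> CSym (Suc n)" by (rule CSym_SucI[OF seminormal_in_CSym[OF v]])
    moreover have "?Y \<in> CSym (Suc n)" using young_product_CSym[of w] yam(2) w by (simp add: CSym_scale)
    ultimately show ?thesis by (simp only: to_alg_mult CSym_mult)
  qed
  also have "seminormal v * ?Y * seminormal v = seminormal w" by (simp add: w scale_simps)
  finally show ?case .
qed

section \<open>Marked standard tableaux and generalized characters\<close>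

lemma marked_row_tableau_of_iff:
  assumes w: "w \<in> yamanouchi_words (Suc n)"
  shows "(\<exists>row\<in>set (tableau_of w). length row = j \<and> last row = Suc n) \<longleftrightarrow> shape w (hd w) = j"
proof -
  obtain r v where w_eq: "w = r # v" using w by (cases w) (auto simp: yamanouchi_words_def)
  have yam: "yamanouchi w" "length w = Suc n" "length v = n" using w w_eq
    by (auto simp: yamanouchi_words_def)
  have cell: "row_of w (Suc n) = r" "col_of w (Suc n) = shape v r" using yam(3) w_eq by auto
  let ?row = "tableau_of w ! r"
  have r: "r < length (tableau_of w)"
    using less_row_lengthD(1)[OF tableau_of_cell_in_row[OF yam(1), of "Suc n"]] yam(2) cell by simp
  have len: "length ?row = shape w r"
    using fun_cong[OF tableau_of_shape(2)[OF yam(1)], of r] r by (simp add: row_length_def)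
  have "?row ! shape v r = Suc n" using tableau_of_nth[OF yam(1), of "Suc n"] yam(2) cell by simp
  moreover have "length ?row = Suc (shape v r)" using len w_eq by simp
  ultimately have last: "last ?row = Suc n"
    by (metis diff_Suc_1 last_conv_nth length_0_conv nat.distinct(1))
  have unique: "row = ?row" if row: "row \<in> set (tableau_of w)" "last row = Suc n" for row
  proof -
    obtain i where i: "i < length (tableau_of w)" "row = tableau_of w ! i" using row(1)
      by (metis in_set_conv_nth)
    have "row \<noteq> []" using row(1) tableau_of_shape(1)[OF yam(1)] by auto
    then have "Suc n \<in> set (tableau_of w ! i)" using row(2) i(2) last_in_set by metis
    then show ?thesis using set_tableau_of_row[OF yam(1) i(1)] i cell by simp
  qed
  have "(\<exists>row\<in>set (tableau_of w). length row = j \<and> last row = Suc n) \<longleftrightarrow> length ?row = j"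
    using unique last r by (metis nth_mem)
  then show ?thesis using len by (simp only: w_eq list.sel)
qed

definition SYT_words :: "nat \<Rightarrow> nat multiset \<Rightarrow> nat \<Rightarrow> nat list set" where
  "SYT_words n \<mu> j = {w \<in> yamanouchi_words n. tableau_shape (tableau_of w) = \<mu> \<and> shape w (hd w) = j}"

lemma SYT_words_subset: "SYT_words n \<mu> j \<subseteq> yamanouchi_words n"
  by (auto simp: SYT_words_def)

lemma SYT_marked_eq: "SYT_marked (Suc n) \<mu> j = tableau_of ` SYT_words (Suc n) \<mu> j"
proof -
  have "SYT_marked (Suc n) \<mu> j = {T \<in> {T. standard_tableau (Suc n) T}. tableau_shape T = \<mu> \<and>
      (\<exists>row\<in>set T. length row = j \<and> last row = Suc n)}"
    by (auto simp: SYT_marked_def)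
  also have "\<dots> = tableau_of ` {w \<in> yamanouchi_words (Suc n). tableau_shape (tableau_of w) = \<mu> \<and>
      (\<exists>row\<in>set (tableau_of w). length row = j \<and> last row = Suc n)}"
    unfolding standard_tableaux_eq by blast
  also have "{w \<in> yamanouchi_words (Suc n). tableau_shape (tableau_of w) = \<mu> \<and>
      (\<exists>row\<in>set (tableau_of w). length row = j \<and> last row = Suc n)} = SYT_words (Suc n) \<mu> j"
    unfolding SYT_words_def by (intro Collect_cong conj_cong refl) (rule marked_row_tableau_of_iff)
  finally show ?thesis .
qed

lemma Gamma_elt_eq: "Gamma_elt (Suc n) \<mu> j = to_alg (\<Sum>w\<in>SYT_words (Suc n) \<mu> j. seminormal w)"
  unfolding Gamma_elt_def SYT_marked_eq
proof (rule finsum_to_alg)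
  show "inj_on tableau_of (SYT_words (Suc n) \<mu> j)"
    by (rule inj_on_subset[OF inj_on_tableau_of SYT_words_subset])
  show "finite (SYT_words (Suc n) \<mu> j)"
    by (rule finite_subset[OF SYT_words_subset finite_yamanouchi_words])
  fix w assume "w \<in> SYT_words (Suc n) \<mu> j"
  then have w: "w \<in> yamanouchi_words (Suc n)" using SYT_words_subset by blast
  show "seminormal w \<in> CSym (Suc n)" by (rule seminormal_in_CSym[OF w])
  show "seminormal_unit (Suc n) (tableau_of w) = to_alg (seminormal w)"
    by (rule seminormal_unit_tableau_of[OF w])
qed

lemma SYT_words_sum_commute:
  assumes "x \<in> CSym n"
  shows "(\<Sum>w\<in>SYT_words (Suc n) \<mu> j. seminormal w) * x = x * (\<Sum>w\<in>SYT_words (Suc n) \<mu> j. seminormal w)"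
proof (cases "SYT_words (Suc n) \<mu> j = {}")
  case False
  then obtain v where v: "v \<in> yamanouchi_words (Suc n)" "tableau_shape (tableau_of v) = \<mu>"
    by (auto simp: SYT_words_def)
  have "SYT_words (Suc n) \<mu> j = marked_words (Suc n) (shape v) j"
    using tableau_of_shape_eq_iff[OF v(1)] v(2)
    unfolding SYT_words_def marked_words_def words_of_shape_def by auto
  then show ?thesis using marked_words_sum_commute[OF assms] by simp
qed simp

lemma end_content_tableau_of:
  assumes w: "w \<in> yamanouchi_words (Suc n)"
  shows "end_content (tableau_shape (tableau_of w)) (shape w (hd w)) = last_content w"
proof -
  obtain r v where w_eq: "w = r # v" using w by (cases w) (auto simp: yamanouchi_words_def)
  let ?T = "tableau_of w" and ?j = "shape w r"
  have yam: "yamanouchi w" "yamanouchi v" using w w_eq by (auto simp: yamanouchi_words_def)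
  have j: "?j = Suc (shape v r)" using w_eq by simp
  have long_rows: "i < length ?T \<and> ?j \<le> length (?T ! i) \<longleftrightarrow> i \<le> r" for i
  proof -
    have "i < length ?T \<and> ?j \<le> length (?T ! i) \<longleftrightarrow> ?j \<le> row_length ?T i"
      by (auto simp: row_length_def j)
    also have "\<dots> \<longleftrightarrow> i \<le> r"
      unfolding tableau_of_shape(2)[OF yam(1)]
      using yamanouchi_antimono[OF yam(1), of i r] yamanouchi_antimono[OF yam(2), of r i]
      by (cases "i \<le> r") (auto simp: w_eq)
    finally show ?thesis .
  qed
  have "(\<Sum>k | k \<in># tableau_shape ?T \<and> ?j \<le> k. count (tableau_shape ?T) k) =
      size (filter_mset (\<lambda>k. ?j \<le> k) (tableau_shape ?T))"
    unfolding size_multiset_overloaded_eq by (rule sum.cong) auto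
  also have "\<dots> = length (filter (\<lambda>k. ?j \<le> k) (map length ?T))"
    unfolding tableau_shape_def mset_filter[symmetric] size_mset ..
  also have "\<dots> = card {i. i < length ?T \<and> ?j \<le> length (?T ! i)}"
    unfolding length_filter_conv_card by (metis (mono_tags, lifting) Collect_cong length_map nth_map)
  also have "\<dots> = Suc r" unfolding long_rows by (simp flip: atMost_def)
  finally show ?thesis by (simp add: end_content_def last_content_def w_eq j del: tableau_of.simps)
qed

lemma tableau_of_marked_partition:
  assumes "w \<in> yamanouchi_words (Suc n)"
  shows "(tableau_shape (tableau_of w), shape w (hd w)) \<in> marked_partitions (Suc n)"
proof -
  have yam: "yamanouchi w" "length w = Suc n" using yamanouchi_wordsD[OF assms] .
  have "hd w \<in> set w" using yam(2) by (cases w) auto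
  then have "0 < row_length (tableau_of w) (hd w)"
    unfolding tableau_of_shape(2)[OF yam(1)] by (metis count_list_0_iff gr0I)
  then have "row_length (tableau_of w) (hd w) \<in># tableau_shape (tableau_of w)"
    by (auto simp: row_length_def tableau_shape_def split: if_splits)
  moreover have "standard_tableau (Suc n) (tableau_of w)" using standard_tableau_of[OF yam(1)] yam(2) by simp
  ultimately show ?thesis
    using standard_tableau_shape_partition
    by (simp add: marked_partitions_def tableau_of_shape(2)[OF yam(1)])
qed

lemma sum_marked_partitions_SYT_words:
  "(\<Sum>(\<mu>, j)\<in>marked_partitions (Suc n). \<Sum>w\<in>SYT_words (Suc n) \<mu> j. h w) =
    (\<Sum>w\<in>yamanouchi_words (Suc n). h w)"
proof -
  let ?p = "\<lambda>w. (tableau_shape (tableau_of w), shape w (hd w))"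
  have "(\<Sum>w\<in>yamanouchi_words (Suc n). h w) =
      (\<Sum>p\<in>marked_partitions (Suc n). \<Sum>w\<in>{w \<in> yamanouchi_words (Suc n). ?p w = p}. h w)"
    by (rule sum.group[symmetric])
      (use tableau_of_marked_partition finite_marked_partitions in auto)
  then show ?thesis by (simp add: SYT_words_def case_prod_unfold prod_eq_iff)
qed

lemma K_coeff_jucys_murphy_power:
  assumes "app a \<in> marked_class (Suc n) lam i"
  shows "K_coeff (Suc n) lam i (jucys_murphy (Suc n) [^]\<^bsub>sym_alg (Suc n)\<^esub> r) = coef (jm (Suc n) ^ r) a"
proof -
  have "jm (Suc n) ^ r * y = y * jm (Suc n) ^ r" if "y \<in> CSym n" for y
    using jm_commute[OF that] by (metis power_commuting_commutes)
  from K_coeff_to_alg[OF CSym_power[OF jm_CSym] this assms]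
  show ?thesis by (simp add: jucys_murphy_eq to_alg_power jm_CSym)
qed

lemma K_coeff_Gamma_elt:
  assumes "app a \<in> marked_class (Suc n) lam i"
  shows "K_coeff (Suc n) lam i (Gamma_elt (Suc n) \<mu> j) =
      (\<Sum>w\<in>SYT_words (Suc n) \<mu> j. coef (seminormal w) a)"
proof -
  have "(\<Sum>w\<in>SYT_words (Suc n) \<mu> j. seminormal w) \<in> CSym (Suc n)"
    using SYT_words_subset by (intro CSym_sum seminormal_in_CSym) blast
  from K_coeff_to_alg[OF this SYT_words_sum_commute assms]
  show ?thesis by (simp add: Gamma_elt_eq lookup_sum)
qed

text \<open>No tableau of shape \<open>\<mu>\<close> has to be exhibited: if there were none, both sides would vanish.\<close>

lemma weighted_gen_char_eq:
  assumes \<mu>: "\<mu> \<turnstile> Suc n" and a: "app a \<in> marked_class (Suc n) lam i"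
  shows "of_nat (num_SYT \<mu>) / fact (Suc n) * gen_char (Suc n) \<mu> j lam i =
    (\<Sum>w\<in>SYT_words (Suc n) \<mu> j. coef (seminormal w) a)"
proof (cases "num_SYT \<mu> = 0")
  case True
  then have "{w \<in> yamanouchi_words (Suc n). tableau_shape (tableau_of w) = \<mu>} = {}"
    unfolding num_SYT_def SYT_eq[OF \<mu>] by simp
  then have "SYT_words (Suc n) \<mu> j = {}" unfolding SYT_words_def by blast
  then show ?thesis using True by simp
next
  case False
  then show ?thesis by (simp add: gen_char_def K_coeff_Gamma_elt[OF a] del: fact_Suc)
qed

lemma jm_power_eq_sum_gen_char:
  assumes a: "app a \<in> marked_class (Suc n) lam i"
  shows "coef (jm (Suc n) ^ r) a = (\<Sum>(\<mu>, j)\<in>marked_partitions (Suc n).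
    of_nat (num_SYT \<mu>) / fact (Suc n) * gen_char (Suc n) \<mu> j lam i * of_int (end_content \<mu> j) ^ r)"
proof -
  have summand: "(\<Sum>w\<in>SYT_words (Suc n) \<mu> j. of_int (last_content w) ^ r * coef (seminormal w) a) =
      of_nat (num_SYT \<mu>) / fact (Suc n) * gen_char (Suc n) \<mu> j lam i * of_int (end_content \<mu> j) ^ r"
    if "\<mu> \<turnstile> Suc n" for \<mu> j
  proof -
    have "last_content w = end_content \<mu> j" if "w \<in> SYT_words (Suc n) \<mu> j" for w
      using that end_content_tableau_of[of w n] by (auto simp: SYT_words_def)
    then show ?thesis
      unfolding weighted_gen_char_eq[OF that a] sum_distrib_right
      by (intro sum.cong refl) (simp add: mult.commute)
  qed
  have "coef (jm (Suc n) ^ r) a =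
      (\<Sum>w\<in>yamanouchi_words (Suc n). of_int (last_content w) ^ r * coef (seminormal w) a)"
    unfolding jm_power by (simp add: lookup_sum)
  also have "\<dots> = (\<Sum>(\<mu>, j)\<in>marked_partitions (Suc n).
      \<Sum>w\<in>SYT_words (Suc n) \<mu> j. of_int (last_content w) ^ r * coef (seminormal w) a)"
    by (rule sum_marked_partitions_SYT_words[symmetric])
  also have "\<dots> = (\<Sum>(\<mu>, j)\<in>marked_partitions (Suc n).
      of_nat (num_SYT \<mu>) / fact (Suc n) * gen_char (Suc n) \<mu> j lam i * of_int (end_content \<mu> j) ^ r)"
    by (intro sum.cong refl) (auto simp only: marked_partitions_def summand split: prod.split)
  finally show ?thesis .
qed

theorem theorem4p1:
  fixes n r i :: nat and lam :: "nat multiset" and \<pi> :: "nat \<Rightarrow> nat"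
  assumes "lam \<turnstile> n" and "i \<in># lam" and "r \<ge> 1" and "\<pi> \<in> marked_class n lam i"
  shows "of_nat (card {\<tau>s. length \<tau>s = r \<and> set \<tau>s \<subseteq> star_transpositions n \<and> foldr (\<circ>) \<tau>s id = \<pi>})
           = K_coeff n lam i (jucys_murphy n [^]\<^bsub>sym_alg n\<^esub> r)
       \<and> K_coeff n lam i (jucys_murphy n [^]\<^bsub>sym_alg n\<^esub> r)
           = (\<Sum>(\<mu>, j)\<in>marked_partitions n.
                of_nat (num_SYT \<mu>) / fact n * gen_char n \<mu> j lam i * of_int (end_content \<mu> j) ^ r)"
proof -
  have "i \<noteq> 0" "i \<le> n" using assms(1,2) by (auto simp: partition_of_def dest: multi_member_split)
  then obtain m where n: "n = Suc m" by (cases n) auto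
  obtain a where a: "\<pi> = app a" using assms(4) by (auto simp: marked_class_def carrier_sym_group_app)
  have marked: "app a \<in> marked_class (Suc m) lam i" using assms(4) by (simp add: n a)
  show ?thesis
    unfolding n a card_star_factorizations K_coeff_jucys_murphy_power[OF marked]
    using jm_power_eq_sum_gen_char[OF marked] by (intro conjI refl)
qed

end
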